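(* Let $Q=(V,A)$, $V=\{1,\dots,n\}$, be a connected acyclic digraph (without multiple arrows) such that every vertex has degree at most $2$ in the underlying graph $\overline Q$. Then exactly one of the following holds. (a) $Q$ is not $2$-regular, $\overline Q$ is the path graph $\mathbb A_n$, and $Q$ is the Hasse digraph of $I_Q$, which is positive with $\mathrm{Dyn}_{I_Q}=\mathbb A_n$. (b) $Q$ is $2$-regular and $\overline Q$ is a cycle. Moreover: (b1) if $Q$ has exactly one sink, then (i) if $Q\simeq\overline{\mathbb A}_{n-1,1}$, then $\mathrm{Dyn}_{I_Q}=\mathbb A_n$, $I_Q$ is positive and $\mathcal H(I_Q)\ne Q$; (ii) if $Q\simeq\overline{\mathbb A}_{n-2,2}$, then $\mathrm{Dyn}_{I_Q}=\mathbb D_n$, $I_Q$ is positive and $\mathcal H(I_Q)=Q$; (iii) if $Q\simeq \overline{\mathbb A}_{3,3},\overline{\mathbb A}_{4,3},\overline{\mathbb A}_{5,3}$, then $\mathcal H(I_Q)=Q$, $I_Q$ is positive and $\mathrm{Dyn}_{I_Q}=\mathbb E_6,\mathbb E_7,\mathbb E_8$ respectively; if $Q\simeq\overline{\mathbb A}_{4,4},\overline{\mathbb A}_{6,3}$, then $\mathcal H(I_Q)=Q$, $I_Q$ is principal and $\mathrm{Dyn}_{I_Q}=\mathbb E_7,\mathbb E_8$ respectively; (iv) otherwise $I_Q$ is indefinite; (b2) if $Q$ has more than one sink, then $I_Q$ is principal, $\mathrm{Dyn}_{I_Q}=\mathbb A_{n-1}$ and $\mathcal H(I_Q)=Q$.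
   Context: For an acyclic digraph $Q$ on $\{1,\dots,n\}$, $I_Q$ is the poset with $a\preceq b$ iff there is a directed path from $a$ to $b$ in $Q$ (including $a=b$). For $1\le r\le p$ and $n=p+r\ge3$, $\overline{\mathbb A}_{p,r}$ is the digraph on $\{1,\dots,n\}$ with arrows $1\to2\to\cdots\to p\to n$ and $1\to p+1\to p+2\to\cdots\to p+r-1\to n$ (two directed chains from $1$ to $n$ with $p$ and $r$ arrows; for $r=1$ the second is the single arrow $1\to n$). A digraph is $2$-regular if every vertex has degree $2$ in the underlying graph; a sink is a vertex that is the tail of no arrow. For a poset $I$: $C_I=[c_{ij}]$, $c_{ij}=1$ iff $i\preceq_I j$; $G_I=\tfrac12(C_I+C_I^{tr})$; $q_I(v)=vG_Iv^{tr}$; $I$ is non-negative of corank $r$ if $G_I$ is positive semi-definite of rank $n-r$, positive if corank $0$, principal if corank $1$, indefinite if $G_I$ is neither positive nor negative semi-definite. $\mathcal H(I)$: arrow $i\to j$ iff $i\prec_I j$ with nothing strictly between. Dynkin graphs: $\mathbb A_m$ path on $m$ vertices; $\mathbb D_m$ path on $m-1$ vertices plus a vertex attached to the second; $\mathbb E_6,\mathbb E_7,\mathbb E_8$ trees with one branch vertex and arms of $1,2,2$ / $1,2,3$ / $1,2,4$ vertices; for a graph $\Gamma$ on $m$ vertices $G_\Gamma=E_m-\tfrac12\mathrm{Adj}(\Gamma)$. Dynkin type of a connected non-negative $I$ of corank $r$: $\mathrm{Ker}\,q_I=\{v\in\mathbb Z^n:q_I(v)=0\}$ has a $\mathbb Z$-basis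 $h^{(1)},\dots,h^{(r)}$ with $h^{(i)}_{k_j}=\delta_{ij}$ for some $k_1<\dots<k_r$; $I'=I\setminus\{k_1,\dots,k_r\}$ is connected positive with $G_{I'}=B^{tr}G_DB$, $B\in GL(n-r,\mathbb Z)$, for a unique Dynkin graph $D$; $\mathrm{Dyn}_I:=D$. *)

theory Defs
  imports Complex_Main "Jordan_Normal_Form.DL_Rank"
begin

section \<open>Digraphs on {1..n}\<close>

text \<open>A digraph Q on the vertex set {1..n} is a set A of arrows (pairs of vertices).
  Multiple arrows are excluded automatically since A is a set.\<close>

definition digraph_on :: "nat \<Rightarrow> (nat \<times> nat) set \<Rightarrow> bool" where
  "digraph_on n A \<longleftrightarrow> A \<subseteq> {1..n} \<times> {1..n}"

text \<open>Neighbours of v in the underlying graph and degree of v.\<close>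
definition nbrs :: "(nat \<times> nat) set \<Rightarrow> nat \<Rightarrow> nat set" where
  "nbrs A v = {u. (u, v) \<in> A \<or> (v, u) \<in> A}"

definition degree :: "(nat \<times> nat) set \<Rightarrow> nat \<Rightarrow> nat" where
  "degree A v = card (nbrs A v)"

text \<open>Edge set of the underlying (undirected) graph.\<close>
definition uedges :: "(nat \<times> nat) set \<Rightarrow> nat set set" where
  "uedges A = {{i, j} | i j. (i, j) \<in> A}"

text \<open>Connectedness of the underlying graph of an arrow set E on a vertex set S.\<close>
definition uconnected :: "nat set \<Rightarrow> (nat \<times> nat) set \<Rightarrow> bool" where
  "uconnected S E \<longleftrightarrow>
     (\<forall>x\<in>S. \<forall>y\<in>S. (x, y) \<in> ((E \<union> E\<inverse>) \<inter> (S \<times> S))\<^sup>*)"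

definition two_regular :: "nat \<Rightarrow> (nat \<times> nat) set \<Rightarrow> bool" where
  "two_regular n A \<longleftrightarrow> (\<forall>v\<in>{1..n}. degree A v = 2)"

definition is_sink :: "(nat \<times> nat) set \<Rightarrow> nat \<Rightarrow> bool" where
  "is_sink A v \<longleftrightarrow> (\<forall>u. (v, u) \<notin> A)"

definition sinks :: "nat \<Rightarrow> (nat \<times> nat) set \<Rightarrow> nat set" where
  "sinks n A = {v \<in> {1..n}. is_sink A v}"

text \<open>The underlying graph is the path graph A_n (up to relabelling of vertices).\<close>
definition underlying_is_path :: "nat \<Rightarrow> (nat \<times> nat) set \<Rightarrow> bool" where
  "underlying_is_path n A \<longleftrightarrow>
     (\<exists>\<sigma>. bij_betw \<sigma> {1..n} {1..n} \<and>
          uedges A = {{\<sigma> i, \<sigma> (i + 1)} | i. 1 \<le> i \<and> i < n})"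

text \<open>The underlying graph is a cycle on all n vertices (n \<ge> 3).\<close>
definition underlying_is_cycle :: "nat \<Rightarrow> (nat \<times> nat) set \<Rightarrow> bool" where
  "underlying_is_cycle n A \<longleftrightarrow> 3 \<le> n \<and>
     (\<exists>\<sigma>. bij_betw \<sigma> {1..n} {1..n} \<and>
          uedges A = {{\<sigma> i, \<sigma> (i + 1)} | i. 1 \<le> i \<and> i < n} \<union> {{\<sigma> n, \<sigma> 1}})"

text \<open>Arrows of a directed path given by the list of its vertices.\<close>
definition path_arrows :: "nat list \<Rightarrow> (nat \<times> nat) set" where
  "path_arrows xs = set (zip xs (tl xs))"

text \<open>The digraph \<open>\<overline>\<bbbA>\<^sub>p\<^sub>,\<^sub>r\<close> on {1..p+r}: chains
  1 \<rightarrow> 2 \<rightarrow> ... \<rightarrow> p \<rightarrow> n and 1 \<rightarrow> p+1 \<rightarrow> ... \<rightarrow> p+r-1 \<rightarrow> n, where n = p + r.\<close>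
definition Abar :: "nat \<Rightarrow> nat \<Rightarrow> (nat \<times> nat) set" where
  "Abar p r = path_arrows ([1..<p+1] @ [p + r]) \<union> path_arrows (1 # [p+1..<p+r] @ [p + r])"

text \<open>Q (on {1..n}) is isomorphic to \<open>\<overline>\<bbbA>\<^sub>p\<^sub>,\<^sub>r\<close>, where 1 \<le> r \<le> p, n = p + r \<ge> 3.\<close>
definition iso_Abar :: "nat \<Rightarrow> (nat \<times> nat) set \<Rightarrow> nat \<Rightarrow> nat \<Rightarrow> bool" where
  "iso_Abar n A p r \<longleftrightarrow> 1 \<le> r \<and> r \<le> p \<and> p + r = n \<and> 3 \<le> n \<and>
     (\<exists>\<sigma>. bij_betw \<sigma> {1..n} {1..n} \<and>
          (\<forall>i\<in>{1..n}. \<forall>j\<in>{1..n}. (i, j) \<in> A \<longleftrightarrow> (\<sigma> i, \<sigma> j) \<in> Abar p r))"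

section \<open>Posets\<close>

text \<open>The poset I_Q: a \<preceq> b iff there is a directed path from a to b (including a = b).\<close>
definition poset_of :: "(nat \<times> nat) set \<Rightarrow> nat \<Rightarrow> nat \<Rightarrow> bool" where
  "poset_of A a b \<longleftrightarrow> (a, b) \<in> A\<^sup>*"

text \<open>Hasse digraph of a poset (given by its order relation) on the finite set S.\<close>
definition hasse :: "nat set \<Rightarrow> (nat \<Rightarrow> nat \<Rightarrow> bool) \<Rightarrow> (nat \<times> nat) set" where
  "hasse S po = {(i, j). i \<in> S \<and> j \<in> S \<and> i \<noteq> j \<and> po i j \<and>
      \<not> (\<exists>k\<in>S. k \<noteq> i \<and> k \<noteq> j \<and> po i k \<and> po k j)}"

text \<open>A poset is connected iff its Hasse digraph is connected.\<close>
definition poset_connected :: "nat set \<Rightarrow> (nat \<Rightarrow> nat \<Rightarrow> bool) \<Rightarrow> bool" where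
  "poset_connected S po \<longleftrightarrow> uconnected S (hasse S po)"

text \<open>Incidence matrix C_I and symmetric Gram matrix G_I = (C_I + C_I^tr)/2 of the poset
  restricted to the finite set S; rows/columns are indexed (0-based) by the elements of S
  in increasing order.\<close>
definition incidence_on :: "nat set \<Rightarrow> (nat \<Rightarrow> nat \<Rightarrow> bool) \<Rightarrow> real mat" where
  "incidence_on S po = mat (card S) (card S)
     (\<lambda>(a, b). if po (sorted_list_of_set S ! a) (sorted_list_of_set S ! b) then 1 else 0)"

definition gram_on :: "nat set \<Rightarrow> (nat \<Rightarrow> nat \<Rightarrow> bool) \<Rightarrow> real mat" where
  "gram_on S po = (1/2) \<cdot>\<^sub>m (incidence_on S po + transpose_mat (incidence_on S po))"

text \<open>Quadratic form q(v) = v G v^tr.\<close>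
definition qform :: "real mat \<Rightarrow> real vec \<Rightarrow> real" where
  "qform G v = v \<bullet> (G *\<^sub>v v)"

definition psd :: "real mat \<Rightarrow> bool" where
  "psd G \<longleftrightarrow> (\<forall>v \<in> carrier_vec (dim_row G). qform G v \<ge> 0)"

definition nsd :: "real mat \<Rightarrow> bool" where
  "nsd G \<longleftrightarrow> (\<forall>v \<in> carrier_vec (dim_row G). qform G v \<le> 0)"

text \<open>I is non-negative of corank r: G_I positive semi-definite of rank |I| - r.\<close>
definition nonneg_corank :: "nat set \<Rightarrow> (nat \<Rightarrow> nat \<Rightarrow> bool) \<Rightarrow> nat \<Rightarrow> bool" where
  "nonneg_corank S po r \<longleftrightarrow> r \<le> card S \<and> psd (gram_on S po) \<and>
     vec_space.rank (card S) (gram_on S po) = card S - r"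

definition poset_positive :: "nat set \<Rightarrow> (nat \<Rightarrow> nat \<Rightarrow> bool) \<Rightarrow> bool" where
  "poset_positive S po \<longleftrightarrow> nonneg_corank S po 0"

definition poset_principal :: "nat set \<Rightarrow> (nat \<Rightarrow> nat \<Rightarrow> bool) \<Rightarrow> bool" where
  "poset_principal S po \<longleftrightarrow> nonneg_corank S po 1"

definition poset_indefinite :: "nat set \<Rightarrow> (nat \<Rightarrow> nat \<Rightarrow> bool) \<Rightarrow> bool" where
  "poset_indefinite S po \<longleftrightarrow> \<not> psd (gram_on S po) \<and> \<not> nsd (gram_on S po)"

section \<open>Dynkin graphs\<close>

datatype dynkin = DA nat | DD nat | DE6 | DE7 | DE8

definition dyn_size :: "dynkin \<Rightarrow> nat" where
  "dyn_size D = (case D of DA m \<Rightarrow> m | DD m \<Rightarrow> m | DE6 \<Rightarrow> 6 | DE7 \<Rightarrow> 7 | DE8 \<Rightarrow> 8)"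

text \<open>Edges of the Dynkin graphs on vertices 0..m-1.
  A_m: path; D_m: path 0..m-2 plus vertex m-1 attached to the second vertex 1;
  E_6,E_7,E_8: branch vertex 0 with arms [1], [2,3], [4,5,...] of 1, 2 and 2/3/4 vertices.\<close>
definition dyn_edges :: "dynkin \<Rightarrow> (nat \<times> nat) set" where
  "dyn_edges D = (case D of
      DA m \<Rightarrow> {(i, i + 1) | i. i + 1 < m}
    | DD m \<Rightarrow> {(i, i + 1) | i. i + 2 < m} \<union> {(1, m - 1)}
    | DE6 \<Rightarrow> {(0,1), (0,2), (2,3), (0,4), (4,5)}
    | DE7 \<Rightarrow> {(0,1), (0,2), (2,3), (0,4), (4,5), (5,6)}
    | DE8 \<Rightarrow> {(0,1), (0,2), (2,3), (0,4), (4,5), (5,6), (6,7)})"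

definition dyn_adj :: "dynkin \<Rightarrow> real mat" where
  "dyn_adj D = mat (dyn_size D) (dyn_size D)
     (\<lambda>(i, j). if (i, j) \<in> dyn_edges D \<or> (j, i) \<in> dyn_edges D then 1 else 0)"

text \<open>G_\<Gamma> = E_m - 1/2 Adj(\<Gamma>).\<close>
definition dyn_gram :: "dynkin \<Rightarrow> real mat" where
  "dyn_gram D = 1\<^sub>m (dyn_size D) - (1/2) \<cdot>\<^sub>m dyn_adj D"

text \<open>B \<in> GL(m, \<int>).\<close>
definition GL_int :: "nat \<Rightarrow> int mat \<Rightarrow> bool" where
  "GL_int m B \<longleftrightarrow> B \<in> carrier_mat m m \<and> (\<exists>B'. B' \<in> carrier_mat m m \<and> B * B' = 1\<^sub>m m \<and> B' * B = 1\<^sub>m m)"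

text \<open>Integer kernel Ker q_I = {v \<in> \<int>^|I| . q_I(v) = 0}.\<close>
definition int_kernel :: "nat set \<Rightarrow> (nat \<Rightarrow> nat \<Rightarrow> bool) \<Rightarrow> int vec set" where
  "int_kernel S po = {v \<in> carrier_vec (card S). qform (gram_on S po) (map_vec real_of_int v) = 0}"

text \<open>Dyn_I = D, following the definition of the paper: I is connected non-negative of some
  corank r, Ker q_I has a \<int>-basis h(0),...,h(r-1) with h(i)_{k_j} = \<delta>_ij for vertices
  k_0 < ... < k_{r-1} of I, the poset I' = I \ {k_0,...,k_{r-1}} is connected positive and
  G_{I'} = B^tr G_D B for some B \<in> GL(|I| - r, \<int>).  (Vertex k corresponds to the position of k
  in the increasing enumeration of S.)\<close>
definition has_dynkin_type :: "nat set \<Rightarrow> (nat \<Rightarrow> nat \<Rightarrow> bool) \<Rightarrow> dynkin \<Rightarrow> bool" where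
  "has_dynkin_type S po D \<longleftrightarrow> poset_connected S po \<and>
     (\<exists>r. nonneg_corank S po r \<and>
       (\<exists>k :: nat \<Rightarrow> nat. \<exists>h :: nat \<Rightarrow> int vec.
          (\<forall>i<r. k i \<in> S) \<and> (\<forall>i j. i < j \<and> j < r \<longrightarrow> k i < k j) \<and>
          (\<forall>i<r. h i \<in> int_kernel S po) \<and>
          (\<forall>i<r. \<forall>j<r. h i $ (card {x \<in> S. x < k j}) = (if i = j then 1 else 0)) \<and>
          (\<forall>c :: nat \<Rightarrow> int. finsum_vec TYPE(int) (card S) (\<lambda>i. c i \<cdot>\<^sub>v h i) {..<r} = 0\<^sub>v (card S)
               \<longrightarrow> (\<forall>i<r. c i = 0)) \<and>
          (\<forall>v\<in>int_kernel S po. \<exists>c :: nat \<Rightarrow> int.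
               v = finsum_vec TYPE(int) (card S) (\<lambda>i. c i \<cdot>\<^sub>v h i) {..<r}) \<and>
          (let S' = S - k ` {..<r} in
             poset_connected S' po \<and> poset_positive S' po \<and>
             dyn_size D = card S' \<and>
             (\<exists>B. GL_int (card S') B \<and>
                gram_on S' po = transpose_mat (map_mat real_of_int B) * dyn_gram D * map_mat real_of_int B))))"

end

theory Submission
  imports Defs "Jordan_Normal_Form.DL_Rank_Submatrix" "HOL-Number_Theory.Cong"
begin

text \<open>A connected graph of maximal degree two is a path or a cycle, so everything reduces to the
  quadratic forms of two families of posets.

  For an oriented path, send the \<open>i\<close>-th vertex to \<open>\<plusminus>(z i - z (p i))\<close>, where \<open>p i < i\<close> is the first
  vertex of the maximal directed segment arriving at \<open>i\<close> and the sign is the direction of that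
  segment. These are roots of type \<open>A\<^sub>n\<close> forming a basis of the root lattice, and their inner products
  are exactly the comparabilities of the poset. For a cycle with at least two sinks, cut at a
  sink \<open>n\<close>, the same works with \<open>z n\<close> identified with \<open>z 0\<close>, which makes the \<open>n\<close> vectors satisfy one
  linear relation.

  A cycle with one sink is a union of two chains of \<open>p\<close> and \<open>r\<close> arrows with common minimum \<open>a\<close> and
  maximum \<open>b\<close>. Completing squares turns twice its form into squares plus
  \<open>(1/p + 1/r - 1/2) (a + b)\<^sup>2\<close>, which decides definiteness; the roots \<open>a - b\<close> (branch vertex), \<open>- a\<close>,
  and the successive differences along the interiors of the two chains, starting with \<open>b\<close>, form a
  star with arms of \<open>1\<close>, \<open>p - 1\<close> and \<open>r - 1\<close> vertices.\<close>

section \<open>Quadratic forms of finite posets\<close>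

text \<open>Gram matrices, ranks and \<open>GL_int\<close> refer to the increasing enumeration of
  the vertex set, which isomorphisms of posets need not respect. The work is therefore done with the
  form \<open>qf\<close> on functions of the vertices and with the bundles
  \<open>positive_type\<close> and \<open>principal_type\<close>, which are invariant under
  \<open>poset_iso\<close>; matrices return only where rank and Dynkin type are deduced from these
  bundles. Semidefiniteness is always read off a sum of squares. A null vector \<open>h\<close>
  spans the whole kernel once the form is definite off a vertex \<open>k\<close> with
  \<open>h k = 1\<close>, and this normalisation makes \<open>h\<close> a generator over the
  integers as well. Cutting a cycle at a sink fixes the directions of both edges at the cut. The cut
  vertex is the only sink exactly when the edge directions, read along the cut cycle, change once,
  from down to up. Otherwise no vertex other than the cut reaches it along both arcs, and this is
  what makes the inner products right. The exceptional pairs are the solutions of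
  \<open>1/p + 1/r \<ge> 1/2\<close> with \<open>r \<le> p\<close>: all with \<open>r = 1\<close> or
  \<open>r = 2\<close>, then (3,3), (4,3), (5,3), and equality at (4,4) and (6,3).\<close>

definition qf :: "nat set \<Rightarrow> (nat \<Rightarrow> nat \<Rightarrow> bool) \<Rightarrow> (nat \<Rightarrow> real) \<Rightarrow> real" where
  "qf S po x = (\<Sum>s\<in>S. \<Sum>t\<in>S. if po s t then x s * x t else 0)"

text \<open>Written as a count because \<open>has_dynkin_type\<close> names the position of a vertex
  \<open>k\<close> by \<open>card {x \<in> S. x < k}\<close>; on \<open>S\<close> it inverts the
  increasing enumeration.\<close>

definition pos_of :: "nat set \<Rightarrow> nat \<Rightarrow> nat" where
  "pos_of S s = card {x \<in> S. x < s}"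

definition fun_of :: "nat set \<Rightarrow> 'a vec \<Rightarrow> nat \<Rightarrow> 'a" where
  "fun_of S v s = v $ pos_of S s"

definition vec_of :: "nat set \<Rightarrow> (nat \<Rightarrow> 'a) \<Rightarrow> 'a vec" where
  "vec_of S x = vec (card S) (\<lambda>i. x (sorted_list_of_set S ! i))"

lemma vec_of_carrier [simp]: "vec_of S x \<in> carrier_vec (card S)"
  by (simp add: vec_of_def)

lemma dim_vec_of [simp]: "dim_vec (vec_of S x) = card S"
  by (simp add: vec_of_def)

lemma bij_enum:
  assumes "finite S"
  shows "bij_betw (\<lambda>i. sorted_list_of_set S ! i) {..<card S} S"
  using bij_betw_nth[of "sorted_list_of_set S" "{..<card S}" S] assms by simp

lemma enum_mem: "finite S \<Longrightarrow> i < card S \<Longrightarrow> sorted_list_of_set S ! i \<in> S"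
  using bij_enum bij_betwE by fastforce

lemma pos_of_enum:
  assumes "finite S" "i < card S"
  shows "pos_of S (sorted_list_of_set S ! i) = i"
proof -
  let ?f = "\<lambda>i. sorted_list_of_set S ! i"
  have mono: "?f j < ?f i \<longleftrightarrow> j < i" if "j < card S" for j
  proof
    assume "j < i"
    then show "?f j < ?f i"
      using strict_sorted_list_of_set[of S] assms by (simp add: sorted_wrt_nth_less)
  next
    assume a: "?f j < ?f i"
    show "j < i"
    proof (rule ccontr)
      assume "\<not> j < i"
      then have "i \<le> j" by simp
      then have "?f i \<le> ?f j"
        using sorted_nth_mono[of "sorted_list_of_set S" i j] that assms by simp
      with a show False by simp
    qed
  qed
  have "{x \<in> S. x < ?f i} = ?f ` {..<i}"
  proof (intro equalityI subsetI)
    fix x assume x: "x \<in> {x \<in> S. x < ?f i}"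
    then have "x \<in> ?f ` {..<card S}"
      using bij_betw_imp_surj_on[OF bij_enum[OF assms(1)]] by auto
    then obtain j where "j < card S" "x = ?f j" by auto
    with x mono show "x \<in> ?f ` {..<i}" by auto
  next
    fix x assume "x \<in> ?f ` {..<i}"
    then obtain j where j: "j < i" "x = ?f j" by auto
    then show "x \<in> {x \<in> S. x < ?f i}"
      using mono[of j] assms by (auto intro: enum_mem)
  qed
  moreover have "inj_on ?f {..<i}"
    by (rule inj_on_subset[OF bij_betw_imp_inj_on[OF bij_enum[OF assms(1)]]]) (use assms(2) in auto)
  ultimately show ?thesis
    by (simp add: pos_of_def card_image)
qed

lemma pos_of_less:
  assumes "finite S" "s \<in> S"
  shows "pos_of S s < card S"
  unfolding pos_of_def using assms by (intro psubset_card_mono) auto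

lemma enum_pos_of:
  assumes "finite S" "s \<in> S"
  shows "sorted_list_of_set S ! pos_of S s = s"
proof -
  have "s \<in> (\<lambda>i. sorted_list_of_set S ! i) ` {..<card S}"
    using bij_betw_imp_surj_on[OF bij_enum[OF assms(1)]] assms(2) by simp
  then obtain i where "i < card S" "s = sorted_list_of_set S ! i" by auto
  with pos_of_enum[OF assms(1)] show ?thesis by simp
qed

lemma sum_enum:
  assumes "finite S"
  shows "(\<Sum>i<card S. f (sorted_list_of_set S ! i)) = sum f S"
  using sum.reindex_bij_betw[OF bij_enum[OF assms]] by blast

lemma vec_of_fun_of:
  assumes "finite S" "v \<in> carrier_vec (card S)"
  shows "vec_of S (fun_of S v) = v"
  using assms by (intro eq_vecI) (auto simp: vec_of_def fun_of_def pos_of_enum)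

lemma fun_of_vec_of:
  assumes "finite S" "s \<in> S"
  shows "fun_of S (vec_of S x) s = x s"
  using assms by (simp add: vec_of_def fun_of_def pos_of_less enum_pos_of)

lemma gram_carrier [simp]: "gram_on S po \<in> carrier_mat (card S) (card S)"
  by (simp add: gram_on_def incidence_on_def)

lemma gram_dims [simp]: "dim_row (gram_on S po) = card S" "dim_col (gram_on S po) = card S"
  by (simp_all add: gram_on_def incidence_on_def)

lemma gram_index:
  assumes "i < card S" "j < card S"
  shows "gram_on S po $$ (i, j) =
    (of_bool (po (sorted_list_of_set S ! i) (sorted_list_of_set S ! j)) +
     of_bool (po (sorted_list_of_set S ! j) (sorted_list_of_set S ! i))) / 2"
  using assms by (simp add: gram_on_def incidence_on_def)

lemma qform_sum:
  assumes "G \<in> carrier_mat m m" "v \<in> carrier_vec m"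
  shows "qform G v = (\<Sum>i<m. \<Sum>j<m. G $$ (i, j) * v $ i * v $ j)"
  using assms
  by (auto simp: qform_def scalar_prod_def sum_distrib_left mult_ac atLeast0LessThan
      intro!: sum.cong)

text \<open>\<open>qf\<close> sums over ordered comparabilities, while \<open>gram_on\<close>
  averages the incidence matrix with its transpose. Exchanging the two summation indices shows that
  the average has the same quadratic form.\<close>

lemma qf_sym:
  "qf S po x = (\<Sum>s\<in>S. \<Sum>t\<in>S. (of_bool (po s t) + of_bool (po t s)) / 2 * x s * x t)"
proof -
  have "(\<Sum>s\<in>S. \<Sum>t\<in>S. of_bool (po t s) * x s * x t) = (\<Sum>s\<in>S. \<Sum>t\<in>S. of_bool (po s t) * x s * x t)"
    by (subst sum.swap) (simp add: mult_ac)
  moreover have "qf S po x = (\<Sum>s\<in>S. \<Sum>t\<in>S. of_bool (po s t) * x s * x t)"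
    by (auto simp: qf_def intro!: sum.cong)
  moreover have "(\<Sum>s\<in>S. \<Sum>t\<in>S. (of_bool (po s t) + of_bool (po t s)) / 2 * x s * x t) =
      ((\<Sum>s\<in>S. \<Sum>t\<in>S. of_bool (po s t) * x s * x t) +
       (\<Sum>s\<in>S. \<Sum>t\<in>S. of_bool (po t s) * x s * x t)) / 2"
    unfolding sum_divide_distrib sum.distrib [symmetric]
    by (intro sum.cong refl) (simp add: field_simps)
  ultimately show ?thesis by simp
qed

lemma qf_cong:
  assumes "\<And>s. s \<in> S \<Longrightarrow> x s = y s"
  shows "qf S po x = qf S po y"
  unfolding qf_def by (intro sum.cong refl) (simp add: assms)

lemma qform_gram_vec_of:
  assumes "finite S"
  shows "qform (gram_on S po) (vec_of S x) = qf S po x"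
proof -
  let ?f = "\<lambda>i. sorted_list_of_set S ! i"
  let ?g = "\<lambda>s t. (of_bool (po s t) + of_bool (po t s)) / 2 * x s * x t"
  have "qform (gram_on S po) (vec_of S x) = (\<Sum>i<card S. \<Sum>j<card S. ?g (?f i) (?f j))"
    by (subst qform_sum[of _ "card S"]) (auto simp: gram_index vec_of_def intro!: sum.cong)
  also have "\<dots> = (\<Sum>i<card S. \<Sum>t\<in>S. ?g (?f i) t)"
    by (intro sum.cong refl sum_enum assms)
  also have "\<dots> = (\<Sum>s\<in>S. \<Sum>t\<in>S. ?g s t)"
    by (rule sum_enum[OF assms])
  finally show ?thesis by (simp add: qf_sym)
qed

lemma qform_gram:
  assumes "finite S" "v \<in> carrier_vec (card S)"
  shows "qform (gram_on S po) v = qf S po (fun_of S v)"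
  using qform_gram_vec_of[OF assms(1), of po "fun_of S v"] vec_of_fun_of[OF assms] by simp

definition qf_psd :: "nat set \<Rightarrow> (nat \<Rightarrow> nat \<Rightarrow> bool) \<Rightarrow> bool" where
  "qf_psd S po \<longleftrightarrow> (\<forall>x. 0 \<le> qf S po x)"

text \<open>Only anisotropy; positivity comes from \<open>qf_psd\<close>. The two are kept apart
  because in corank one semidefiniteness holds on all of \<open>S\<close>, but anisotropy only after
  a vertex is deleted.\<close>

definition qf_definite :: "nat set \<Rightarrow> (nat \<Rightarrow> nat \<Rightarrow> bool) \<Rightarrow> bool" where
  "qf_definite S po \<longleftrightarrow> (\<forall>x. qf S po x = 0 \<longrightarrow> (\<forall>s\<in>S. x s = 0))"

lemma psd_gram_iff:
  assumes "finite S"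
  shows "psd (gram_on S po) \<longleftrightarrow> qf_psd S po"
proof
  assume *: "psd (gram_on S po)"
  have "0 \<le> qf S po x" for x
    using * vec_of_carrier[of S x] qform_gram_vec_of[OF assms, of po x] 
    unfolding psd_def gram_dims by metis
  then show "qf_psd S po" by (simp add: qf_psd_def)
qed (auto simp: psd_def qf_psd_def qform_gram[OF assms])

lemma poset_indefiniteI:
  assumes "finite S" "qf S po x < 0" "qf S po y > 0"
  shows "poset_indefinite S po"
proof -
  have "qform (gram_on S po) (vec_of S x) < 0" "qform (gram_on S po) (vec_of S y) > 0"
    using assms by (simp_all add: qform_gram_vec_of)
  then show ?thesis
    unfolding poset_indefinite_def psd_def nsd_def gram_dims
    by (meson leD vec_of_carrier)
qed

lemma gram_kernel_qform:
  assumes "gram_on S po *\<^sub>v v = 0\<^sub>v (card S)" "v \<in> carrier_vec (card S)"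
  shows "qform (gram_on S po) v = 0"
  using assms by (simp add: qform_def)

lemma vec_eq_zeroI:
  fixes v :: "'a::zero vec"
  assumes "finite S" "v \<in> carrier_vec (card S)" "\<And>s. s \<in> S \<Longrightarrow> fun_of S v s = 0"
  shows "v = 0\<^sub>v (card S)"
proof (rule eq_vecI)
  fix i assume "i < dim_vec (0\<^sub>v (card S) :: 'a vec)"
  then have i: "i < card S" by simp
  with assms(3)[OF enum_mem[OF assms(1) i]] pos_of_enum[OF assms(1) i]
  show "v $ i = 0\<^sub>v (card S) $ i" by (simp add: fun_of_def)
qed (use assms in auto)

text \<open>A kernel vector of the Gram matrix is isotropic, hence zero; so the determinant does not
  vanish and the rank is full.\<close>

lemma poset_positiveI:
  assumes "finite S" "qf_psd S po" "qf_definite S po"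
  shows "poset_positive S po"
proof -
  have "det (gram_on S po) \<noteq> 0"
  proof
    assume "det (gram_on S po) = 0"
    then obtain v where v: "v \<in> carrier_vec (card S)" "v \<noteq> 0\<^sub>v (card S)"
      "gram_on S po *\<^sub>v v = 0\<^sub>v (card S)"
      using det_0_iff_vec_prod_zero_field[OF gram_carrier] by blast
    have "qf S po (fun_of S v) = 0"
      using gram_kernel_qform[OF v(3,1)] qform_gram[OF assms(1) v(1)] by simp
    then have "fun_of S v s = 0" if "s \<in> S" for s
      using assms(3) that by (auto simp: qf_definite_def)
    with vec_eq_zeroI[OF assms(1) v(1)] v(2) show False by blast
  qed
  then have "vec_space.rank (card S) (gram_on S po) = card S"
    using vec_space.low_rank_det_zero[OF gram_carrier] by blast
  with assms show ?thesis
    by (simp add: poset_positive_def nonneg_corank_def psd_gram_iff)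
qed

subsection \<open>Polarisation\<close>

text \<open>Twice the symmetric bilinear form of \<open>qf\<close>, so that \<open>qf_linear\<close>
  carries no factor 2.\<close>

definition bf :: "nat set \<Rightarrow> (nat \<Rightarrow> nat \<Rightarrow> bool) \<Rightarrow> (nat \<Rightarrow> real) \<Rightarrow> (nat \<Rightarrow> real) \<Rightarrow> real" where
  "bf S po x y = (\<Sum>s\<in>S. \<Sum>t\<in>S. if po s t then x s * y t + x t * y s else 0)"

lemma qf_linear:
  "qf S po (\<lambda>s. x s + c * y s) = qf S po x + c * bf S po x y + c\<^sup>2 * qf S po y"
  unfolding qf_def bf_def sum_distrib_left sum.distrib [symmetric]
  by (intro sum.cong refl) (simp add: power2_eq_square algebra_simps)

text \<open>Near \<open>c = 0\<close> a nonzero linear term dominates and makes the expression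
  negative on one side.\<close>

lemma psd_quadratic_zero:
  fixes a b :: real
  assumes "\<And>c. 0 \<le> c * b + c\<^sup>2 * a"
  shows "b = 0"
proof (rule ccontr)
  assume b: "b \<noteq> 0"
  \<comment> \<open>Chosen so that \<open>k * a < 1\<close>: at \<open>c = - k * b\<close> the
    expression equals \<open>k * b^2 * (k * a - 1)\<close>, which is negative for nonzero
    \<open>b\<close>.\<close>
  define k where "k = 1 / (\<bar>a\<bar> + 1)"
  have k: "0 < k" "k * \<bar>a\<bar> < 1" by (auto simp: k_def field_simps)
  have "0 \<le> (- k * b) * b + (- k * b)\<^sup>2 * a" by (rule assms)
  also have "\<dots> = (k * b\<^sup>2) * (k * a - 1)" by (simp add: power2_eq_square algebra_simps)
  finally have "0 \<le> k * a - 1"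
    using k(1) b mult_pos_neg[of "k * b\<^sup>2" "k * a - 1"] by (force simp: not_less [symmetric])
  moreover have "k * a \<le> k * \<bar>a\<bar>" using k by simp
  ultimately show False using k by linarith
qed

text \<open>A null vector of a semidefinite form lies in its radical, because on
  \<open>h + c x\<close> the form is a quadratic in \<open>c\<close> without constant term.\<close>

lemma qf_psd_null_add:
  assumes "qf_psd S po" "qf S po h = 0"
  shows "qf S po (\<lambda>s. x s + c * h s) = qf S po x"
proof -
  have "bf S po h x = 0"
  proof (rule psd_quadratic_zero)
    fix c
    have "0 \<le> qf S po (\<lambda>s. h s + c * x s)" using assms(1) by (simp add: qf_psd_def)
    then show "0 \<le> c * bf S po h x + c\<^sup>2 * qf S po x" by (simp add: qf_linear assms(2))
  qed
  moreover have "bf S po h x = bf S po x h"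
    unfolding bf_def by (intro sum.cong refl) simp
  ultimately show ?thesis by (simp add: qf_linear assms(2))
qed

section \<open>Null vectors, deletion of a vertex, and corank one\<close>

lemma qf_remove:
  assumes "finite S" "x k = 0"
  shows "qf S po x = qf (S - {k}) po x"
proof (cases "k \<in> S")
  case True
  have *: "(\<Sum>t\<in>S. if po s t then x s * x t else 0) = (\<Sum>t\<in>S - {k}. if po s t then x s * x t else 0)" for s
    using sum.remove[OF assms(1) True, of "\<lambda>t. if po s t then x s * x t else 0"] assms(2) by simp
  show ?thesis
    unfolding qf_def * by (subst sum.remove[OF assms(1) True]) (simp add: assms(2) cong: if_cong)
qed simp

text \<open>Subtracting \<open>x k\<close> times \<open>h\<close> keeps \<open>x\<close> isotropic
  and makes its \<open>k\<close>-th value zero, so definiteness off \<open>k\<close> kills what is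
  left. The multiplier is the value \<open>x k\<close> itself, hence an integer whenever
  \<open>x\<close> is integral.\<close>

lemma qf_psd_line:
  assumes "finite S" "qf_psd S po" "qf S po h = 0" "h k = 1" "qf_definite (S - {k}) po"
    "qf S po x = 0" "s \<in> S"
  shows "x s = x k * h s"
proof -
  let ?y = "\<lambda>s. x s + (- x k) * h s"
  have "qf S po ?y = 0" using qf_psd_null_add[OF assms(2,3), of x "- x k"] assms(6) by simp
  then have "qf (S - {k}) po ?y = 0" using qf_remove[OF assms(1), of ?y k po] assms(4) by simp
  then have "\<forall>s\<in>S - {k}. ?y s = 0" using assms(5) unfolding qf_definite_def by blast
  then show ?thesis using assms(4,7) by (cases "s = k") auto
qed

lemma qf_psd_remove:
  assumes "finite S" "qf_psd S po"
  shows "qf_psd (S - {k}) po"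
  unfolding qf_psd_def
proof
  fix x
  have "qf (S - {k}) po x = qf (S - {k}) po (x(k := 0))" by (rule qf_cong) auto
  also have "\<dots> = qf S po (x(k := 0))" using qf_remove[OF assms(1), of "x(k := 0)" k po] by simp
  finally show "0 \<le> qf (S - {k}) po x" using assms(2) by (simp add: qf_psd_def)
qed

text \<open>The radical argument for matrices, tested against unit vectors: a vanishing determinant
  needs a genuine kernel vector and not merely an isotropic one.\<close>

lemma qform_null_imp_kernel:
  assumes G: "(G :: real mat) \<in> carrier_mat m m" "psd G" "v \<in> carrier_vec m" "qform G v = 0"
    and sym: "transpose_mat G = G"
  shows "G *\<^sub>v v = 0\<^sub>v m"
proof (rule eq_vecI)
  fix i assume "i < dim_vec (0\<^sub>v m :: real vec)"
  then have i: "i < m" by simp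
  let ?u = "unit_vec m i"
  have u: "?u \<in> carrier_vec m" by simp
  have Gv: "G *\<^sub>v v \<in> carrier_vec m" and Gu: "G *\<^sub>v ?u \<in> carrier_vec m"
    using G by auto
  have sw: "v \<bullet> (G *\<^sub>v ?u) = ?u \<bullet> (G *\<^sub>v v)"
  proof -
    have "v \<bullet> (G *\<^sub>v ?u) = (transpose_mat G *\<^sub>v v) \<bullet> ?u"
      using transpose_vec_mult_scalar[of G m m ?u v] G(1,3) u by simp
    also have "\<dots> = ?u \<bullet> (G *\<^sub>v v)"
      unfolding sym by (rule comm_scalar_prod[OF Gv u])
    finally show ?thesis .
  qed
  have "2 * (?u \<bullet> (G *\<^sub>v v)) = 0"
  proof (rule psd_quadratic_zero)
    fix c
    have "0 \<le> qform G (v + c \<cdot>\<^sub>v ?u)"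
      using G(1,2,3) by (simp add: psd_def)
    also have "\<dots> = qform G v + c * (2 * (?u \<bullet> (G *\<^sub>v v))) + c\<^sup>2 * qform G ?u"
      using G(1,3) u Gv Gu sw
      by (simp add: qform_def mult_add_distrib_mat_vec[of G m m] mult_mat_vec[of G m m]
          scalar_prod_add_distrib[of _ m] add_scalar_prod_distrib[of _ m]
          smult_scalar_prod_distrib[of _ m] scalar_prod_smult_distrib[of _ m]
          power2_eq_square algebra_simps)
    finally show "0 \<le> c * (2 * (?u \<bullet> (G *\<^sub>v v))) + c\<^sup>2 * qform G ?u" by (simp add: G(4))
  qed
  then have "?u \<bullet> (G *\<^sub>v v) = 0" by simp
  then show "(G *\<^sub>v v) $ i = 0\<^sub>v m $ i"
    using i Gv by (simp add: scalar_prod_left_unit[OF Gv])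
qed (use G in auto)

lemma gram_sym: "transpose_mat (gram_on S po) = gram_on S po"
  by (intro eq_matI) (auto simp: gram_index add.commute)

text \<open>The null vector makes the determinant vanish, so the rank is below
  \<open>card S\<close>. Conversely, adding the square of the \<open>k\<close>-th coordinate gives
  an anisotropic form; as this summand has rank at most one, subadditivity bounds the rank from
  below by \<open>card S - 1\<close>.\<close>

lemma nonneg_corank_1I:
  assumes S: "finite S" "qf_psd S po" "qf S po h = 0" "k \<in> S" "h k = 1"
    and def: "qf_definite (S - {k}) po"
  shows "nonneg_corank S po 1"
proof -
  let ?m = "card S" and ?G = "gram_on S po"
  define f where "f i = (if i = pos_of S k then 1 else 0 :: real)" for i
  \<comment> \<open>The Gram matrix of \<open>(x k)^2\<close>, written as a product
    \<open>f i * f j\<close> to expose that its rank is at most one.\<close>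
  define E where "E = mat ?m ?m (\<lambda>(i, j). f i * f j)"
  have E: "E \<in> carrier_mat ?m ?m" by (simp add: E_def)
  have psdG: "psd ?G" using S by (simp add: psd_gram_iff)
  have "det ?G = 0"
  proof -
    have "vec_of S h \<noteq> 0\<^sub>v ?m"
    proof
      assume "vec_of S h = 0\<^sub>v ?m"
      then have "fun_of S (vec_of S h) k = 0" using S by (simp add: fun_of_def pos_of_less)
      then show False using fun_of_vec_of[OF S(1,4), of h] S(5) by simp
    qed
    moreover have "?G *\<^sub>v vec_of S h = 0\<^sub>v ?m"
      by (rule qform_null_imp_kernel) (auto simp: psdG gram_sym qform_gram_vec_of S)
    ultimately show ?thesis
      using det_0_iff_vec_prod_zero_field[OF gram_carrier] vec_of_carrier by blast
  qed
  then have upper: "vec_space.rank ?m ?G < ?m"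
    using vec_space.det_zero_low_rank[OF gram_carrier] by blast
  have GE: "?G + E \<in> carrier_mat ?m ?m" using E by simp
  have "det (?G + E) \<noteq> 0"
  proof
    assume "det (?G + E) = 0"
    then obtain v where v: "v \<in> carrier_vec ?m" "v \<noteq> 0\<^sub>v ?m" "(?G + E) *\<^sub>v v = 0\<^sub>v ?m"
      using det_0_iff_vec_prod_zero_field[OF GE] by blast
    define x where "x = fun_of S v"
    have pk: "pos_of S k < ?m" using S by (simp add: pos_of_less)
    have delta: "(\<Sum>j<?m. f j * c j) = c (pos_of S k)" for c
    proof -
      have "(\<Sum>j<?m. f j * c j) = (\<Sum>j<?m. if j = pos_of S k then c j else 0)"
        by (intro sum.cong) (auto simp: f_def)
      then show ?thesis using pk by simp
    qed
    have "qform E v = (\<Sum>i<?m. f i * v $ i * (\<Sum>j<?m. f j * v $ j))"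
      by (subst qform_sum[OF E v(1)]) (auto simp: E_def sum_distrib_left mult_ac intro!: sum.cong)
    also have "(\<Sum>j<?m. f j * v $ j) = x k"
      by (simp add: delta x_def fun_of_def)
    also have "(\<Sum>i<?m. f i * v $ i * x k) = x k * x k"
      by (simp add: delta mult.assoc) (simp add: x_def fun_of_def)
    finally have qE: "qform E v = x k * x k" .
    have "0 = qform (?G + E) v" using v by (simp add: qform_def)
    also have "\<dots> = qform ?G v + qform E v"
      using add_mult_distrib_mat_vec[OF gram_carrier E v(1), of po]
        scalar_prod_add_distrib[OF v(1) mult_mat_vec_carrier[OF gram_carrier v(1)] mult_mat_vec_carrier[OF E v(1)], of po]
      by (simp add: qform_def)
    also have "\<dots> = qf S po x + x k * x k"
      using qE qform_gram[OF S(1) v(1)] by (simp add: x_def)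
    finally have *: "0 = qf S po x + x k * x k" .
    moreover have "0 \<le> qf S po x" using S(2) by (simp add: qf_psd_def)
    ultimately have xk: "x k = 0" and "qf S po x = 0"
      using zero_le_square[of "x k"] by (auto simp: add_nonneg_eq_0_iff)
    then have "x s = 0" if "s \<in> S" for s
      using qf_psd_line[of S po h k x s] S def that by simp
    with vec_eq_zeroI[OF S(1) v(1)] v(2) show False by (simp add: x_def)
  qed
  then have "?m = vec_space.rank ?m (?G + E)"
    using vec_space.low_rank_det_zero[OF GE] by simp
  also have "\<dots> \<le> vec_space.rank ?m ?G + vec_space.rank ?m E"
    by (rule vec_space.rank_subadditive[OF gram_carrier E])
  also have "vec_space.rank ?m E \<le> 1"
    by (rule vec_space.rank_le_1_product_entries[OF E, of f f]) (simp add: E_def)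
  finally show ?thesis
    using upper psdG by (simp add: nonneg_corank_def)
qed

section \<open>Integral equivalence with Dynkin forms\<close>

definition dq :: "dynkin \<Rightarrow> (nat \<Rightarrow> real) \<Rightarrow> real" where
  "dq D y = (\<Sum>j<dyn_size D. (y j)\<^sup>2) - (\<Sum>(j, k)\<in>dyn_edges D. y j * y k)"

text \<open>Each undirected edge is stored once, in increasing order, which makes \<open>dq\<close>
  agree with the form of the symmetric adjacency matrix. Degenerate graphs such as
  \<open>DD 2\<close>, whose extra edge would be a loop, are excluded.\<close>

definition dyn_wf :: "dynkin \<Rightarrow> bool" where
  "dyn_wf D \<longleftrightarrow> (\<forall>(j, k)\<in>dyn_edges D. j < k \<and> k < dyn_size D)"

text \<open>The columns of \<open>b'\<close> are simple roots written in the basis of vertices, and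
  \<open>b j s\<close> is the coordinate of the vertex \<open>s\<close> along the
  \<open>j\<close>-th simple root. A one-sided inverse suffices because the matrices are
  square.\<close>

definition dyn_equiv :: "nat set \<Rightarrow> (nat \<Rightarrow> nat \<Rightarrow> bool) \<Rightarrow> dynkin \<Rightarrow> bool" where
  "dyn_equiv S po D \<longleftrightarrow> card S = dyn_size D \<and> dyn_wf D \<and>
     (\<exists>b b' :: nat \<Rightarrow> nat \<Rightarrow> int.
        (\<forall>j<dyn_size D. \<forall>k<dyn_size D. (\<Sum>s\<in>S. b j s * b' s k) = of_bool (j = k)) \<and>
        (\<forall>x. qf S po x = dq D (\<lambda>j. \<Sum>s\<in>S. real_of_int (b j s) * x s)))"

lemma dyn_gram_carrier [simp]: "dyn_gram D \<in> carrier_mat (dyn_size D) (dyn_size D)"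
  by (auto simp: dyn_gram_def dyn_adj_def intro!: carrier_matI)

lemma qform_dyn_gram:
  assumes "dyn_wf D" "v \<in> carrier_vec (dyn_size D)"
  shows "qform (dyn_gram D) v = dq D (\<lambda>j. v $ j)"
proof -
  let ?m = "dyn_size D" and ?E = "dyn_edges D"
  let ?f = "\<lambda>i j. v $ i * v $ j"
  have E: "?E \<subseteq> {..<?m} \<times> {..<?m}" "\<And>i j. (i, j) \<in> ?E \<Longrightarrow> i < j"
    using assms(1) by (fastforce simp: dyn_wf_def)+
  have half: "(\<Sum>i<?m. \<Sum>j<?m. of_bool ((i, j) \<in> ?E) * ?f i j) = (\<Sum>(i, j)\<in>?E. ?f i j)"
  proof -
    have "(\<Sum>i<?m. \<Sum>j<?m. of_bool ((i, j) \<in> ?E) * ?f i j) =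
        (\<Sum>p\<in>{..<?m} \<times> {..<?m}. if p \<in> ?E then (case p of (i, j) \<Rightarrow> ?f i j) else 0)"
      unfolding sum.cartesian_product by (intro sum.cong) auto
    also have "\<dots> = (\<Sum>p\<in>({..<?m} \<times> {..<?m}) \<inter> ?E. case p of (i, j) \<Rightarrow> ?f i j)"
      by (rule sum.inter_restrict [symmetric]) simp
    also have "({..<?m} \<times> {..<?m}) \<inter> ?E = ?E" using E by auto
    finally show ?thesis .
  qed
  have half': "(\<Sum>i<?m. \<Sum>j<?m. of_bool ((j, i) \<in> ?E) * ?f i j) = (\<Sum>(i, j)\<in>?E. ?f i j)"
    unfolding half [symmetric] by (subst sum.swap) (simp add: mult_ac)
  have "qform (dyn_gram D) v = (\<Sum>i<?m. \<Sum>j<?m. of_bool (i = j) * ?f i j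
      - (of_bool ((i, j) \<in> ?E) * ?f i j + of_bool ((j, i) \<in> ?E) * ?f i j) / 2)"
  proof (subst qform_sum[OF dyn_gram_carrier assms(2)], intro sum.cong refl)
    fix i j assume ij: "i \<in> {..<?m}" "j \<in> {..<?m}"
    consider "i = j" "(i, j) \<notin> ?E" "(j, i) \<notin> ?E" | "i \<noteq> j" "(i, j) \<in> ?E" "(j, i) \<notin> ?E"
      | "i \<noteq> j" "(i, j) \<notin> ?E" "(j, i) \<in> ?E" | "i \<noteq> j" "(i, j) \<notin> ?E" "(j, i) \<notin> ?E"
      using E(2) by (metis less_asym less_irrefl)
    then show "dyn_gram D $$ (i, j) * v $ i * v $ j = of_bool (i = j) * ?f i j
      - (of_bool ((i, j) \<in> ?E) * ?f i j + of_bool ((j, i) \<in> ?E) * ?f i j) / 2"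
      using ij by cases (simp_all add: dyn_gram_def dyn_adj_def)
  qed
  also have "\<dots> = (\<Sum>i<?m. \<Sum>j<?m. of_bool (i = j) * ?f i j)
      - ((\<Sum>i<?m. \<Sum>j<?m. of_bool ((i, j) \<in> ?E) * ?f i j) +
         (\<Sum>i<?m. \<Sum>j<?m. of_bool ((j, i) \<in> ?E) * ?f i j)) / 2"
    unfolding sum.distrib [symmetric] sum_divide_distrib sum_subtractf [symmetric] ..
  also have "(\<Sum>i<?m. \<Sum>j<?m. of_bool (i = j) * ?f i j) = (\<Sum>i<?m. (v $ i)\<^sup>2)"
  proof (intro sum.cong refl)
    fix i assume "i \<in> {..<?m}"
    moreover have "(\<Sum>j<?m. of_bool (i = j) * ?f i j) = (\<Sum>j<?m. if i = j then ?f i j else 0)"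
      by (intro sum.cong) auto
    ultimately show "(\<Sum>j<?m. of_bool (i = j) * ?f i j) = (v $ i)\<^sup>2"
      by (simp add: power2_eq_square)
  qed
  finally show ?thesis unfolding half half' by (simp add: dq_def)
qed

text \<open>Polarisation: an entry of a symmetric matrix is determined by the values of its form at
  two unit vectors and at their sum.\<close>

lemma sym_mat_eqI:
  fixes M N :: "real mat"
  assumes M: "M \<in> carrier_mat m m" "transpose_mat M = M"
    and N: "N \<in> carrier_mat m m" "transpose_mat N = N"
    and eq: "\<And>v. v \<in> carrier_vec m \<Longrightarrow> qform M v = qform N v"
  shows "M = N"
proof -
  have entry: "G $$ (i, j) = (qform G (unit_vec m i + unit_vec m j)
      - qform G (unit_vec m i) - qform G (unit_vec m j)) / 2"
    if G: "G \<in> carrier_mat m m" "transpose_mat G = G" and ij: "i < m" "j < m"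
    for G :: "real mat" and i j
  proof -
    have u: "unit_vec m i \<bullet> (G *\<^sub>v unit_vec m j) = G $$ (i, j)" if "i < m" "j < m" for i j
      using G(1) that by simp
    have "G $$ (j, i) = G $$ (i, j)"
      using G ij by (metis carrier_matD index_transpose_mat(1))
    with u[of i j] u[of j i] u[of i i] u[of j j] ij G(1) show ?thesis
      by (simp add: qform_def mult_add_distrib_mat_vec[of G m m]
          scalar_prod_add_distrib[of _ m] add_scalar_prod_distrib[of _ m])
  qed
  show ?thesis
  proof (rule eq_matI)
    fix i j assume "i < dim_row N" "j < dim_col N"
    with N have "i < m" "j < m" by auto
    with entry[OF M, of i j] entry[OF N, of i j] eq show "M $$ (i, j) = N $$ (i, j)" by simp
  qed (use M N in auto)
qed

text \<open>Over the reals a right inverse of a square matrix is a left inverse; the identity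
  returns to the integers because the embedding is injective.\<close>

lemma int_mat_left_inverse:
  fixes B B' :: "int mat"
  assumes "B \<in> carrier_mat m m" "B' \<in> carrier_mat m m" "B * B' = 1\<^sub>m m"
  shows "B' * B = 1\<^sub>m m"
proof -
  let ?R = "map_mat real_of_int"
  have "?R B * ?R B' = ?R (B * B')"
    by (rule of_int_hom.mat_hom_mult[OF assms(1,2), symmetric])
  then have "?R B' * ?R B = 1\<^sub>m m"
    using assms mat_mult_left_right_inverse[of "?R B" m "?R B'"]
    by (simp add: of_int_hom.mat_hom_one)
  moreover have "?R (B' * B) = ?R B' * ?R B"
    by (rule of_int_hom.mat_hom_mult[OF assms(2,1)])
  ultimately have "?R (B' * B) = ?R (1\<^sub>m m)"
    by (simp add: of_int_hom.mat_hom_one)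
  then show ?thesis using of_int_hom.mat_hom_inj by blast
qed

text \<open>Enumerating the columns of \<open>b\<close> along \<open>S\<close> gives
  \<open>B\<close>. Both sides are symmetric matrices, so it is enough to compare quadratic
  forms.\<close>

lemma dyn_equiv_mat:
  assumes "finite S" "dyn_equiv S po D"
  shows "\<exists>B. GL_int (card S) B \<and>
    gram_on S po = transpose_mat (map_mat real_of_int B) * dyn_gram D * map_mat real_of_int B"
proof -
  let ?m = "card S" and ?f = "\<lambda>i. sorted_list_of_set S ! i"
  from assms(2) obtain b b' :: "nat \<Rightarrow> nat \<Rightarrow> int" where
    m: "card S = dyn_size D" and wf: "dyn_wf D"
    and inv: "\<forall>j<dyn_size D. \<forall>k<dyn_size D. (\<Sum>s\<in>S. b j s * b' s k) = of_bool (j = k)"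
    and q: "\<forall>x. qf S po x = dq D (\<lambda>j. \<Sum>s\<in>S. real_of_int (b j s) * x s)"
    unfolding dyn_equiv_def by blast
  define B where "B = mat ?m ?m (\<lambda>(j, i). b j (?f i))"
  define B' where "B' = mat ?m ?m (\<lambda>(i, k). b' (?f i) k)"
  define R where "R = map_mat real_of_int B"
  have BB: "B \<in> carrier_mat ?m ?m" "B' \<in> carrier_mat ?m ?m" by (simp_all add: B_def B'_def)
  have "B * B' = 1\<^sub>m ?m"
  proof (rule eq_matI)
    fix j k assume "j < dim_row (1\<^sub>m ?m :: int mat)" "k < dim_col (1\<^sub>m ?m :: int mat)"
    then have jk: "j < ?m" "k < ?m" by auto
    have "(B * B') $$ (j, k) = (\<Sum>i<?m. b j (?f i) * b' (?f i) k)"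
      using jk BB by (simp add: scalar_prod_def B_def B'_def atLeast0LessThan)
    also have "\<dots> = (\<Sum>s\<in>S. b j s * b' s k)" by (rule sum_enum[OF assms(1)])
    finally show "(B * B') $$ (j, k) = 1\<^sub>m ?m $$ (j, k)" using inv jk by (simp add: m)
  qed (use BB in auto)
  with int_mat_left_inverse[OF BB] BB have GL: "GL_int ?m B"
    by (auto simp: GL_int_def)
  have R: "R \<in> carrier_mat ?m ?m" using BB by (simp add: R_def)
  have Gd: "dyn_gram D \<in> carrier_mat ?m ?m" by (simp add: m)
  have sym: "transpose_mat (dyn_gram D) = dyn_gram D"
    by (intro eq_matI) (auto simp: dyn_gram_def dyn_adj_def)
  have "gram_on S po = transpose_mat R * dyn_gram D * R"
  proof (rule sym_mat_eqI[of _ ?m])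
    show "transpose_mat (transpose_mat R * dyn_gram D * R) = transpose_mat R * dyn_gram D * R"
      using R Gd sym
      by (simp add: transpose_mult[of _ ?m ?m _ ?m] assoc_mult_mat[of _ ?m ?m _ ?m _ ?m])
    fix v :: "real vec" assume v: "v \<in> carrier_vec ?m"
    have Rv: "R *\<^sub>v v \<in> carrier_vec ?m" using R v by simp
    have "qform (transpose_mat R * dyn_gram D * R) v = v \<bullet> (transpose_mat R *\<^sub>v (dyn_gram D *\<^sub>v (R *\<^sub>v v)))"
      using R Gd v Rv
      by (simp add: qform_def assoc_mult_mat_vec[of _ ?m ?m _ ?m])
    also have "\<dots> = (R *\<^sub>v v) \<bullet> (dyn_gram D *\<^sub>v (R *\<^sub>v v))"
      using transpose_vec_mult_scalar[of "transpose_mat R" ?m ?m "dyn_gram D *\<^sub>v (R *\<^sub>v v)" v]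
        R Gd v Rv by simp
    also have "\<dots> = dq D (\<lambda>j. (R *\<^sub>v v) $ j)"
      using qform_dyn_gram[OF wf, of "R *\<^sub>v v"] Rv by (simp add: qform_def m)
    also have "\<dots> = dq D (\<lambda>j. \<Sum>s\<in>S. real_of_int (b j s) * fun_of S v s)"
    proof -
      have Rv_j: "(R *\<^sub>v v) $ j = (\<Sum>s\<in>S. real_of_int (b j s) * fun_of S v s)" if "j < ?m" for j
      proof -
        have "(R *\<^sub>v v) $ j = (\<Sum>i<?m. real_of_int (b j (?f i)) * fun_of S v (?f i))"
          using that R v BB assms(1)
          by (auto simp: scalar_prod_def R_def B_def atLeast0LessThan fun_of_def pos_of_enum intro!: sum.cong)
        also have "\<dots> = (\<Sum>s\<in>S. real_of_int (b j s) * fun_of S v s)"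
          by (rule sum_enum[OF assms(1)])
        finally show ?thesis .
      qed
      \<comment> \<open>\<open>dyn_wf D\<close> keeps every edge in range, so \<open>dq\<close>
        never looks at vector entries beyond the dimension, which are unspecified.\<close>
      have dq_cong: "dq D y = dq D z" if "\<And>j. j < ?m \<Longrightarrow> y j = z j" for y z
        using that wf unfolding dq_def dyn_wf_def
        by (intro arg_cong2[of _ _ _ _ "(-)"] sum.cong) (fastforce simp: m)+
      show ?thesis by (rule dq_cong) (rule Rv_j)
    qed
    also have "\<dots> = qform (gram_on S po) v" by (simp add: q qform_gram[OF assms(1) v])
    finally show "qform (gram_on S po) v = qform (transpose_mat R * dyn_gram D * R) v" ..
  qed (use R Gd gram_sym in auto)
  with GL show ?thesis by (auto simp: R_def)
qed

section \<open>Dynkin types deduced from forms on functions\<close>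

lemma fun_of_map_vec:
  "finite S \<Longrightarrow> s \<in> S \<Longrightarrow> v \<in> carrier_vec (card S) \<Longrightarrow> fun_of S (map_vec f v) s = f (fun_of S v s)"
  by (simp add: fun_of_def pos_of_less)

lemma int_kernel_iff:
  assumes "finite S"
  shows "v \<in> int_kernel S po \<longleftrightarrow> v \<in> carrier_vec (card S) \<and> qf S po (\<lambda>s. real_of_int (fun_of S v s)) = 0"
proof (cases "v \<in> carrier_vec (card S)")
  case True
  have "qform (gram_on S po) (map_vec real_of_int v) = qf S po (fun_of S (map_vec real_of_int v))"
    using True by (intro qform_gram assms) simp
  also have "\<dots> = qf S po (\<lambda>s. real_of_int (fun_of S v s))"
    by (rule qf_cong) (rule fun_of_map_vec[OF assms _ True])
  finally show ?thesis using True by (simp add: int_kernel_def)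
qed (simp add: int_kernel_def)

text \<open>The corank is 0, the integral kernel is zero with the empty basis, and no vertex is
  deleted.\<close>

lemma has_dynkin_type_positiveI:
  assumes S: "finite S" and con: "poset_connected S po"
    and pd: "qf_psd S po" "qf_definite S po" and eqv: "dyn_equiv S po D"
  shows "has_dynkin_type S po D"
proof -
  have pos: "poset_positive S po" using assms by (intro poset_positiveI)
  have ker: "v = 0\<^sub>v (card S)" if "v \<in> int_kernel S po" for v
    using that pd(2) vec_eq_zeroI[OF S, of v] by (auto simp: int_kernel_iff[OF S] qf_definite_def)
  show ?thesis
    unfolding has_dynkin_type_def
    using pos con eqv dyn_equiv_mat[OF S eqv] ker
    by (intro conjI exI[of _ 0])
      (auto simp: poset_positive_def finsum_vec_empty dyn_equiv_def)
qed

text \<open>A single kernel vector \<open>h\<close> with \<open>h k = 1\<close> is a basis over the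
  integers: by \<open>qf_psd_line\<close> every integral null vector is its own \<open>k\<close>-th
  entry times \<open>h\<close>. The same \<open>k\<close> serves as the deleted vertex.\<close>

lemma has_dynkin_type_principalI:
  fixes h :: "nat \<Rightarrow> int"
  assumes S: "finite S" and con: "poset_connected S po" "poset_connected (S - {k}) po"
    and ker: "qf_psd S po" "qf S po (\<lambda>s. real_of_int (h s)) = 0" "k \<in> S" "h k = 1"
    and def: "qf_definite (S - {k}) po" and eqv: "dyn_equiv (S - {k}) po D"
  shows "has_dynkin_type S po D"
proof -
  let ?h = "\<lambda>s. real_of_int (h s)"
  have pos: "poset_positive (S - {k}) po"
    using S ker(1) def by (intro poset_positiveI qf_psd_remove) auto
  have cor: "nonneg_corank S po 1"
    using S ker def by (intro nonneg_corank_1I[of S po ?h k]) auto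
  have h_in: "vec_of S h \<in> int_kernel S po"
    using ker(2) qf_cong[of S "\<lambda>s. real_of_int (fun_of S (vec_of S h) s)" ?h po] S
    by (simp add: int_kernel_iff fun_of_vec_of)
  have hk: "vec_of S h $ card {x \<in> S. x < k} = 1"
    using fun_of_vec_of[OF S ker(3), of h] ker(4) by (simp add: fun_of_def pos_of_def)
  have single: "finsum_vec TYPE(int) (card S) (\<lambda>i. c i \<cdot>\<^sub>v vec_of S h) {..<Suc 0} = c 0 \<cdot>\<^sub>v vec_of S h" for c
  proof -
    have "{..<Suc 0} = {0::nat}" by auto
    moreover have fc: "(\<lambda>i. c i \<cdot>\<^sub>v vec_of S h) \<in> {..<Suc 0} \<rightarrow> carrier_vec (card S)" by simp
    ultimately show ?thesis
      using finsum_vec_closed[OF fc] index_finsum_vec[OF _ _ fc]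
      by (intro eq_vecI) simp_all
  qed
  have indep: "c 0 = 0" if "c 0 \<cdot>\<^sub>v vec_of S h = 0\<^sub>v (card S)" for c :: "nat \<Rightarrow> int"
  proof -
    have "(c 0 \<cdot>\<^sub>v vec_of S h) $ pos_of S k = 0"
      using that S ker(3) by (simp add: pos_of_less)
    then show ?thesis
      using hk S ker(3) pos_of_less[OF S ker(3)] by (simp add: pos_of_def)
  qed
  have gen: "\<exists>c. v = c 0 \<cdot>\<^sub>v vec_of S h" if v: "v \<in> int_kernel S po" for v
  proof -
    let ?x = "\<lambda>s. real_of_int (fun_of S v s)"
    have vc: "v \<in> carrier_vec (card S)" and "qf S po ?x = 0"
      using v by (auto simp: int_kernel_iff[OF S])
    then have "?x s = ?x k * ?h s" if "s \<in> S" for s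
      using qf_psd_line[of S po ?h k ?x s] S ker def that by simp
    then have x: "fun_of S v s = fun_of S v k * h s" if "s \<in> S" for s
      using that by (metis of_int_eq_iff of_int_mult)
    have "v = fun_of S v k \<cdot>\<^sub>v vec_of S h"
    proof (rule eq_vecI)
      fix i assume "i < dim_vec (fun_of S v k \<cdot>\<^sub>v vec_of S h)"
      then have i: "i < card S" by simp
      show "v $ i = (fun_of S v k \<cdot>\<^sub>v vec_of S h) $ i"
        using x[OF enum_mem[OF S i]] i pos_of_enum[OF S i]
        by (simp add: vec_of_def) (simp add: fun_of_def)
    qed (use vc in simp)
    then show ?thesis by (intro exI[of _ "\<lambda>_. fun_of S v k"])
  qed
  have img: "(\<lambda>_. k) ` {..<Suc 0} = {k}" by auto
  show ?thesis
    unfolding has_dynkin_type_def One_nat_def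
    apply (intro conjI con(1) exI[of _ "Suc 0"] exI[of _ "\<lambda>_. k"] exI[of _ "\<lambda>_. vec_of S h"])
    unfolding single img Let_def
    using cor ker(3) h_in hk indep gen con(2) pos eqv dyn_equiv_mat[OF _ eqv] S
    by (auto simp: dyn_equiv_def)
qed

section \<open>Posets up to isomorphism\<close>

lemma rtrancl_image:
  assumes "\<And>x y. (x, y) \<in> r \<Longrightarrow> (f x, f y) \<in> s" "(x, y) \<in> r\<^sup>*"
  shows "(f x, f y) \<in> s\<^sup>*"
  using assms(2) by induction (auto intro: assms(1) rtrancl_into_rtrancl)

text \<open>Connectedness through all comparabilities instead of covering relations: it can be
  checked directly from a formula for the order, and \<open>poset_connectedI\<close> converts it
  into connectedness of the Hasse digraph.\<close>

definition comp_connected :: "nat set \<Rightarrow> (nat \<Rightarrow> nat \<Rightarrow> bool) \<Rightarrow> bool" where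
  "comp_connected S po \<longleftrightarrow> uconnected S {(x, y). po x y}"

definition positive_type :: "nat set \<Rightarrow> (nat \<Rightarrow> nat \<Rightarrow> bool) \<Rightarrow> dynkin \<Rightarrow> bool" where
  "positive_type S po D \<longleftrightarrow> finite S \<and> comp_connected S po \<and> qf_psd S po \<and> qf_definite S po \<and>
     dyn_equiv S po D"

definition principal_type :: "nat set \<Rightarrow> (nat \<Rightarrow> nat \<Rightarrow> bool) \<Rightarrow> dynkin \<Rightarrow> bool" where
  "principal_type S po D \<longleftrightarrow> finite S \<and> comp_connected S po \<and> qf_psd S po \<and>
     (\<exists>k\<in>S. \<exists>h :: nat \<Rightarrow> int. h k = 1 \<and> qf S po (\<lambda>s. real_of_int (h s)) = 0 \<and>
        positive_type (S - {k}) po D)"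

definition poset_iso :: "(nat \<Rightarrow> nat) \<Rightarrow> nat set \<Rightarrow> (nat \<Rightarrow> nat \<Rightarrow> bool) \<Rightarrow> nat set \<Rightarrow>
    (nat \<Rightarrow> nat \<Rightarrow> bool) \<Rightarrow> bool" where
  "poset_iso f S po S' po' \<longleftrightarrow> bij_betw f S S' \<and> (\<forall>s\<in>S. \<forall>t\<in>S. po s t \<longleftrightarrow> po' (f s) (f t))"

lemma poset_iso_subset:
  assumes "poset_iso f S po S' po'" "T \<subseteq> S"
  shows "poset_iso f T po (f ` T) po'"
  using assms unfolding poset_iso_def bij_betw_def by (blast intro: inj_on_subset)

lemma poset_iso_remove:
  assumes "poset_iso f S po S' po'" "k \<in> S"
  shows "poset_iso f (S - {k}) po (S' - {f k}) po'"
proof -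
  have "f ` (S - {k}) = S' - {f k}"
    using assms unfolding poset_iso_def bij_betw_def by (auto simp: inj_on_def)
  with poset_iso_subset[OF assms(1), of "S - {k}"] show ?thesis by auto
qed

lemma qf_iso:
  assumes "poset_iso f S po S' po'"
  shows "qf S' po' x = qf S po (\<lambda>s. x (f s))"
proof -
  have b: "bij_betw f S S'" using assms by (simp add: poset_iso_def)
  have "qf S' po' x = (\<Sum>s\<in>S. \<Sum>t\<in>S. if po' (f s) (f t) then x (f s) * x (f t) else 0)"
    unfolding qf_def sum.reindex_bij_betw[OF b, symmetric] ..
  also have "\<dots> = qf S po (\<lambda>s. x (f s))"
    unfolding qf_def using assms by (intro sum.cong refl) (auto simp: poset_iso_def)
  finally show ?thesis .
qed

lemma qf_psd_iso:
  assumes "poset_iso f S po S' po'" "qf_psd S po"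
  shows "qf_psd S' po'"
  using assms(2) by (simp add: qf_psd_def qf_iso[OF assms(1)])

lemma qf_definite_iso:
  assumes "poset_iso f S po S' po'" "qf_definite S po"
  shows "qf_definite S' po'"
  unfolding qf_definite_def
proof (intro allI impI ballI)
  fix x s' assume "qf S' po' x = 0" "s' \<in> S'"
  moreover obtain s where "s \<in> S" "s' = f s"
    using assms(1) \<open>s' \<in> S'\<close> by (auto simp: poset_iso_def bij_betw_def)
  ultimately show "x s' = 0"
    using assms(2)[unfolded qf_definite_def, rule_format, of "\<lambda>s. x (f s)" s]
    by (simp add: qf_iso[OF assms(1)])
qed

lemma comp_connected_iso:
  assumes iso: "poset_iso f S po S' po'" and con: "comp_connected S po"
  shows "comp_connected S' po'"
  unfolding comp_connected_def uconnected_def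
proof (intro ballI)
  let ?R = "({(x, y). po x y} \<union> {(x, y). po x y}\<inverse>) \<inter> S \<times> S"
  let ?R' = "({(x, y). po' x y} \<union> {(x, y). po' x y}\<inverse>) \<inter> S' \<times> S'"
  fix x' y' assume "x' \<in> S'" "y' \<in> S'"
  then obtain x y where xy: "x \<in> S" "y \<in> S" "x' = f x" "y' = f y"
    using iso unfolding poset_iso_def bij_betw_def by blast
  have "(x, y) \<in> ?R\<^sup>*"
    using con xy(1,2) unfolding comp_connected_def uconnected_def by blast
  then have "(f x, f y) \<in> ?R'\<^sup>*"
  proof (rule rtrancl_image[rotated])
    fix a b assume "(a, b) \<in> ?R"
    then show "(f a, f b) \<in> ?R'"
      using iso unfolding poset_iso_def bij_betw_def by blast
  qed
  then show "(x', y') \<in> ?R'\<^sup>*" using xy by simp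
qed

lemma dyn_equiv_iso:
  assumes iso: "poset_iso f S po S' po'" and eqv: "dyn_equiv S po D"
  shows "dyn_equiv S' po' D"
proof -
  have b: "bij_betw f S S'" using iso by (simp add: poset_iso_def)
  define g where "g = inv_into S f"
  have g: "g (f s) = s" if "s \<in> S" for s
    using b that by (simp add: g_def bij_betw_inv_into_left)
  from eqv obtain c c' :: "nat \<Rightarrow> nat \<Rightarrow> int" where
    inv: "\<forall>j<dyn_size D. \<forall>k<dyn_size D. (\<Sum>s\<in>S. c j s * c' s k) = of_bool (j = k)"
    and q: "\<forall>x. qf S po x = dq D (\<lambda>j. \<Sum>s\<in>S. real_of_int (c j s) * x s)"
    unfolding dyn_equiv_def by blast
  have "(\<Sum>s\<in>S'. c j (g s) * c' (g s) k) = of_bool (j = k)" if "j < dyn_size D" "k < dyn_size D" for j k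
    unfolding sum.reindex_bij_betw[OF b, symmetric] using inv that by (simp add: g)
  moreover have "qf S' po' x = dq D (\<lambda>j. \<Sum>s\<in>S'. real_of_int (c j (g s)) * x s)" for x
    unfolding sum.reindex_bij_betw[OF b, symmetric] qf_iso[OF iso] using q by (simp add: g)
  moreover have "card S' = dyn_size D" "dyn_wf D"
    using eqv bij_betw_same_card[OF b] by (simp_all add: dyn_equiv_def)
  ultimately show ?thesis
    unfolding dyn_equiv_def
    by (intro conjI exI[of _ "\<lambda>j s. c j (g s)"] exI[of _ "\<lambda>s. c' (g s)"]) auto
qed

lemma positive_type_iso:
  assumes "poset_iso f S po S' po'" "positive_type S po D"
  shows "positive_type S' po' D"
  using assms qf_psd_iso[OF assms(1)] qf_definite_iso[OF assms(1)] comp_connected_iso[OF assms(1)]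
    dyn_equiv_iso[OF assms(1)] bij_betw_finite[of f S S']
  by (auto simp: positive_type_def poset_iso_def)

lemma principal_type_iso:
  assumes iso: "poset_iso f S po S' po'" and pt: "principal_type S po D"
  shows "principal_type S' po' D"
proof -
  have b: "bij_betw f S S'" using iso by (simp add: poset_iso_def)
  from pt obtain k and h :: "nat \<Rightarrow> int" where k: "k \<in> S" "h k = 1"
    "qf S po (\<lambda>s. real_of_int (h s)) = 0" "positive_type (S - {k}) po D"
    unfolding principal_type_def by blast
  define g where "g = inv_into S f"
  have g: "g (f s) = s" if "s \<in> S" for s
    using b that by (simp add: g_def bij_betw_inv_into_left)
  have "qf S' po' (\<lambda>s. real_of_int (h (g s))) = 0"
    unfolding qf_iso[OF iso] using k(3) qf_cong[of S "\<lambda>s. real_of_int (h (g (f s)))" "\<lambda>s. real_of_int (h s)" po]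
    by (simp add: g)
  moreover have "positive_type (S' - {f k}) po' D"
    using positive_type_iso[OF poset_iso_remove[OF iso k(1)] k(4)] .
  moreover have "f k \<in> S'" "finite S'" using b k(1) pt
    by (auto simp: bij_betw_def principal_type_def)
  ultimately show ?thesis
    using pt k g qf_psd_iso[OF iso] comp_connected_iso[OF iso]
    unfolding principal_type_def
    by (intro conjI bexI[of _ "f k"] exI[of _ "\<lambda>s. h (g s)"]) auto
qed

subsection \<open>Posets of acyclic digraphs\<close>

lemma poset_of_refl [simp]: "poset_of A a a"
  by (simp add: poset_of_def)

lemma poset_of_trans: "poset_of A a b \<Longrightarrow> poset_of A b c \<Longrightarrow> poset_of A a c"
  by (simp add: poset_of_def)

lemma poset_of_antisym:
  assumes "acyclic A" "poset_of A a b" "poset_of A b a"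
  shows "a = b"
  using assms acyclic_impl_antisym_rtrancl[of A] by (auto simp: poset_of_def dest: antisymD)

text \<open>Induction on the size of the interval from \<open>x\<close> to \<open>y\<close>: by
  antisymmetry a vertex strictly inside splits it into two properly smaller intervals.\<close>

lemma hasse_rtrancl:
  assumes "acyclic A" "finite S" "x \<in> S" "y \<in> S" "poset_of A x y"
  shows "(x, y) \<in> (hasse S (poset_of A))\<^sup>*"
  using assms(3-5)
proof (induction "card {z \<in> S. poset_of A x z \<and> poset_of A z y}" arbitrary: x y rule: less_induct)
  case less
  let ?I = "\<lambda>x y. {z \<in> S. poset_of A x z \<and> poset_of A z y}"
  show ?case
  proof (cases "\<exists>k\<in>S. k \<noteq> x \<and> k \<noteq> y \<and> poset_of A x k \<and> poset_of A k y")
    case True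
    then obtain k where k: "k \<in> S" "k \<noteq> x" "k \<noteq> y" "poset_of A x k" "poset_of A k y" by blast
    have "?I x k \<subset> ?I x y" "?I k y \<subset> ?I x y"
      using k less.prems poset_of_antisym[OF assms(1)] poset_of_trans poset_of_refl by blast+
    then have "card (?I x k) < card (?I x y)" "card (?I k y) < card (?I x y)"
      using assms(2) by (auto intro!: psubset_card_mono)
    then have "(x, k) \<in> (hasse S (poset_of A))\<^sup>*" "(k, y) \<in> (hasse S (poset_of A))\<^sup>*"
      using less.hyps k less.prems by blast+
    then show ?thesis by (rule rtrancl_trans)
  next
    case False
    then have "x = y \<or> (x, y) \<in> hasse S (poset_of A)"
      using less.prems by (auto simp: hasse_def)
    then show ?thesis by auto
  qed
qed

lemma rtrancl_hasse_sym:
  "(x, y) \<in> (hasse S po)\<^sup>* \<Longrightarrow> (x, y) \<in> ((hasse S po \<union> (hasse S po)\<inverse>) \<inter> S \<times> S)\<^sup>*"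
  by (erule rtrancl_mono[THEN subsetD, rotated]) (auto simp: hasse_def)

lemma poset_connectedI:
  assumes "acyclic A" "finite S" "comp_connected S (poset_of A)"
  shows "poset_connected S (poset_of A)"
  unfolding poset_connected_def uconnected_def
proof (intro ballI)
  let ?H = "hasse S (poset_of A)"
  let ?R = "(?H \<union> ?H\<inverse>) \<inter> S \<times> S"
  have sym: "sym (?R\<^sup>*)" by (intro sym_rtrancl) (auto simp: sym_def)
  fix x y assume "x \<in> S" "y \<in> S"
  then have "(x, y) \<in> (({(x, y). poset_of A x y} \<union> {(x, y). poset_of A x y}\<inverse>) \<inter> S \<times> S)\<^sup>*"
    using assms(3) unfolding comp_connected_def uconnected_def by blast
  then show "(x, y) \<in> ?R\<^sup>*"
  proof induction
    case (step y z)
    then have "(y, z) \<in> ?R\<^sup>* \<or> (z, y) \<in> ?R\<^sup>*"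
      using hasse_rtrancl[OF assms(1,2)] rtrancl_hasse_sym by blast
    then have "(y, z) \<in> ?R\<^sup>*" using sym by (auto dest: symD)
    with step.IH show ?case by (rule rtrancl_trans)
  qed simp
qed

lemma positive_typeD:
  assumes "acyclic A" "positive_type S (poset_of A) D"
  shows "poset_positive S (poset_of A)" "has_dynkin_type S (poset_of A) D"
  using assms poset_connectedI[OF assms(1)]
  by (auto simp: positive_type_def intro: poset_positiveI has_dynkin_type_positiveI)

lemma principal_typeD:
  assumes "acyclic A" "principal_type S (poset_of A) D"
  shows "poset_principal S (poset_of A)" "has_dynkin_type S (poset_of A) D"
proof -
  from assms(2) obtain k and h :: "nat \<Rightarrow> int" where k: "k \<in> S" "h k = 1"
    "qf S (poset_of A) (\<lambda>s. real_of_int (h s)) = 0" "positive_type (S - {k}) (poset_of A) D"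
    unfolding principal_type_def by blast
  have S: "finite S" "comp_connected S (poset_of A)" "qf_psd S (poset_of A)"
    using assms(2) by (auto simp: principal_type_def)
  show "poset_principal S (poset_of A)"
    unfolding poset_principal_def
    using S k by (intro nonneg_corank_1I[of S _ "\<lambda>s. real_of_int (h s)" k]) (auto simp: positive_type_def)
  show "has_dynkin_type S (poset_of A) D"
    using S k poset_connectedI[OF assms(1)]
    by (intro has_dynkin_type_principalI[of S _ k h]) (auto simp: positive_type_def)
qed

text \<open>The first arrow of a directed path realising a covering relation must already end at the
  upper vertex.\<close>

lemma hasse_subset:
  assumes "acyclic A" "A \<subseteq> V \<times> V"
  shows "hasse V (poset_of A) \<subseteq> A"
proof clarify
  fix i j assume ij: "(i, j) \<in> hasse V (poset_of A)"
  then have "(i, j) \<in> A\<^sup>*" "i \<noteq> j" by (auto simp: hasse_def poset_of_def)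
  then obtain k where k: "(i, k) \<in> A" "(k, j) \<in> A\<^sup>*" by (meson converse_rtranclE)
  have "k \<noteq> i" using k(1) assms(1) by (auto simp: acyclic_def)
  then have "k = j"
    using ij k assms(2) unfolding hasse_def poset_of_def by blast
  with k show "(i, j) \<in> A" by simp
qed

text \<open>An arrow fails to be a covering relation only if a directed path through a third vertex
  bypasses it.\<close>

lemma hasse_eqI:
  assumes "acyclic A" "A \<subseteq> V \<times> V"
    and "\<And>i j k. (i, j) \<in> A \<Longrightarrow> k \<in> V \<Longrightarrow> k \<noteq> i \<Longrightarrow> k \<noteq> j \<Longrightarrow> poset_of A i k \<Longrightarrow> \<not> poset_of A k j"
  shows "hasse V (poset_of A) = A"
proof (rule equalityI[OF hasse_subset[OF assms(1,2)]])
  have "i \<noteq> j" if "(i, j) \<in> A" for i j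
    using that assms(1) by (auto simp: acyclic_def)
  then show "A \<subseteq> hasse V (poset_of A)"
    using assms(2,3) unfolding hasse_def poset_of_def by blast
qed

lemma rtrancl_iso_iff:
  assumes "bij_betw f S S'" "E \<subseteq> S \<times> S" "A \<subseteq> S' \<times> S'"
    and "\<And>i j. i \<in> S \<Longrightarrow> j \<in> S \<Longrightarrow> (i, j) \<in> E \<longleftrightarrow> (f i, f j) \<in> A"
    and "i \<in> S" "j \<in> S"
  shows "(i, j) \<in> E\<^sup>* \<longleftrightarrow> (f i, f j) \<in> A\<^sup>*"
proof
  assume "(i, j) \<in> E\<^sup>*"
  then show "(f i, f j) \<in> A\<^sup>*"
    by (rule rtrancl_image[rotated]) (use assms(2,4) in blast)
next
  define g where "g = inv_into S f"
  have g: "g (f s) = s" if "s \<in> S" for s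
    using assms(1) that by (simp add: g_def bij_betw_inv_into_left)
  have g': "g x \<in> S" "f (g x) = x" if "x \<in> S'" for x
    using assms(1) that by (simp_all add: g_def bij_betw_inv_into_right bij_betw_def inv_into_into)
  assume "(f i, f j) \<in> A\<^sup>*"
  then have "(g (f i), g (f j)) \<in> E\<^sup>*"
    by (rule rtrancl_image[rotated]) (use assms(3,4) g' in auto)
  then show "(i, j) \<in> E\<^sup>*" using assms g by simp
qed

lemma poset_iso_rtrancl:
  assumes "bij_betw f S S'" "E \<subseteq> S \<times> S" "A \<subseteq> S' \<times> S'"
    and "\<And>i j. i \<in> S \<Longrightarrow> j \<in> S \<Longrightarrow> (i, j) \<in> E \<longleftrightarrow> (f i, f j) \<in> A"
  shows "poset_iso f S (poset_of E) S' (poset_of A)"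
  unfolding poset_iso_def poset_of_def using assms(1) rtrancl_iso_iff[OF assms] by blast

declare One_nat_def [simp del]

section \<open>Oriented paths and cycles\<close>

text \<open>The hypothesis asks for integral vectors of squared length 2 whose inner product is 1
  for comparable and 0 for incomparable vertices. The form is then half the squared length of the
  combination with coefficients \<open>x\<close>, so it is visibly semidefinite.\<close>

lemma qf_realization:
  fixes e :: "nat \<Rightarrow> nat \<Rightarrow> int"
  assumes "finite W"
    and "\<And>i j. i \<in> S \<Longrightarrow> j \<in> S \<Longrightarrow> (\<Sum>w\<in>W. e i w * e j w) = of_bool (po i j) + of_bool (po j i)"
  shows "qf S po x = (\<Sum>w\<in>W. (\<Sum>i\<in>S. real_of_int (e i w) * x i)\<^sup>2) / 2"
proof -
  let ?e = "\<lambda>i w. real_of_int (e i w)"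
  have "(\<Sum>w\<in>W. (\<Sum>i\<in>S. ?e i w * x i)\<^sup>2) = (\<Sum>w\<in>W. \<Sum>i\<in>S. \<Sum>j\<in>S. ?e i w * ?e j w * x i * x j)"
    by (simp add: power2_eq_square sum_product mult_ac)
  also have "\<dots> = (\<Sum>i\<in>S. \<Sum>w\<in>W. \<Sum>j\<in>S. ?e i w * ?e j w * x i * x j)" by (rule sum.swap)
  also have "\<dots> = (\<Sum>i\<in>S. \<Sum>j\<in>S. \<Sum>w\<in>W. ?e i w * ?e j w * x i * x j)"
    by (intro sum.cong refl sum.swap)
  also have "\<dots> = (\<Sum>i\<in>S. \<Sum>j\<in>S. (of_bool (po i j) + of_bool (po j i)) * x i * x j)"
  proof (intro sum.cong refl)
    fix i j assume "i \<in> S" "j \<in> S"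
    then have "real_of_int (\<Sum>w\<in>W. e i w * e j w) = of_bool (po i j) + of_bool (po j i)"
      by (simp only: assms(2)) simp
    then have "(\<Sum>w\<in>W. ?e i w * ?e j w) = of_bool (po i j) + of_bool (po j i)" by simp
    then show "(\<Sum>w\<in>W. ?e i w * ?e j w * x i * x j) = (of_bool (po i j) + of_bool (po j i)) * x i * x j"
      by (simp add: sum_distrib_right [symmetric])
  qed
  finally show ?thesis by (simp add: qf_sym sum_divide_distrib)
qed

section \<open>Orders and root vectors of oriented paths\<close>

definition seg_le :: "(nat \<Rightarrow> bool) \<Rightarrow> nat \<Rightarrow> nat \<Rightarrow> bool" where
  "seg_le d i j \<longleftrightarrow> i \<le> j \<and> (\<forall>k\<in>{i..<j}. d k) \<or> j \<le> i \<and> (\<forall>k\<in>{j..<i}. \<not> d k)"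

text \<open>\<open>d k\<close> means that the edge between \<open>k\<close> and \<open>Suc k\<close>
  points upwards. The vertices are 1 to \<open>n\<close>, but the search may run down to a virtual
  vertex 0: \<open>d 0\<close> directs a phantom edge below vertex 1. This supplies the extra
  coordinate of type A for a path, and for a cycle the phantom edge becomes the closing
  edge.\<close>

definition seg_start :: "(nat \<Rightarrow> bool) \<Rightarrow> nat \<Rightarrow> nat" where
  "seg_start d j = (LEAST q. \<forall>k\<in>{q..<j}. d k = d (j - 1))"

definition seg_sign :: "(nat \<Rightarrow> bool) \<Rightarrow> nat \<Rightarrow> int" where
  "seg_sign d j = (if d (j - 1) then 1 else - 1)"

definition seg_vec :: "(nat \<Rightarrow> bool) \<Rightarrow> nat \<Rightarrow> nat \<Rightarrow> int" where
  "seg_vec d j w = seg_sign d j * (of_bool (w = j) - of_bool (w = seg_start d j))"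

lemma seg_start_less: "0 < j \<Longrightarrow> seg_start d j < j"
proof -
  assume "0 < j"
  then have "\<forall>k\<in>{j - 1..<j}. d k = d (j - 1)" by (auto simp: le_less_Suc_eq dest!: le_antisym[rotated])
  then have "seg_start d j \<le> j - 1" unfolding seg_start_def by (rule Least_le)
  with \<open>0 < j\<close> show ?thesis by simp
qed

lemma seg_start_le_iff: "seg_start d j \<le> q \<longleftrightarrow> (\<forall>k\<in>{q..<j}. d k = d (j - 1))"
proof
  have "\<forall>k\<in>{seg_start d j..<j}. d k = d (j - 1)"
    unfolding seg_start_def by (rule LeastI[of _ j]) simp
  then show "seg_start d j \<le> q \<Longrightarrow> \<forall>k\<in>{q..<j}. d k = d (j - 1)" by auto
  show "\<forall>k\<in>{q..<j}. d k = d (j - 1) \<Longrightarrow> seg_start d j \<le> q"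
    unfolding seg_start_def by (rule Least_le)
qed

lemma seg_start_same:
  assumes "seg_start d j < i" "i < j"
  shows "seg_start d i = seg_start d j" "d (i - 1) = d (j - 1)"
proof -
  have j: "\<forall>k\<in>{seg_start d j..<j}. d k = d (j - 1)" using seg_start_le_iff by blast
  moreover have "i - 1 \<in> {seg_start d j..<j}" using assms by auto
  ultimately show eq: "d (i - 1) = d (j - 1)" by blast
  have i: "\<forall>k\<in>{seg_start d i..<i}. d k = d (i - 1)" using seg_start_le_iff by blast
  have "seg_start d i \<le> seg_start d j"
    unfolding seg_start_le_iff eq
  proof
    fix k assume "k \<in> {seg_start d j..<i}"
    then have "k \<in> {seg_start d j..<j}" using assms by auto
    with j show "d k = d (j - 1)" by blast
  qed
  moreover have "seg_start d j \<le> seg_start d i"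
    unfolding seg_start_le_iff
  proof
    fix k assume "k \<in> {seg_start d i..<j}"
    then have "k \<in> {seg_start d i..<i} \<or> k \<in> {seg_start d j..<j}" using assms by auto
    then show "d k = d (j - 1)" using i j eq by metis
  qed
  ultimately show "seg_start d i = seg_start d j" by simp
qed

text \<open>By maximality of the segment, the edge just before its start must point the other
  way.\<close>

lemma seg_start_turn:
  assumes "seg_start d j = i" "0 < i" "i < j"
  shows "d (i - 1) \<noteq> d (j - 1)"
proof
  assume eq: "d (i - 1) = d (j - 1)"
  have "\<forall>k\<in>{i..<j}. d k = d (j - 1)" using assms(1) seg_start_le_iff by blast
  then have "\<forall>k\<in>{i - 1..<j}. d k = d (j - 1)"
    using eq assms by (metis Suc_diff_1 Suc_leI atLeastLessThan_iff le_neq_implies_less)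
  then have "seg_start d j \<le> i - 1" by (simp add: seg_start_le_iff)
  with assms show False by simp
qed

lemma seg_sign_square [simp]: "seg_sign d i * seg_sign d i = 1"
  by (simp add: seg_sign_def)

lemma seg_comparable:
  assumes "i < j"
  shows "of_bool (seg_le d i j) + of_bool (seg_le d j i) = (of_bool (seg_start d j \<le> i) :: int)"
proof -
  have "j - 1 \<in> {i..<j}" using assms by auto
  then show ?thesis
    unfolding seg_start_le_iff seg_le_def using assms by (cases "d (j - 1)") auto
qed

text \<open>Three positions of \<open>i\<close> relative to the segment arriving at
  \<open>j\<close>. Strictly inside, both vectors have the same start and sign. At the start, the
  signs are opposite and cancel the minus of the shared coordinate. Before the start, the supports
  are disjoint.\<close>

lemma seg_pair:
  assumes "0 < i" "i < j"
  shows "seg_sign d i * seg_sign d j *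
     (of_bool (seg_start d i = seg_start d j) - of_bool (seg_start d j = i)) =
     of_bool (seg_start d j \<le> i)"
proof -
  have "seg_start d i < i" using assms seg_start_less by blast
  then consider "seg_start d j < i" | "seg_start d j = i" | "seg_start d j > i" by linarith
  then show ?thesis
  proof cases
    case 1
    with seg_start_same[OF 1 assms(2)] show ?thesis by (simp add: seg_sign_def)
  next
    case 2
    with seg_start_turn[OF 2 assms] \<open>seg_start d i < i\<close> show ?thesis by (auto simp: seg_sign_def)
  next
    case 3
    with \<open>seg_start d i < i\<close> show ?thesis by simp
  qed
qed

lemma sum_of_bool_mult:
  fixes f :: "nat \<Rightarrow> 'a::comm_ring_1"
  assumes "finite W"
  shows "(\<Sum>w\<in>W. of_bool (w = a) * f w) = of_bool (a \<in> W) * f a"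
proof -
  have "(\<Sum>w\<in>W. of_bool (w = a) * f w) = (\<Sum>w\<in>W. if w = a then f w else 0)"
    by (intro sum.cong) auto
  with assms show ?thesis by simp
qed

lemma sum_delta_diff:
  fixes f :: "nat \<Rightarrow> 'a::comm_ring_1"
  assumes "finite W" "a \<in> W" "b \<in> W"
  shows "(\<Sum>w\<in>W. (of_bool (w = a) - of_bool (w = b)) * f w) = f a - f b"
  using assms by (simp add: left_diff_distrib sum_subtractf sum_of_bool_mult)

text \<open>For \<open>i < j\<close> the coordinate \<open>j\<close> does not occur in the vector of
  \<open>i\<close>, so only the start of the segment arriving at \<open>j\<close> can contribute;
  \<open>seg_pair\<close> evaluates that contribution.\<close>

lemma seg_vec_gram:
  assumes "0 < i" "i \<le> n" "0 < j" "j \<le> n"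
  shows "(\<Sum>w\<le>n. seg_vec d i w * seg_vec d j w) = of_bool (seg_le d i j) + of_bool (seg_le d j i)"
proof -
  have sum: "(\<Sum>w\<le>n. seg_vec d i w * seg_vec d j w) = seg_sign d i * (seg_vec d j i - seg_vec d j (seg_start d i))"
    if "0 < i" "i \<le> n" for i j
  proof -
    have "(\<Sum>w\<le>n. seg_vec d i w * seg_vec d j w) =
        seg_sign d i * (\<Sum>w\<le>n. (of_bool (w = i) - of_bool (w = seg_start d i)) * seg_vec d j w)"
      by (simp add: seg_vec_def sum_distrib_left mult_ac)
    then show ?thesis
      using that seg_start_less[of i d] by (subst (asm) sum_delta_diff) auto
  qed
  have less: "(\<Sum>w\<le>n. seg_vec d i w * seg_vec d j w) = of_bool (seg_le d i j) + of_bool (seg_le d j i)"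
    if "0 < i" "i < j" "j \<le> n" for i j
  proof -
    have "(\<Sum>w\<le>n. seg_vec d i w * seg_vec d j w) = seg_sign d i * seg_sign d j *
        (of_bool (seg_start d i = seg_start d j) - of_bool (seg_start d j = i))"
      using that seg_start_less[of i d] by (subst sum) (auto simp: seg_vec_def algebra_simps)
    with seg_pair[OF that(1,2)] seg_comparable[OF that(2)] show ?thesis by simp
  qed
  consider "i < j" | "j < i" | "i = j" by linarith
  then show ?thesis
  proof cases
    case 1
    then show ?thesis using less assms by simp
  next
    case 2
    then show ?thesis using less[of j i] assms by (simp add: mult.commute add.commute)
  next
    case 3
    have "seg_start d i \<noteq> i" using seg_start_less[OF assms(1), of d] by simp
    with 3 show ?thesis
      using sum[of i i] assms by (simp add: seg_vec_def seg_le_def algebra_simps)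
  qed
qed

lemma qf_seg_le:
  "qf {1..n} (seg_le d) x = (\<Sum>w\<le>n. (\<Sum>i\<in>{1..n}. real_of_int (seg_vec d i w) * x i)\<^sup>2) / 2"
  by (rule qf_realization, simp, rule seg_vec_gram) auto

text \<open>Following \<open>seg_start\<close> down to 0 expresses \<open>z i - z 0\<close>
  integrally in the segment vectors. This one fact yields both the integral inverse for paths and
  the linear relation for cycles.\<close>

lemma seg_span:
  "i \<le> n \<Longrightarrow> \<exists>c. \<forall>w. (\<Sum>s\<in>{1..n}. seg_vec d s w * c s) = of_bool (w = i) - of_bool (w = 0)"
proof (induction i rule: less_induct)
  case (less i)
  show ?case
  proof (cases "i = 0")
    case True
    then show ?thesis by (intro exI[of _ "\<lambda>_. 0"]) simp
  next
    case False
    then have lt: "seg_start d i < i" by (simp add: seg_start_less)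
    with less obtain c where c: "\<And>w. (\<Sum>s\<in>{1..n}. seg_vec d s w * c s) =
        of_bool (w = seg_start d i) - of_bool (w = 0)" by fastforce
    have "(\<Sum>s\<in>{1..n}. seg_vec d s w * (c s + of_bool (s = i) * seg_sign d s)) =
        of_bool (w = i) - of_bool (w = 0)" for w
    proof -
      have "(\<Sum>s\<in>{1..n}. seg_vec d s w * (c s + of_bool (s = i) * seg_sign d s)) =
          (\<Sum>s\<in>{1..n}. seg_vec d s w * c s) + (\<Sum>s\<in>{1..n}. of_bool (s = i) * (seg_vec d s w * seg_sign d s))"
        by (simp add: algebra_simps sum.distrib)
      also have "(\<Sum>s\<in>{1..n}. of_bool (s = i) * (seg_vec d s w * seg_sign d s)) = seg_vec d i w * seg_sign d i"
        using False less.prems by (subst sum_of_bool_mult) auto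
      also have "\<dots> = of_bool (w = i) - of_bool (w = seg_start d i)"
        by (simp add: seg_vec_def mult_ac)
      finally show ?thesis by (simp add: c)
    qed
    then show ?thesis by (intro exI[of _ "\<lambda>s. c s + of_bool (s = i) * seg_sign d s"]) blast
  qed
qed

text \<open>The usual realisation of type A by differences of neighbouring coordinates:
  \<open>f\<close> is \<open>y\<close> shifted by one and padded with a zero at each end.\<close>

lemma dq_DA:
  assumes "\<And>w. w < n \<Longrightarrow> f (Suc w) = y w" "f 0 = 0" "f (Suc n) = 0"
  shows "dq (DA n) y = (\<Sum>w\<le>n. (f w - f (Suc w))\<^sup>2) / 2"
proof -
  have edges: "dyn_edges (DA n) = (\<lambda>i. (i, Suc i)) ` {..<n - 1}"
    by (auto simp: dyn_edges_def)
  have cross: "(\<Sum>w\<le>n. f w * f (Suc w)) = (\<Sum>(j, k)\<in>dyn_edges (DA n). y j * y k)"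
  proof (cases n)
    case 0
    then show ?thesis unfolding edges by (simp add: assms)
  next
    case (Suc m)
    have "(\<Sum>w\<le>n. f w * f (Suc w)) = (\<Sum>w<m. f (Suc w) * f (Suc (Suc w)))"
      unfolding Suc sum.atMost_Suc_shift using assms(2,3) Suc
      by (simp add: lessThan_Suc_atMost [symmetric])
    also have "\<dots> = (\<Sum>w<m. y w * y (Suc w))" using assms(1) Suc by (intro sum.cong) auto
    finally show ?thesis unfolding edges using Suc by (subst sum.reindex) (auto intro: inj_onI)
  qed
  have sq: "(\<Sum>w\<le>n. (f (Suc w))\<^sup>2) = (\<Sum>j<n. (y j)\<^sup>2)"
    using assms(1,3) by (simp add: lessThan_Suc_atMost [symmetric])
  have sq': "(\<Sum>w\<le>n. (f w)\<^sup>2) = (\<Sum>j<n. (y j)\<^sup>2)"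
    unfolding lessThan_Suc_atMost [symmetric] sum.lessThan_Suc_shift using assms(1,2) by simp
  have "(\<Sum>w\<le>n. (f w - f (Suc w))\<^sup>2) =
      (\<Sum>w\<le>n. (f w)\<^sup>2) + (\<Sum>w\<le>n. (f (Suc w))\<^sup>2) - 2 * (\<Sum>w\<le>n. f w * f (Suc w))"
    by (simp add: power2_diff sum.distrib sum_subtractf sum_distrib_left mult_ac)
  then show ?thesis unfolding sq sq' cross by (simp add: dq_def dyn_size_def)
qed

text \<open>The vectors are triangular: at the largest index \<open>i\<close> with nonzero
  coefficient, no earlier vector meets the coordinate \<open>i\<close>, so that coordinate of the
  combination cannot vanish.\<close>

lemma qf_definite_seg_le: "qf_definite {1..n} (seg_le d)"
  unfolding qf_definite_def
proof (intro allI impI ballI, rule ccontr)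
  fix x s assume q: "qf {1..n} (seg_le d) x = 0" and s: "s \<in> {1..n}" "x s \<noteq> 0"
  define i where "i = Max {i \<in> {1..n}. x i \<noteq> 0}"
  have "i \<in> {i \<in> {1..n}. x i \<noteq> 0}" unfolding i_def by (rule Max_in) (use s in auto)
  then have i: "i \<in> {1..n}" "x i \<noteq> 0" by auto
  have above: "x j = 0" if "j \<in> {1..n}" "i < j" for j
    using that Max_ge[of "{i \<in> {1..n}. x i \<noteq> 0}" j] by (fastforce simp: i_def)
  have "(\<Sum>w\<le>n. (\<Sum>i\<in>{1..n}. real_of_int (seg_vec d i w) * x i)\<^sup>2) = 0"
    using q by (simp add: qf_seg_le)
  then have "(\<Sum>j\<in>{1..n}. real_of_int (seg_vec d j i) * x j) = 0"
    using i(1) by (subst (asm) sum_nonneg_eq_0_iff) auto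
  moreover have "(\<Sum>j\<in>{1..n}. real_of_int (seg_vec d j i) * x j) =
      (\<Sum>j\<in>{1..n}. if j = i then real_of_int (seg_sign d i) * x i else 0)"
  proof (intro sum.cong refl)
    fix j assume j: "j \<in> {1..n}"
    consider "j < i" | "j = i" | "i < j" by linarith
    then show "real_of_int (seg_vec d j i) * x j = (if j = i then real_of_int (seg_sign d i) * x i else 0)"
    proof cases
      case 1
      then show ?thesis using j seg_start_less[of j d] by (auto simp: seg_vec_def)
    next
      case 2
      then show ?thesis using j seg_start_less[of j d] by (auto simp: seg_vec_def)
    qed (use above j in auto)
  qed
  ultimately have "real_of_int (seg_sign d i) * x i = 0" using i by simp
  then show False using i(2) by (simp add: seg_sign_def split: if_splits)
qed

text \<open>The simple roots are \<open>z (j + 1) - z j\<close>. Coordinates with respect to them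
  are partial sums of the coordinates of the vectors, and \<open>seg_span\<close> makes the change
  of basis invertible over the integers.\<close>

lemma dyn_equiv_seg_le: "dyn_equiv {1..n} (seg_le d) (DA n)"
proof -
  \<comment> \<open>Up to its sign the vector of \<open>s\<close> is
    \<open>z s - z (seg_start d s)\<close>, the sum of the simple roots with index \<open>j\<close>
    from \<open>seg_start d s\<close> to \<open>s - 1\<close>.\<close>
  define b where "b j s = (if seg_start d s \<le> j \<and> j < s then seg_sign d s else 0)" for j s
  have b_diff: "(if w = 0 then 0 else b (w - 1) s) - b w s = seg_vec d s w" if "s \<in> {1..n}" for s w
    using that seg_start_less[of s d] by (auto simp: b_def seg_vec_def)
  have "\<exists>c. \<forall>j. (\<Sum>s\<in>{1..n}. b j s * c s) = of_bool (j < i)" if i: "i \<le> n" for i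
  proof -
    obtain c where c: "\<And>w. (\<Sum>s\<in>{1..n}. seg_vec d s w * c s) = of_bool (w = i) - of_bool (w = 0)"
      using seg_span[OF i, of d] by blast
    have "(\<Sum>s\<in>{1..n}. b j s * c s) = of_bool (j < i)" for j
    proof (induction j)
      case 0
      have "(\<Sum>s\<in>{1..n}. b 0 s * c s) = - (\<Sum>s\<in>{1..n}. seg_vec d s 0 * c s)"
        unfolding sum_negf [symmetric] using b_diff[of _ 0, symmetric]
        by (intro sum.cong refl) simp
      then show ?case by (simp add: c)
    next
      case (Suc j)
      have "(\<Sum>s\<in>{1..n}. b (Suc j) s * c s) =
          (\<Sum>s\<in>{1..n}. b j s * c s) - (\<Sum>s\<in>{1..n}. seg_vec d s (Suc j) * c s)"
        unfolding sum_subtractf [symmetric]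
      proof (intro sum.cong refl)
        fix s assume "s \<in> {1..n}"
        then have "b (Suc j) s = b j s - seg_vec d s (Suc j)" using b_diff[of s "Suc j"] by simp
        then show "b (Suc j) s * c s = b j s * c s - seg_vec d s (Suc j) * c s"
          by (simp add: left_diff_distrib)
      qed
      then show ?case by (auto simp: c Suc)
    qed
    then show ?thesis by blast
  qed
  then obtain c where c: "\<And>i j. i \<le> n \<Longrightarrow> (\<Sum>s\<in>{1..n}. b j s * c i s) = of_bool (j < i)"
    by metis
  \<comment> \<open>The simple root of index \<open>k\<close> is the difference of
    \<open>z (k + 1) - z 0\<close> and \<open>z k - z 0\<close>, whose coefficients are
    \<open>c (Suc k)\<close> and \<open>c k\<close>.\<close>
  have inv: "(\<Sum>s\<in>{1..n}. b j s * (c (Suc k) s - c k s)) = of_bool (j = k)" if "k < n" for j k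
    using c[of k j] c[of "Suc k" j] that
    by (auto simp: right_diff_distrib sum_subtractf)
  have "qf {1..n} (seg_le d) x = dq (DA n) (\<lambda>j. \<Sum>s\<in>{1..n}. real_of_int (b j s) * x s)" for x
  proof -
    define f where "f w = (if w = 0 then 0 else \<Sum>s\<in>{1..n}. real_of_int (b (w - 1) s) * x s)" for w
    have "f w - f (Suc w) = (\<Sum>s\<in>{1..n}. real_of_int (seg_vec d s w) * x s)" for w
    proof -
      have "f w - f (Suc w) = (\<Sum>s\<in>{1..n}. real_of_int ((if w = 0 then 0 else b (w - 1) s) - b w s) * x s)"
        by (simp add: f_def sum_subtractf [symmetric] left_diff_distrib sum_negf)
      then show ?thesis using b_diff by (auto intro!: sum.cong)
    qed
    moreover have "f (Suc n) = 0" by (auto simp: f_def b_def intro!: sum.neutral)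
    ultimately show ?thesis
      by (subst dq_DA[of n f]) (auto simp: f_def qf_seg_le)
  qed
  moreover have "dyn_wf (DA n)" by (auto simp: dyn_wf_def dyn_edges_def dyn_size_def)
  ultimately show ?thesis
    unfolding dyn_equiv_def using inv
    by (intro conjI exI[of _ b] exI[of _ "\<lambda>s k. c (Suc k) s - c k s"]) (auto simp: dyn_size_def)
qed

lemma comp_connected_consecutive:
  assumes "\<And>i. 1 \<le> i \<Longrightarrow> i < n \<Longrightarrow> po i (Suc i) \<or> po (Suc i) i"
  shows "comp_connected {1..n} po"
  unfolding comp_connected_def uconnected_def
proof (intro ballI)
  let ?R = "({(x, y). po x y} \<union> {(x, y). po x y}\<inverse>) \<inter> {1..n} \<times> {1..n}"
  have up: "(i, j) \<in> ?R\<^sup>*" if "i \<le> j" "1 \<le> i" "j \<le> n" for i j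
    using that
  proof (induction j rule: dec_induct)
    case (step j)
    then have "(j, Suc j) \<in> ?R" using assms[of j] by auto
    with step show ?case by (auto intro: rtrancl_into_rtrancl)
  qed simp
  have sym: "sym (?R\<^sup>*)" by (intro sym_rtrancl) (auto simp: sym_def)
  fix x y assume "x \<in> {1..n}" "y \<in> {1..n}"
  then show "(x, y) \<in> ?R\<^sup>*"
    using up[of x y] up[of y x] sym by (cases "x \<le> y") (auto dest: symD)
qed

lemma seg_le_Suc: "seg_le d i (Suc i) \<or> seg_le d (Suc i) i"
  by (auto simp: seg_le_def)

lemma path_positive_type: "positive_type {1..n} (seg_le d) (DA n)"
proof -
  have "qf_psd {1..n} (seg_le d)" by (auto simp: qf_psd_def qf_seg_le intro!: sum_nonneg)
  then show ?thesis
    unfolding positive_type_def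
    using qf_definite_seg_le dyn_equiv_seg_le comp_connected_consecutive seg_le_Suc by blast
qed

section \<open>Cycles with several sinks, cut at a sink\<close>

definition cyc_le :: "(nat \<Rightarrow> bool) \<Rightarrow> nat \<Rightarrow> nat \<Rightarrow> nat \<Rightarrow> bool" where
  "cyc_le d n i j \<longleftrightarrow> seg_le d i j \<or> j = n \<and> (\<forall>k<i. \<not> d k)"

text \<open>The vertex \<open>n\<close> also plays the part of 0, so it can be reached upwards
  through edge \<open>n - 1\<close> or downwards through edge 0. The hypothesis \<open>turn\<close>
  forbids the pattern of edges that first all point down and then all point up, which is the case of
  a single sink. Deleting \<open>n\<close> leaves an oriented path.\<close>

lemma cycle_principal_type:
  assumes n: "2 \<le> n" and d: "\<not> d 0" "d (n - 1)"
    and turn: "\<And>t. 0 < t \<Longrightarrow> t < n \<Longrightarrow> \<forall>k<t. \<not> d k \<Longrightarrow> \<exists>k\<in>{t..<n}. \<not> d k"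
  shows "principal_type {1..n} (cyc_le d n) (DA (n - 1))"
proof -
  let ?S = "{1..n}" and ?p = "seg_start d"
  \<comment> \<open>The vector of \<open>n\<close> is its segment vector with \<open>z n\<close>
    replaced by \<open>z 0\<close>; the sign is positive because edge \<open>n - 1\<close> points
    up.\<close>
  define e where "e j w = (if j < n then seg_vec d j w else of_bool (w = 0) - of_bool (w = ?p n))" for j w
  \<comment> \<open>Edges 0 and \<open>n - 1\<close> have opposite directions, so the last segment
    stops short of 0 and \<open>z 0 - z (?p n)\<close> is nonzero.\<close>
  have pn: "0 < ?p n" "?p n < n"
    using n d seg_start_le_iff[of d n 0] seg_start_less[of n d] by auto
  have sn: "seg_sign d n = 1" using d by (simp add: seg_sign_def)
  have p0: "?p i = 0 \<longleftrightarrow> (\<forall>k<i. \<not> d k)" if "0 < i" for i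
  proof -
    have "?p i = 0 \<longleftrightarrow> (\<forall>k\<in>{0..<i}. d k = d (i - 1))"
      using seg_start_le_iff[of d i 0] unfolding le_zero_eq .
    also have "\<dots> \<longleftrightarrow> (\<forall>k<i. d k = d (i - 1))" unfolding atLeast0LessThan Ball_def lessThan_iff ..
    also have "\<dots> \<longleftrightarrow> (\<forall>k<i. \<not> d k)"
    proof
      assume *: "\<forall>k<i. d k = d (i - 1)"
      then have "d 0 = d (i - 1)" using that by blast
      with * d(1) show "\<forall>k<i. \<not> d k" by blast
    next
      assume *: "\<forall>k<i. \<not> d k"
      then have "\<not> d (i - 1)" using that by simp
      with * show "\<forall>k<i. d k = d (i - 1)" by blast
    qed
    finally show ?thesis .
  qed
  have gram_less: "(\<Sum>w<n. e i w * e n w) = of_bool (cyc_le d n i n) + of_bool (cyc_le d n n i)"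
    if i: "0 < i" "i < n" for i
  proof -
    have "(\<Sum>w<n. e i w * e n w) = (\<Sum>w<n. (of_bool (w = 0) - of_bool (w = ?p n)) * seg_vec d i w)"
      using i by (intro sum.cong) (auto simp: e_def)
    also have "\<dots> = seg_vec d i 0 - seg_vec d i (?p n)"
      using pn n by (subst sum_delta_diff) auto
    also have "\<dots> = seg_sign d i * (of_bool (?p i = ?p n) - of_bool (?p n = i)) - seg_sign d i * of_bool (?p i = 0)"
      using i by (auto simp: seg_vec_def)
    also have "seg_sign d i * (of_bool (?p i = ?p n) - of_bool (?p n = i)) = of_bool (?p n \<le> i)"
      using seg_pair[OF i, of d] sn by simp
    also have "- seg_sign d i * of_bool (?p i = 0) = of_bool (?p i = 0)"
      using p0[OF i(1)] i by (auto simp: seg_sign_def)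
    then have "of_bool (?p n \<le> i) - seg_sign d i * of_bool (?p i = 0) = of_bool (?p n \<le> i) + of_bool (?p i = 0)"
      by simp
    also have "\<dots> = of_bool (cyc_le d n i n) + (of_bool (cyc_le d n n i) :: int)"
    proof -
      have "\<not> seg_le d n i" using i d(2) by (auto simp: seg_le_def)
      moreover have "seg_le d i n \<longleftrightarrow> ?p n \<le> i"
        using i d(2) unfolding seg_start_le_iff seg_le_def by auto
      \<comment> \<open>If \<open>i\<close> reached \<open>n\<close> on both arcs, the inner product
        would be 2 while the comparability counts once; \<open>turn\<close> excludes exactly
        this.\<close>
      moreover have "\<not> (?p n \<le> i \<and> ?p i = 0)"
        using turn[OF i] p0[OF i(1)] d(2) unfolding seg_start_le_iff by blast
      ultimately show ?thesis using p0[OF i(1)] i by (auto simp: cyc_le_def)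
    qed
    finally show ?thesis .
  qed
  have gram: "(\<Sum>w<n. e i w * e j w) = of_bool (cyc_le d n i j) + of_bool (cyc_le d n j i)"
    if ij: "i \<in> ?S" "j \<in> ?S" for i j
  proof -
    consider "i < n" "j < n" | "i < n" "j = n" | "i = n" "j < n" | "i = n" "j = n"
      using ij by fastforce
    then show ?thesis
    proof cases
      case 1
      have "{..n - 1} = {..<n}" using n by auto
      with 1 ij seg_vec_gram[of i "n - 1" j d] show ?thesis
        by (simp add: e_def cyc_le_def)
    next
      case 4
      have "(\<Sum>w<n. e n w * e n w) = (\<Sum>w<n. (of_bool (w = 0) - of_bool (w = ?p n)) * e n w)"
        by (simp add: e_def)
      also have "\<dots> = e n 0 - e n (?p n)" using pn n by (subst sum_delta_diff) auto
      finally show ?thesis using 4 pn by (simp add: e_def cyc_le_def seg_le_def)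
    qed (use gram_less ij in \<open>auto simp: mult.commute add.commute\<close>)
  qed
  have qf: "qf ?S (cyc_le d n) x = (\<Sum>w<n. (\<Sum>i\<in>?S. real_of_int (e i w) * x i)\<^sup>2) / 2" for x
    by (rule qf_realization, simp, rule gram)
  have psd: "qf_psd ?S (cyc_le d n)" by (auto simp: qf_psd_def qf intro!: sum_nonneg)
  have split: "?S = insert n {1..n - 1}" "n \<notin> {1..n - 1}" using n by auto
  \<comment> \<open>These integral coefficients produce the negative of the vector of
    \<open>n\<close> from the vectors of the path, so together with coefficient 1 at
    \<open>n\<close> they form the kernel vector.\<close>
  obtain c where c: "\<And>w. (\<Sum>s\<in>{1..n - 1}. seg_vec d s w * c s) = of_bool (w = ?p n) - of_bool (w = 0)"
    using seg_span[of "?p n" "n - 1" d] pn by fastforce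
  define h where "h s = (if s = n then 1 else c s)" for s
  have "(\<Sum>i\<in>?S. e i w * h i) = 0" for w
  proof -
    have "(\<Sum>i\<in>{1..n - 1}. e i w * h i) = (\<Sum>s\<in>{1..n - 1}. seg_vec d s w * c s)"
      using n by (intro sum.cong) (auto simp: e_def h_def)
    then show ?thesis unfolding split(1) using split(2) by (simp add: c) (simp add: e_def h_def)
  qed
  then have "(\<Sum>i\<in>?S. real_of_int (e i w) * real_of_int (h i)) = 0" for w
    by (metis (mono_tags, lifting) of_int_0 of_int_mult of_int_sum sum.cong)
  then have null: "qf ?S (cyc_le d n) (\<lambda>s. real_of_int (h s)) = 0" by (simp add: qf)
  have "?S - {n} = {1..n - 1}" using n by auto
  moreover have "poset_iso id {1..n - 1} (seg_le d) {1..n - 1} (cyc_le d n)"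
    using n by (auto simp: poset_iso_def cyc_le_def)
  ultimately have "positive_type (?S - {n}) (cyc_le d n) (DA (n - 1))"
    using positive_type_iso path_positive_type by metis
  moreover have "comp_connected ?S (cyc_le d n)"
    using seg_le_Suc by (intro comp_connected_consecutive) (auto simp: cyc_le_def)
  ultimately show ?thesis
    unfolding principal_type_def using psd null n
    by (intro conjI bexI[of _ n] exI[of _ h]) (auto simp: h_def)
qed

section \<open>Two directed chains with common endpoints\<close>

lemma path_arrows_Cons: "xs \<noteq> [] \<Longrightarrow> path_arrows (x # xs) = insert (x, hd xs) (path_arrows xs)"
  by (cases xs) (auto simp: path_arrows_def)

lemma path_arrows_snoc: "xs \<noteq> [] \<Longrightarrow> path_arrows (xs @ [y]) = insert (last xs, y) (path_arrows xs)"
proof (induction xs)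
  case (Cons x xs)
  show ?case
  proof (cases "xs = []")
    case False
    with Cons.IH show ?thesis by (simp add: path_arrows_Cons insert_commute)
  qed (simp add: path_arrows_def)
qed simp

lemma path_arrows_upt: "path_arrows [a..<b] = {(i, Suc i) | i. a \<le> i \<and> Suc i < b}"
proof (induction b)
  case (Suc b)
  show ?case
  proof (cases "a < b")
    case True
    then have "path_arrows [a..<Suc b] = insert (last [a..<b], b) (path_arrows [a..<b])"
      using path_arrows_snoc[of "[a..<b]" b] by simp
    also have "last [a..<b] = b - 1" using True by simp
    finally show ?thesis using True unfolding Suc.IH by (auto simp: less_Suc_eq)
  qed (auto simp: path_arrows_def)
qed (simp add: path_arrows_def)

text \<open>For \<open>r = 1\<close> the disjunct with \<open>j = p + 1\<close> is the single arrow
  from 1 to \<open>n\<close>, and the last disjunct is empty.\<close>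

lemma Abar_iff:
  assumes "1 \<le> p" "1 \<le> r"
  shows "(i, j) \<in> Abar p r \<longleftrightarrow> 1 \<le> i \<and> i < p \<and> j = Suc i \<or> i = p \<and> j = p + r \<or>
    i = 1 \<and> j = p + 1 \<or> p < i \<and> i < p + r \<and> j = Suc i"
proof -
  have 1: "path_arrows ([1..<p + 1] @ [p + r]) = insert (p, p + r) {(i, Suc i) | i. 1 \<le> i \<and> i < p}"
    using assms by (subst path_arrows_snoc) (auto simp: path_arrows_upt simp del: upt_Suc)
  have "[p + 1..<p + r] @ [p + r] = [p + 1..<Suc (p + r)]"
    using assms by simp
  then have 2: "path_arrows (1 # [p + 1..<p + r] @ [p + r]) =
      insert (1, p + 1) {(i, Suc i) | i. p < i \<and> i < p + r}"
    using assms by (simp only:) (subst path_arrows_Cons, auto simp: path_arrows_upt simp del: upt_Suc)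
  show ?thesis unfolding Abar_def 1 2 by auto
qed

lemma Abar_subset:
  assumes "1 \<le> p" "1 \<le> r"
  shows "Abar p r \<subseteq> {1..p + r} \<times> {1..p + r}"
  using assms by (auto simp: Abar_iff)

definition bar_le :: "nat \<Rightarrow> nat \<Rightarrow> nat \<Rightarrow> nat \<Rightarrow> bool" where
  "bar_le p r i j \<longleftrightarrow> i = j \<or> i = 1 \<or> j = p + r \<or> i \<le> j \<and> j \<le> p \<or> p < i \<and> i \<le> j"

lemma rtrancl_interval:
  assumes "\<And>k. i \<le> k \<Longrightarrow> k < j \<Longrightarrow> (k, Suc k) \<in> E" "i \<le> j"
  shows "(i, j) \<in> E\<^sup>*"
  using assms(2,1)
proof (induction j rule: dec_induct)
  case (step m)
  then show ?case by (auto intro: rtrancl_into_rtrancl)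
qed simp

lemma poset_of_Abar:
  assumes pr: "1 \<le> p" "1 \<le> r" and ij: "i \<in> {1..p + r}" "j \<in> {1..p + r}"
  shows "poset_of (Abar p r) i j \<longleftrightarrow> bar_le p r i j"
proof
  assume "poset_of (Abar p r) i j"
  then have "(i, j) \<in> (Abar p r)\<^sup>*" by (simp add: poset_of_def)
  then show "bar_le p r i j"
  proof induction
    case (step j k)
    then show ?case using pr ij(1) by (auto simp: bar_le_def Abar_iff)
  qed (simp add: bar_le_def)
next
  let ?E = "Abar p r"
  have up1: "(i, j) \<in> ?E\<^sup>*" if "1 \<le> i" "i \<le> j" "j \<le> p" for i j
    using that pr by (intro rtrancl_interval) (auto simp: Abar_iff)
  have up2: "(i, j) \<in> ?E\<^sup>*" if "p < i" "i \<le> j" "j \<le> p + r" for i j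
    using that pr by (intro rtrancl_interval) (auto simp: Abar_iff)
  have pn: "(p, p + r) \<in> ?E" and one: "(1, p + 1) \<in> ?E" using pr by (auto simp: Abar_iff)
  have bot: "(1, j) \<in> ?E\<^sup>*" if "j \<in> {1..p + r}" for j
    using up1[of 1 j] up2[of "p + 1" j] one that by (cases "j \<le> p") auto
  have top: "(i, p + r) \<in> ?E\<^sup>*" if "i \<in> {1..p + r}" for i
    using up1[of i p] up2[of i "p + r"] pn that by (cases "i \<le> p") auto
  assume "bar_le p r i j"
  then show "poset_of ?E i j"
    using bot top up1 up2 ij unfolding bar_le_def poset_of_def by auto
qed

text \<open>In a chain each unordered pair is counted once and each square once. The ambient
  \<open>S\<close> is kept so that forms of different chains can be added and subtracted.\<close>

lemma qf_chain:
  assumes "finite S" "C \<subseteq> S"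
  shows "qf S (\<lambda>i j. i \<in> C \<and> j \<in> C \<and> i \<le> j) x = ((\<Sum>i\<in>C. x i)\<^sup>2 + (\<Sum>i\<in>C. (x i)\<^sup>2)) / 2"
proof -
  let ?po = "\<lambda>i j. i \<in> C \<and> j \<in> C \<and> i \<le> (j::nat)"
  have fin: "finite C" using assms finite_subset by blast
  have "qf S ?po x = (\<Sum>i\<in>S. \<Sum>j\<in>S. if i \<in> C then if j \<in> C then (1 + of_bool (i = j)) / 2 * x i * x j else 0 else 0)"
    unfolding qf_sym by (intro sum.cong refl) auto
  also have "\<dots> = (\<Sum>i\<in>S. if i \<in> C then \<Sum>j\<in>S. if j \<in> C then (1 + of_bool (i = j)) / 2 * x i * x j else 0 else 0)"
    by (intro sum.cong refl) auto
  also have "\<dots> = (\<Sum>i\<in>S \<inter> C. \<Sum>j\<in>S \<inter> C. (1 + of_bool (i = j)) / 2 * x i * x j)"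
    unfolding sum.inter_restrict[OF assms(1)] ..
  also have "S \<inter> C = C" using assms(2) by blast
  also have "(\<Sum>i\<in>C. \<Sum>j\<in>C. (1 + of_bool (i = j)) / 2 * x i * x j) =
      (\<Sum>i\<in>C. x i * (\<Sum>j\<in>C. x j) / 2 + x i * x i / 2)"
  proof (intro sum.cong refl)
    fix i assume "i \<in> C"
    have "(\<Sum>j\<in>C. (1 + of_bool (i = j)) / 2 * x i * x j) =
        (\<Sum>j\<in>C. x i * x j / 2) + (\<Sum>j\<in>C. if i = j then x i * x j / 2 else 0)"
      unfolding sum.distrib [symmetric] by (intro sum.cong) (auto simp: field_simps)
    then show "(\<Sum>j\<in>C. (1 + of_bool (i = j)) / 2 * x i * x j) = x i * (\<Sum>j\<in>C. x j) / 2 + x i * x i / 2"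
      using fin \<open>i \<in> C\<close> by (simp add: sum_distrib_left sum_divide_distrib)
  qed
  also have "\<dots> = ((\<Sum>i\<in>C. x i)\<^sup>2 + (\<Sum>i\<in>C. (x i)\<^sup>2)) / 2"
    by (simp add: sum.distrib power2_eq_square sum_distrib_right sum_divide_distrib add_divide_distrib)
  finally show ?thesis .
qed

text \<open>Inclusion and exclusion: the comparabilities are those of two maximal chains, which
  share just those of their common endpoints. The labels increase along both chains, so the
  numerical order serves for each of them.\<close>

lemma qf_bar:
  fixes x :: "nat \<Rightarrow> real"
  assumes pr: "2 \<le> p" "1 \<le> r"
  defines "U \<equiv> \<Sum>i\<in>{2..p}. x i" and "W \<equiv> \<Sum>i\<in>{p<..<p + r}. x i"
  shows "2 * qf {1..p + r} (bar_le p r) x =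
    (\<Sum>i\<in>{2..p}. (x i)\<^sup>2) + (\<Sum>i\<in>{p<..<p + r}. (x i)\<^sup>2) + (x 1)\<^sup>2 + (x (p + r))\<^sup>2 +
    (x 1 + x (p + r) + U)\<^sup>2 + (x 1 + x (p + r) + W)\<^sup>2 - (x 1 + x (p + r))\<^sup>2"
proof -
  let ?S = "{1..p + r}"
  define C1 where "C1 = insert 1 (insert (p + r) {2..p})"
  define C2 where "C2 = insert 1 (insert (p + r) {p<..<p + r})"
  define C3 where "C3 = {1, p + r}"
  have sub: "C1 \<subseteq> ?S" "C2 \<subseteq> ?S" "C3 \<subseteq> ?S" using pr by (auto simp: C1_def C2_def C3_def)
  have "(if bar_le p r i j then x i * x j else 0) =
      (if i \<in> C1 \<and> j \<in> C1 \<and> i \<le> j then x i * x j else 0) +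
      (if i \<in> C2 \<and> j \<in> C2 \<and> i \<le> j then x i * x j else 0) -
      (if i \<in> C3 \<and> j \<in> C3 \<and> i \<le> j then x i * x j else 0)" if "i \<in> ?S" "j \<in> ?S" for i j
    using that pr by (auto simp: bar_le_def C1_def C2_def C3_def)
  then have "qf ?S (bar_le p r) x = qf ?S (\<lambda>i j. i \<in> C1 \<and> j \<in> C1 \<and> i \<le> j) x +
      qf ?S (\<lambda>i j. i \<in> C2 \<and> j \<in> C2 \<and> i \<le> j) x - qf ?S (\<lambda>i j. i \<in> C3 \<and> j \<in> C3 \<and> i \<le> j) x"
    unfolding qf_def sum.distrib [symmetric] sum_subtractf [symmetric] by (intro sum.cong refl) simp
  also have "\<dots> = ((\<Sum>i\<in>C1. x i)\<^sup>2 + (\<Sum>i\<in>C1. (x i)\<^sup>2)) / 2 + ((\<Sum>i\<in>C2. x i)\<^sup>2 + (\<Sum>i\<in>C2. (x i)\<^sup>2)) / 2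
      - ((\<Sum>i\<in>C3. x i)\<^sup>2 + (\<Sum>i\<in>C3. (x i)\<^sup>2)) / 2"
    using sub by (simp add: qf_chain)
  finally have q: "2 * qf ?S (bar_le p r) x = (\<Sum>i\<in>C1. x i)\<^sup>2 + (\<Sum>i\<in>C1. (x i)\<^sup>2) +
      ((\<Sum>i\<in>C2. x i)\<^sup>2 + (\<Sum>i\<in>C2. (x i)\<^sup>2)) - ((\<Sum>i\<in>C3. x i)\<^sup>2 + (\<Sum>i\<in>C3. (x i)\<^sup>2))"
    by (simp add: field_simps)
  have s1: "sum f C1 = f 1 + f (p + r) + sum f {2..p}" for f :: "nat \<Rightarrow> real"
    using pr by (simp add: C1_def)
  have s2: "sum f C2 = f 1 + f (p + r) + sum f {p<..<p + r}" for f :: "nat \<Rightarrow> real"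
    using pr by (simp add: C2_def)
  have s3: "sum f C3 = f 1 + f (p + r)" for f :: "nat \<Rightarrow> real"
    using pr by (simp add: C3_def)
  show ?thesis unfolding q s1 s2 s3 U_def W_def by (simp add: algebra_simps)
qed

text \<open>Sharp form of Cauchy--Schwarz for the \<open>card T + 1\<close> numbers \<open>x t\<close> and \<open>- c - sum x T\<close>,
  whose sum is \<open>- c\<close>.\<close>
lemma sum_squares_deviation:
  fixes x :: "nat \<Rightarrow> real"
  assumes "finite T" "real (card T) + 1 = k"
  shows "(\<Sum>t\<in>T. (x t)\<^sup>2) + (c + sum x T)\<^sup>2 =
    c\<^sup>2 / k + (\<Sum>t\<in>T. (x t + c / k)\<^sup>2) + (c + sum x T - c / k)\<^sup>2"
proof -
  have k: "k \<noteq> 0" using assms(2) by auto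
  have "(\<Sum>t\<in>T. (x t + m)\<^sup>2) = (\<Sum>t\<in>T. (x t)\<^sup>2) + 2 * m * sum x T + (k - 1) * m\<^sup>2" for m
  proof -
    have "(\<Sum>t\<in>T. (x t + m)\<^sup>2) = (\<Sum>t\<in>T. (x t)\<^sup>2) + (\<Sum>t\<in>T. 2 * m * x t) + (\<Sum>t\<in>T. m\<^sup>2)"
      unfolding sum.distrib [symmetric] by (intro sum.cong refl) (simp add: power2_sum)
    also have "(\<Sum>t\<in>T. 2 * m * x t) = 2 * m * sum x T" by (rule sum_distrib_left [symmetric])
    finally show ?thesis by (simp flip: assms(2))
  qed
  from this[of "c / k"]
  have "(\<Sum>t\<in>T. (x t + c / k)\<^sup>2) = (\<Sum>t\<in>T. (x t)\<^sup>2) + 2 * (c / k) * sum x T + (k - 1) * (c / k)\<^sup>2" .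
  then show ?thesis
    using k by (simp add: power2_eq_square field_simps)
qed

text \<open>The two chain interiors have \<open>p - 1\<close> and \<open>r - 1\<close> vertices, so
  the deviation identity releases \<open>c^2 / p\<close> and \<open>c^2 / r\<close>. The two
  endpoint squares minus \<open>c^2\<close> leave half the square of the difference and
  \<open>- c^2 / 2\<close>.\<close>

lemma qf_bar_squares:
  fixes x :: "nat \<Rightarrow> real"
  assumes pr: "2 \<le> p" "1 \<le> r"
  defines "c \<equiv> x 1 + x (p + r)"
  defines "U \<equiv> \<Sum>i\<in>{2..p}. x i" and "W \<equiv> \<Sum>i\<in>{p<..<p + r}. x i"
  shows "2 * qf {1..p + r} (bar_le p r) x =
    (1 / p + 1 / r - 1 / 2) * c\<^sup>2 + (x 1 - x (p + r))\<^sup>2 / 2 +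
    (\<Sum>i\<in>{2..p}. (x i + c / p)\<^sup>2) + (c + U - c / p)\<^sup>2 +
    (\<Sum>i\<in>{p<..<p + r}. (x i + c / r)\<^sup>2) + (c + W - c / r)\<^sup>2"
proof -
  have 1: "(\<Sum>i\<in>{2..p}. (x i)\<^sup>2) + (c + U)\<^sup>2 =
      c\<^sup>2 / p + (\<Sum>i\<in>{2..p}. (x i + c / p)\<^sup>2) + (c + U - c / p)\<^sup>2"
    unfolding U_def by (rule sum_squares_deviation) (use pr in \<open>auto simp: of_nat_diff\<close>)
  have 2: "(\<Sum>i\<in>{p<..<p + r}. (x i)\<^sup>2) + (c + W)\<^sup>2 =
      c\<^sup>2 / r + (\<Sum>i\<in>{p<..<p + r}. (x i + c / r)\<^sup>2) + (c + W - c / r)\<^sup>2"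
    unfolding W_def by (rule sum_squares_deviation) (use pr in \<open>auto simp: of_nat_diff\<close>)
  have 3: "(x 1)\<^sup>2 + (x (p + r))\<^sup>2 - c\<^sup>2 = (x 1 - x (p + r))\<^sup>2 / 2 - c\<^sup>2 / 2"
    unfolding c_def by (simp add: power2_eq_square field_simps)
  have "2 * qf {1..p + r} (bar_le p r) x =
      ((\<Sum>i\<in>{2..p}. (x i)\<^sup>2) + (c + U)\<^sup>2) + ((\<Sum>i\<in>{p<..<p + r}. (x i)\<^sup>2) + (c + W)\<^sup>2) +
      ((x 1)\<^sup>2 + (x (p + r))\<^sup>2 - c\<^sup>2)"
    unfolding qf_bar[OF pr] c_def U_def W_def by simp
  then show ?thesis unfolding 1 2 3 by (simp add: algebra_simps)
qed

lemma qf_psd_bar: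
  assumes "2 \<le> p" "1 \<le> r" "1 / 2 \<le> 1 / real p + 1 / real r"
  shows "qf_psd {1..p + r} (bar_le p r)"
  unfolding qf_psd_def
proof
  fix x
  have "0 \<le> 2 * qf {1..p + r} (bar_le p r) x"
    unfolding qf_bar_squares[OF assms(1,2)] using assms(3)
    by (intro add_nonneg_nonneg mult_nonneg_nonneg sum_nonneg) auto
  then show "0 \<le> qf {1..p + r} (bar_le p r) x" by simp
qed

lemma qf_definite_bar:
  assumes "2 \<le> p" "1 \<le> r" "1 / 2 < 1 / real p + 1 / real r"
  shows "qf_definite {1..p + r} (bar_le p r)"
  unfolding qf_definite_def
proof (intro allI impI)
  fix x assume "qf {1..p + r} (bar_le p r) x = 0"
  then have 0: "2 * qf {1..p + r} (bar_le p r) x = 0" by simp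
  define c where "c = x 1 + x (p + r)"
  define k where "k = 1 / real p + 1 / real r - 1 / 2"
  have k: "0 < k" using assms by (simp add: k_def)
  define S1 where "S1 = (\<Sum>i\<in>{2..p}. (x i + c / p)\<^sup>2)"
  define S2 where "S2 = (\<Sum>i\<in>{p<..<p + r}. (x i + c / r)\<^sup>2)"
  define R1 where "R1 = (c + (\<Sum>i\<in>{2..p}. x i) - c / p)\<^sup>2"
  define R2 where "R2 = (c + (\<Sum>i\<in>{p<..<p + r}. x i) - c / r)\<^sup>2"
  have "k * c\<^sup>2 + (x 1 - x (p + r))\<^sup>2 / 2 + S1 + R1 + S2 + R2 = 0"
    using 0 unfolding qf_bar_squares[OF assms(1,2)] c_def k_def S1_def S2_def R1_def R2_def .
  moreover have "0 \<le> k * c\<^sup>2" "0 \<le> (x 1 - x (p + r))\<^sup>2 / 2" "0 \<le> S1" "0 \<le> S2" "0 \<le> R1" "0 \<le> R2"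
    using k by (auto simp: S1_def S2_def R1_def R2_def intro: sum_nonneg)
  ultimately have "k * c\<^sup>2 = 0" "(x 1 - x (p + r))\<^sup>2 / 2 = 0" "S1 = 0" "S2 = 0"
    by linarith+
  then have c: "c = 0" and ab: "x 1 = x (p + r)" using k by auto
  have "x i = 0" if "i \<in> {2..p}" for i
    using \<open>S1 = 0\<close> that c by (simp add: S1_def sum_nonneg_eq_0_iff)
  moreover have "x i = 0" if "i \<in> {p<..<p + r}" for i
    using \<open>S2 = 0\<close> that c by (simp add: S2_def sum_nonneg_eq_0_iff)
  moreover have "x 1 = 0" "x (p + r) = 0" using c ab by (auto simp: c_def)
  moreover have "s = 1 \<or> s = p + r \<or> s \<in> {2..p} \<or> s \<in> {p<..<p + r}" if "s \<in> {1..p + r}" for s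
    using that by auto
  ultimately show "\<forall>s\<in>{1..p + r}. x s = 0" by blast
qed

lemma comp_connected_bar:
  assumes "1 \<le> p"
  shows "comp_connected {1..p + r} (bar_le p r)"
  unfolding comp_connected_def uconnected_def
proof (intro ballI)
  let ?R = "({(x, y). bar_le p r x y} \<union> {(x, y). bar_le p r x y}\<inverse>) \<inter> {1..p + r} \<times> {1..p + r}"
  fix x y assume "x \<in> {1..p + r}" "y \<in> {1..p + r}"
  then have "(x, 1) \<in> ?R" "(1, y) \<in> ?R" using assms by (auto simp: bar_le_def)
  then show "(x, y) \<in> ?R\<^sup>*" by (meson r_into_rtrancl rtrancl_into_rtrancl)
qed

lemma bar_positive_typeI:
  assumes "2 \<le> p" "1 \<le> r" "1 / 2 < 1 / real p + 1 / real r" "dyn_equiv {1..p + r} (bar_le p r) D"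
  shows "positive_type {1..p + r} (bar_le p r) D"
  unfolding positive_type_def
  using assms comp_connected_bar[of p r] qf_psd_bar[of p r] qf_definite_bar[of p r] by simp

text \<open>For \<open>r = 1\<close> the second chain adds no vertex and no comparability, so the
  poset is a single chain, that is, a path with all edges pointing up.\<close>

lemma bar_type_A:
  assumes "1 \<le> p"
  shows "positive_type {1..p + 1} (bar_le p 1) (DA (p + 1))"
proof (rule positive_type_iso[OF _ path_positive_type])
  show "poset_iso id {1..p + 1} (seg_le (\<lambda>_. True)) {1..p + 1} (bar_le p 1)"
    using assms by (auto simp: poset_iso_def seg_le_def bar_le_def)
qed

text \<open>The hypothesis says that the coefficient \<open>1/p + 1/r - 1/2\<close> is negative; the
  unit vector at the minimum gives a positive value.\<close>

lemma bar_indefinite: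
  assumes pr: "2 \<le> p" "1 \<le> r" "2 * p + 2 * r < p * r"
  obtains x y where "qf {1..p + r} (bar_le p r) x < 0" "qf {1..p + r} (bar_le p r) y > 0"
proof
  let ?y = "\<lambda>s::nat. if s = 1 then 1 else 0 :: real"
  have "(\<Sum>i\<in>{2..p}. (?y i)\<^sup>2) = 0" "(\<Sum>i\<in>{2..p}. ?y i) = 0"
    "(\<Sum>i\<in>{p<..<p + r}. (?y i)\<^sup>2) = 0" "(\<Sum>i\<in>{p<..<p + r}. ?y i) = 0"
    using pr by (auto intro!: sum.neutral)
  then have "2 * qf {1..p + r} (bar_le p r) ?y = 2"
    using pr by (simp add: qf_bar)
  then show "qf {1..p + r} (bar_le p r) ?y > 0" by simp
next
  define P R where "P = real p" and "R = real r"
  \<comment> \<open>The vector that kills every square in \<open>qf_bar_squares\<close> except the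
    \<open>c^2\<close> term: equal end values, and interior values \<open>- c / P\<close> and
    \<open>- c / R\<close> for \<open>c = 2 * P * R\<close>.\<close>
  define x where "x s = (if s = 1 \<or> s = p + r then P * R else if s \<le> p then - 2 * R else - 2 * P)" for s
  have U: "(\<Sum>i\<in>{2..p}. (x i)\<^sup>2) = (P - 1) * (2 * R)\<^sup>2" "(\<Sum>i\<in>{2..p}. x i) = (P - 1) * (- 2 * R)"
    using pr by (simp_all add: x_def P_def of_nat_diff)
  have W: "(\<Sum>i\<in>{p<..<p + r}. (x i)\<^sup>2) = (R - 1) * (2 * P)\<^sup>2" "(\<Sum>i\<in>{p<..<p + r}. x i) = (R - 1) * (- 2 * P)"
    using pr by (simp_all add: x_def R_def of_nat_diff)
  have "2 * qf {1..p + r} (bar_le p r) x = 2 * (P * R * (2 * P + 2 * R - P * R))"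
    unfolding qf_bar[OF pr(1,2)] U W using pr
    by (simp add: x_def power2_eq_square algebra_simps)
  moreover have "2 * P + 2 * R - P * R < 0"
  proof -
    have "real (2 * p + 2 * r) < real (p * r)" using pr(3) by (rule less_imp_of_nat_less)
    then show ?thesis by (simp add: P_def R_def)
  qed
  moreover have "0 < P * R" using pr by (simp add: P_def R_def)
  ultimately show "qf {1..p + r} (bar_le p r) x < 0" by (simp add: mult_pos_neg)
qed

section \<open>Dynkin types D and E of two chains\<close>

lemma sum_telescope_squares:
  fixes y :: "nat \<Rightarrow> real"
  assumes "1 \<le> p"
  shows "(\<Sum>j\<in>{1..<p}. (y j - y (Suc j))\<^sup>2) + (y p)\<^sup>2 + (y 1)\<^sup>2 =
    2 * (\<Sum>j\<in>{1..p}. (y j)\<^sup>2) - 2 * (\<Sum>j\<in>{1..<p}. y j * y (Suc j))"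
  using assms
proof (induction p rule: nat_induct_at_least)
  case (Suc p)
  then show ?case by (simp add: power2_eq_square algebra_simps)
qed simp

text \<open>The orthonormal realisation of type D: the leaves 0 and \<open>p + 1\<close> at vertex 1
  contribute a difference and a sum, and the path from 1 to \<open>p\<close> contributes consecutive
  differences.\<close>

lemma dq_DD:
  assumes "2 \<le> p"
  shows "2 * dq (DD (p + 2)) y = (y 0 - y (p + 1))\<^sup>2 + (y 0 + y (p + 1) - y 1)\<^sup>2 +
    (\<Sum>j\<in>{1..<p}. (y j - y (Suc j))\<^sup>2) + (y p)\<^sup>2"
proof -
  have edges: "dyn_edges (DD (p + 2)) = insert (1, p + 1) ((\<lambda>i. (i, Suc i)) ` {..<p})"
    by (auto simp: dyn_edges_def)
  have "(1, p + 1) \<notin> (\<lambda>i. (i, Suc i)) ` {..<p}" using assms by auto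
  then have cross: "(\<Sum>(j, k)\<in>dyn_edges (DD (p + 2)). y j * y k) =
      y 1 * y (p + 1) + (\<Sum>j<p. y j * y (Suc j))"
    unfolding edges by (subst sum.insert) (auto simp: sum.reindex inj_on_def)
  have "{..<p} = insert 0 {1..<p}" "{..<p + 2} = insert 0 (insert (p + 1) {1..p})"
    using assms by auto
  then have s: "(\<Sum>j<p. f j) = f 0 + (\<Sum>j\<in>{1..<p}. f j)"
    "(\<Sum>j<p + 2. f j) = f 0 + f (p + 1) + (\<Sum>j\<in>{1..p}. f j)" for f :: "nat \<Rightarrow> real"
    by simp_all
  have "2 * dq (DD (p + 2)) y = 2 * ((y 0)\<^sup>2 + (y (p + 1))\<^sup>2) - 2 * (y 1 * y (p + 1)) - 2 * (y 0 * y 1)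
      + (2 * (\<Sum>j\<in>{1..p}. (y j)\<^sup>2) - 2 * (\<Sum>j\<in>{1..<p}. y j * y (Suc j)))"
    unfolding dq_def cross dyn_size_def dynkin.case s
    by (simp add: algebra_simps flip: One_nat_def)
  also have "\<dots> = 2 * ((y 0)\<^sup>2 + (y (p + 1))\<^sup>2) - 2 * (y 1 * y (p + 1)) - 2 * (y 0 * y 1)
      + ((\<Sum>j\<in>{1..<p}. (y j - y (Suc j))\<^sup>2) + (y p)\<^sup>2 + (y 1)\<^sup>2)"
    using assms by (subst sum_telescope_squares) auto
  finally show ?thesis by (simp add: power2_eq_square algebra_simps)
qed

text \<open>The simple roots are \<open>b - w, a - b, b - u\<^sub>1, u\<^sub>1 - u\<^sub>2, \<dots>, - a\<close>, where \<open>a\<close> is the minimum,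
  \<open>b\<close> the maximum, and \<open>u\<^sub>1, \<dots>, u\<^sub>p\<^sub>-\<^sub>1\<close> and \<open>w\<close> are the interiors of the two chains.\<close>
lemma dyn_equiv_bar_2:
  assumes p: "2 \<le> p"
  shows "dyn_equiv {1..p + 2} (bar_le p 2) (DD (p + 2))"
proof -
  \<comment> \<open>Each vertex is the negative of a sum of distinct simple roots, so all
    coordinates are 0 or -1.\<close>
  define b :: "nat \<Rightarrow> nat \<Rightarrow> int" where "b j s = - of_bool (if j = 0 then s = p + 1 else if j = p + 1 then True
      else if j = 1 then s \<noteq> 1 else j \<le> s \<and> s \<le> p)" for j s
  \<comment> \<open>Every simple root except the last is the difference of the basis vectors at
    \<open>hi k\<close> and \<open>lo k\<close>; the last one, of index \<open>p + 1\<close>, is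
    minus the minimum.\<close>
  define hi where "hi k = (if k = 0 then p + 2 else if k = 1 then 1 else if k = 2 then p + 2 else k - 1)" for k
  define lo where "lo k = (if k = 0 then p + 1 else if k = 1 then p + 2 else k)" for k
  define b' :: "nat \<Rightarrow> nat \<Rightarrow> int" where
    "b' s k = (if k = p + 1 then - of_bool (s = 1) else of_bool (s = hi k) - of_bool (s = lo k))" for s k
  have "(\<Sum>s\<in>{1..p + 2}. b j s * b' s k) = of_bool (j = k)" if jk: "j < p + 2" "k < p + 2" for j k
  proof (cases "k = p + 1")
    case True
    have "(\<Sum>s\<in>{1..p + 2}. b j s * b' s k) = - (\<Sum>s\<in>{1..p + 2}. of_bool (s = 1) * b j s)"
      unfolding sum_negf [symmetric] by (intro sum.cong refl) (simp add: b'_def True)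
    also have "\<dots> = - b j 1" by (subst sum_of_bool_mult) auto
    finally show ?thesis using True jk p by (auto simp: b_def)
  next
    case False
    have "(\<Sum>s\<in>{1..p + 2}. b j s * b' s k) = (\<Sum>s\<in>{1..p + 2}. (of_bool (s = hi k) - of_bool (s = lo k)) * b j s)"
      by (intro sum.cong refl) (simp add: b'_def False)
    also have "\<dots> = b j (hi k) - b j (lo k)"
      using jk p False by (intro sum_delta_diff) (auto simp: hi_def lo_def)
    finally show ?thesis using False jk p by (auto simp: b_def hi_def lo_def)
  qed
  moreover have "qf {1..p + 2} (bar_le p 2) x = dq (DD (p + 2)) (\<lambda>j. \<Sum>s\<in>{1..p + 2}. real_of_int (b j s) * x s)" for x
  proof -
    define y where "y j = (\<Sum>s\<in>{1..p + 2}. real_of_int (b j s) * x s)" for j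
    define U where "U = (\<Sum>i\<in>{2..p}. x i)"
    have "{1..p + 2} = insert 1 (insert (p + 1) (insert (p + 2) {2..p}))" using p by auto
    then have ys: "y j = real_of_int (b j 1) * x 1 + real_of_int (b j (p + 1)) * x (p + 1)
        + real_of_int (b j (p + 2)) * x (p + 2) + (\<Sum>s\<in>{2..p}. real_of_int (b j s) * x s)" for j
      unfolding y_def using p by simp
    have y0: "y 0 = - x (p + 1)"
      unfolding ys using p by (simp add: b_def)
    have ylast: "y (p + 1) = - (x 1 + x (p + 1) + x (p + 2) + U)"
      unfolding ys U_def using p by (simp add: b_def sum_negf)
    have y1: "y 1 = - (x (p + 1) + x (p + 2) + U)"
      unfolding ys U_def using p by (simp add: b_def sum_negf)
    have yj: "y j = - (\<Sum>i\<in>{j..p}. x i)" if "2 \<le> j" "j \<le> p" for j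
    proof -
      have "(\<Sum>s\<in>{2..p}. real_of_int (b j s) * x s) = (\<Sum>s\<in>{2..p}. if s \<in> {j..p} then - x s else 0)"
        using that by (intro sum.cong refl) (auto simp: b_def)
      also have "\<dots> = (\<Sum>s\<in>{2..p} \<inter> {j..p}. - x s)" by (rule sum.inter_restrict [symmetric]) simp
      also have "{2..p} \<inter> {j..p} = {j..p}" using that by auto
      finally show ?thesis unfolding ys using that by (simp add: b_def sum_negf)
    qed
    have d1: "y 1 - y (Suc 1) = - (x (p + 1) + x (p + 2))"
      using p yj[of 2] unfolding y1 U_def by (simp add: numeral_2_eq_2 [symmetric])
    have dj: "y j - y (Suc j) = - x j" if "2 \<le> j" "j < p" for j
      using that yj[of j] yj[of "Suc j"] sum.atLeast_Suc_atMost[of j p x] by simp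
    have "{1..<p} = insert 1 {2..<p}" using p by auto
    then have "(\<Sum>j\<in>{1..<p}. (y j - y (Suc j))\<^sup>2) = (x (p + 1) + x (p + 2))\<^sup>2 + (\<Sum>j\<in>{2..<p}. (x j)\<^sup>2)"
      using d1 dj by (simp add: power2_commute add.commute)
    moreover have "y p = - x p" using yj[of p] p by simp
    moreover have "{2..p} = insert p {2..<p}" using p by auto
    then have "(\<Sum>i\<in>{2..p}. (x i)\<^sup>2) = (x p)\<^sup>2 + (\<Sum>j\<in>{2..<p}. (x j)\<^sup>2)" by simp
    ultimately have "2 * dq (DD (p + 2)) y = (x 1 + x (p + 2) + U)\<^sup>2 + (x 1 + x (p + 1))\<^sup>2 +
        (x (p + 1) + x (p + 2))\<^sup>2 + (\<Sum>i\<in>{2..p}. (x i)\<^sup>2)"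
      unfolding dq_DD[OF p] y0 ylast y1 by (simp add: power2_eq_square algebra_simps)
    moreover have "{p<..<p + 2} = {p + 1}" by auto
    then have "2 * qf {1..p + 2} (bar_le p 2) x = (\<Sum>i\<in>{2..p}. (x i)\<^sup>2) + (x (p + 1))\<^sup>2 + (x 1)\<^sup>2 + (x (p + 2))\<^sup>2 +
      (x 1 + x (p + 2) + U)\<^sup>2 + (x 1 + x (p + 2) + x (p + 1))\<^sup>2 - (x 1 + x (p + 2))\<^sup>2"
      using qf_bar[of p 2 x] p by (simp add: U_def)
    ultimately show ?thesis unfolding y_def by (simp add: power2_eq_square algebra_simps)
  qed
  moreover have "dyn_wf (DD (p + 2))" using p by (auto simp: dyn_wf_def dyn_edges_def dyn_size_def)
  ultimately show ?thesis
    unfolding dyn_equiv_def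
    by (intro conjI exI[of _ b] exI[of _ b']) (auto simp: dyn_size_def)
qed

lemma bar_type_D:
  assumes "2 \<le> p"
  shows "positive_type {1..p + 2} (bar_le p 2) (DD (p + 2))"
  using assms by (intro bar_positive_typeI dyn_equiv_bar_2) auto

text \<open>With \<open>w\<^sub>1, w\<^sub>2\<close> the interior of the second chain, the simple roots are \<open>a - b\<close> (branch vertex),
  \<open>- a\<close>, \<open>b - w\<^sub>1, w\<^sub>1 - w\<^sub>2\<close> and \<open>b - u\<^sub>1, u\<^sub>1 - u\<^sub>2, \<dots>\<close>.\<close>
definition bar3_coord :: "nat \<Rightarrow> nat \<Rightarrow> nat \<Rightarrow> int" where
  "bar3_coord p j s = - of_bool (if j = 0 then s \<noteq> 1 else if j = 1 then True
     else if j = 2 then s = p + 1 \<or> s = p + 2 else if j = 3 then s = p + 2 else j - 2 \<le> s \<and> s \<le> p)"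

text \<open>The indices follow the numbering of the E graphs: 0 is the branch vertex, 1 the short
  arm, 2 and 3 the second arm, and 4 onwards the remaining arm. The value at index 1 has no meaning,
  since \<open>bar3_root\<close> treats that root separately.\<close>

definition bar3_upper :: "nat \<Rightarrow> nat \<Rightarrow> nat" where
  "bar3_upper p k = (if k = 0 then 1 else if k = 2 \<or> k = 4 then p + 3 else if k = 3 then p + 1 else k - 3)"

definition bar3_lower :: "nat \<Rightarrow> nat \<Rightarrow> nat" where
  "bar3_lower p k = (if k = 0 then p + 3 else if k = 2 then p + 1 else if k = 3 then p + 2 else k - 2)"

definition bar3_root :: "nat \<Rightarrow> nat \<Rightarrow> nat \<Rightarrow> int" where
  "bar3_root p s k = (if k = 1 then - of_bool (s = 1)
     else of_bool (s = bar3_upper p k) - of_bool (s = bar3_lower p k))"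

lemma bar3_inverse:
  assumes p: "2 \<le> p" and jk: "j < p + 3" "k < p + 3"
  shows "(\<Sum>s\<in>{1..p + 3}. bar3_coord p j s * bar3_root p s k) = of_bool (j = k)"
proof (cases "k = 1")
  case True
  have "(\<Sum>s\<in>{1..p + 3}. bar3_coord p j s * bar3_root p s k) = - (\<Sum>s\<in>{1..p + 3}. of_bool (s = 1) * bar3_coord p j s)"
    unfolding sum_negf [symmetric] by (intro sum.cong refl) (simp add: bar3_root_def True)
  also have "\<dots> = - bar3_coord p j 1" by (subst sum_of_bool_mult) auto
  finally show ?thesis using True jk p by (auto simp: bar3_coord_def)
next
  case False
  have "(\<Sum>s\<in>{1..p + 3}. bar3_coord p j s * bar3_root p s k) =
      (\<Sum>s\<in>{1..p + 3}. (of_bool (s = bar3_upper p k) - of_bool (s = bar3_lower p k)) * bar3_coord p j s)"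
    by (intro sum.cong refl) (simp add: bar3_root_def False)
  also have "\<dots> = bar3_coord p j (bar3_upper p k) - bar3_coord p j (bar3_lower p k)"
    using jk p False by (intro sum_delta_diff) (auto simp: bar3_upper_def bar3_lower_def)
  also have "\<dots> = of_bool (j = k)"
  proof -
    consider "j = 0" | "j = 1" | "j = 2" | "j = 3" | "4 \<le> j" by linarith
    note j_cases = this
    consider "k = 0" | "k = 2" | "k = 3" | "k = 4" | "5 \<le> k" using False by linarith
    then show ?thesis
    proof cases
      case 5
      have *: "bar3_upper p k = k - 3" "bar3_lower p k = k - 2"
        using 5 by (simp_all add: bar3_upper_def bar3_lower_def)
      have k: "k - 3 \<noteq> 1" "k - 2 \<noteq> 1" "k - 3 \<le> p" "k - 2 \<le> p" "k \<notin> {0, 1, 2, 3}"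
        using jk 5 by auto
      have "j - 2 \<le> k - 3 \<longleftrightarrow> j < k" "j - 2 \<le> k - 2 \<longleftrightarrow> j \<le> k" if "4 \<le> j"
        using that 5 by auto
      with k jk p show ?thesis unfolding * by (cases rule: j_cases) (simp_all add: bar3_coord_def)
    next
      case 1
      then show ?thesis using jk p
        by (cases rule: j_cases) (simp_all add: bar3_coord_def bar3_upper_def bar3_lower_def)
    next
      case 2
      then show ?thesis using jk p
        by (cases rule: j_cases) (simp_all add: bar3_coord_def bar3_upper_def bar3_lower_def)
    next
      case 3
      then show ?thesis using jk p
        by (cases rule: j_cases) (simp_all add: bar3_coord_def bar3_upper_def bar3_lower_def)
    next
      case 4
      have "j - 2 \<le> 2 \<longleftrightarrow> j = 4" if "4 \<le> j" using that by auto
      with 4 show ?thesis using jk p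
        by (cases rule: j_cases) (simp_all add: bar3_coord_def bar3_upper_def bar3_lower_def)
    qed
  qed
  finally show ?thesis .
qed

text \<open>The squares are those of \<open>qf_bar\<close> in the new coordinates:
  \<open>y 0 - y 1\<close> is the minimum, \<open>y 2 + y 4 - y 0\<close> the maximum,
  \<open>y 2 + y 4 - y 1\<close> their sum, and the remaining linear forms are, up to sign, interior
  values and the two chain sums. The identity is uniform in \<open>p\<close>.\<close>

lemma qf_bar3:
  fixes x :: "nat \<Rightarrow> real"
  assumes p: "2 \<le> p"
  defines "y \<equiv> \<lambda>j. \<Sum>s\<in>{1..p + 3}. real_of_int (bar3_coord p j s) * x s"
  shows "2 * qf {1..p + 3} (bar_le p 3) x = (\<Sum>j\<in>{4..<p + 2}. (y j - y (Suc j))\<^sup>2) + (y (p + 2))\<^sup>2 +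
    (y 3 - y 2)\<^sup>2 + (y 3)\<^sup>2 + (y 0 - y 1)\<^sup>2 + (y 2 + y 4 - y 0)\<^sup>2 + (y 2 - y 1)\<^sup>2 + (y 4 - y 1)\<^sup>2 -
    (y 2 + y 4 - y 1)\<^sup>2"
proof -
  define U where "U = (\<Sum>i\<in>{2..p}. x i)"
  have "{1..p + 3} = insert 1 (insert (p + 1) (insert (p + 2) (insert (p + 3) {2..p})))" using p by auto
  then have ys: "y j = real_of_int (bar3_coord p j 1) * x 1 + real_of_int (bar3_coord p j (p + 1)) * x (p + 1)
      + real_of_int (bar3_coord p j (p + 2)) * x (p + 2) + real_of_int (bar3_coord p j (p + 3)) * x (p + 3)
      + (\<Sum>s\<in>{2..p}. real_of_int (bar3_coord p j s) * x s)" for j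
    unfolding y_def using p by simp
  have y0: "y 0 = - (x (p + 1) + x (p + 2) + x (p + 3) + U)"
    unfolding ys U_def using p by (simp add: bar3_coord_def sum_negf)
  have y1: "y 1 = - (x 1 + x (p + 1) + x (p + 2) + x (p + 3) + U)"
    unfolding ys U_def using p by (simp add: bar3_coord_def sum_negf)
  have y2: "y 2 = - (x (p + 1) + x (p + 2))"
    unfolding ys using p by (simp add: bar3_coord_def)
  have y3: "y 3 = - x (p + 2)"
    unfolding ys using p by (simp add: bar3_coord_def)
  have yj: "y j = - (\<Sum>i\<in>{j - 2..p}. x i)" if "4 \<le> j" "j \<le> p + 2" for j
  proof -
    have "(\<Sum>s\<in>{2..p}. real_of_int (bar3_coord p j s) * x s) = (\<Sum>s\<in>{2..p}. if s \<in> {j - 2..p} then - x s else 0)"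
      using that by (intro sum.cong refl) (auto simp: bar3_coord_def)
    also have "\<dots> = (\<Sum>s\<in>{2..p} \<inter> {j - 2..p}. - x s)" by (rule sum.inter_restrict [symmetric]) simp
    also have "{2..p} \<inter> {j - 2..p} = {j - 2..p}" using that by auto
    moreover have "\<not> j - 2 \<le> 1" using that by simp
    ultimately show ?thesis unfolding ys using that by (simp add: bar3_coord_def sum_negf)
  qed
  have y4: "y 4 = - U" using yj[of 4] p by (simp add: U_def)
  have dj: "y j - y (Suc j) = - x (j - 2)" if "4 \<le> j" "j < p + 2" for j
  proof -
    have eq: "Suc j - 2 = Suc (j - 2)" and le: "j - 2 \<le> p" using that by auto
    have "y j = - sum x {j - 2..p}" by (rule yj) (use that in auto)
    also have "sum x {j - 2..p} = x (j - 2) + sum x {Suc (j - 2)..p}"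
      by (rule sum.atLeast_Suc_atMost[OF le])
    finally have "y j = - (x (j - 2) + sum x {Suc (j - 2)..p})" .
    moreover have "y (Suc j) = - sum x {Suc (j - 2)..p}"
      unfolding eq [symmetric] by (rule yj) (use that in auto)
    ultimately show ?thesis by linarith
  qed
  have "(\<Sum>j\<in>{4..<p + 2}. (y j - y (Suc j))\<^sup>2) = (\<Sum>j\<in>{4..<p + 2}. (x (j - 2))\<^sup>2)"
    using dj by (intro sum.cong refl) simp
  also have "\<dots> = (\<Sum>i\<in>{2..<p}. (x i)\<^sup>2)"
    by (rule sum.reindex_bij_witness[of _ "\<lambda>i. i + 2" "\<lambda>j. j - 2"]) auto
  moreover have "y (p + 2) = - x p" using yj[of "p + 2"] p by simp
  moreover have "{2..p} = insert p {2..<p}" using p by auto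
  then have "(\<Sum>i\<in>{2..p}. (x i)\<^sup>2) = (x p)\<^sup>2 + (\<Sum>j\<in>{2..<p}. (x j)\<^sup>2)" by simp
  moreover have "{p<..<p + 3} = {p + 1, p + 2}" by auto
  ultimately show ?thesis
    using p by (subst qf_bar) (simp_all add: y0 y1 y2 y3 y4 flip: U_def, simp add: power2_eq_square algebra_simps)
qed

text \<open>Reduces each E type to one polynomial identity, which for a fixed \<open>p\<close> is
  verified by expansion.\<close>

lemma dyn_equiv_bar3I:
  assumes "2 \<le> p" "dyn_size D = p + 3" "dyn_wf D"
    and "\<And>y :: nat \<Rightarrow> real. 2 * dq D y = (\<Sum>j\<in>{4..<p + 2}. (y j - y (Suc j))\<^sup>2) + (y (p + 2))\<^sup>2 +
      (y 3 - y 2)\<^sup>2 + (y 3)\<^sup>2 + (y 0 - y 1)\<^sup>2 + (y 2 + y 4 - y 0)\<^sup>2 + (y 2 - y 1)\<^sup>2 + (y 4 - y 1)\<^sup>2 -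
      (y 2 + y 4 - y 1)\<^sup>2"
  shows "dyn_equiv {1..p + 3} (bar_le p 3) D"
proof -
  have "qf {1..p + 3} (bar_le p 3) x = dq D (\<lambda>j. \<Sum>s\<in>{1..p + 3}. real_of_int (bar3_coord p j s) * x s)" for x
  proof -
    have "2 * qf {1..p + 3} (bar_le p 3) x =
        2 * dq D (\<lambda>j. \<Sum>s\<in>{1..p + 3}. real_of_int (bar3_coord p j s) * x s)"
      unfolding assms(4) qf_bar3[OF assms(1)] ..
    then show ?thesis by simp
  qed
  moreover have "card {1..p + 3} = dyn_size D" by (simp add: assms(2))
  moreover have "(\<Sum>s\<in>{1..p + 3}. bar3_coord p j s * bar3_root p s k) = of_bool (j = k)"
    if "j < dyn_size D" "k < dyn_size D" for j k
    using bar3_inverse[OF assms(1)] that by (simp add: assms(2))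
  ultimately show ?thesis
    unfolding dyn_equiv_def using assms(3) by blast
qed

lemma lessThan_numerals:
  "{..<6::nat} = {0, 1, 2, 3, 4, 5}" "{..<7::nat} = {0, 1, 2, 3, 4, 5, 6}"
  "{..<8::nat} = {0, 1, 2, 3, 4, 5, 6, 7}"
  unfolding set_eq_iff lessThan_iff insert_iff empty_iff by presburger+

lemma dyn_equiv_bar_33: "dyn_equiv {1..6} (bar_le 3 3) DE6"
proof -
  have set: "{4..<5::nat} = {4}" by auto
  have "dyn_equiv {1..3 + 3} (bar_le 3 3) DE6"
    by (rule dyn_equiv_bar3I)
      (simp_all add: dyn_size_def dyn_wf_def dyn_edges_def dq_def lessThan_numerals set,
        simp add: power2_eq_square algebra_simps)
  then show ?thesis by simp
qed

lemma dyn_equiv_bar_43: "dyn_equiv {1..7} (bar_le 4 3) DE7"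
proof -
  have set: "{4..<6::nat} = {4, 5}" by auto
  have "dyn_equiv {1..4 + 3} (bar_le 4 3) DE7"
    by (rule dyn_equiv_bar3I)
      (simp_all add: dyn_size_def dyn_wf_def dyn_edges_def dq_def lessThan_numerals set,
        simp add: power2_eq_square algebra_simps)
  then show ?thesis by simp
qed

lemma dyn_equiv_bar_53: "dyn_equiv {1..8} (bar_le 5 3) DE8"
proof -
  have set: "{4..<7::nat} = {4, 5, 6}" by auto
  have "dyn_equiv {1..5 + 3} (bar_le 5 3) DE8"
    by (rule dyn_equiv_bar3I)
      (simp_all add: dyn_size_def dyn_wf_def dyn_edges_def dq_def lessThan_numerals set,
        simp add: power2_eq_square algebra_simps)
  then show ?thesis by simp
qed

lemma bar_type_E:
  "positive_type {1..6} (bar_le 3 3) DE6" "positive_type {1..7} (bar_le 4 3) DE7"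
  "positive_type {1..8} (bar_le 5 3) DE8"
  using bar_positive_typeI[of 3 3] bar_positive_typeI[of 4 3] bar_positive_typeI[of 5 3]
    dyn_equiv_bar_33 dyn_equiv_bar_43 dyn_equiv_bar_53
  by simp_all

section \<open>The two principal pairs of chains\<close>

lemma bar_iso_remove:
  assumes "2 \<le> p" "1 \<le> r"
  shows "poset_iso (\<lambda>i. if i < p then i else Suc i) {1..p - 1 + r} (bar_le (p - 1) r)
    ({1..p + r} - {p}) (bar_le p r)"
proof -
  let ?f = "\<lambda>i. if i < p then i else Suc i"
  have "bij_betw ?f {1..p - 1 + r} ({1..p + r} - {p})"
    by (rule bij_betw_byWitness[where f' = "\<lambda>i. if i < p then i else i - 1"]) (use assms in auto)
  moreover have "bar_le (p - 1) r i j \<longleftrightarrow> bar_le p r (?f i) (?f j)"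
    if "i \<in> {1..p - 1 + r}" "j \<in> {1..p - 1 + r}" for i j
    using that assms unfolding bar_le_def by auto
  ultimately show ?thesis by (simp add: poset_iso_def)
qed

lemma bar_principalI:
  fixes h :: "nat \<Rightarrow> int"
  assumes "2 \<le> p" "1 \<le> r" "1 / 2 \<le> 1 / real p + 1 / real r"
    and "h p = 1" "qf {1..p + r} (bar_le p r) (\<lambda>s. real_of_int (h s)) = 0"
    and "positive_type {1..p - 1 + r} (bar_le (p - 1) r) D"
  shows "principal_type {1..p + r} (bar_le p r) D"
proof -
  have "positive_type ({1..p + r} - {p}) (bar_le p r) D"
    by (rule positive_type_iso[OF bar_iso_remove assms(6)]) (use assms in auto)
  then show ?thesis
    unfolding principal_type_def
    using assms qf_psd_bar[of p r] comp_connected_bar[of p r]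
    by (intro conjI bexI[of _ p] exI[of _ h]) auto
qed

text \<open>Exchanges the two chains. It is needed because deleting a vertex from the pair (4,4)
  gives (3,4), while the type was determined for (4,3).\<close>

lemma bar_iso_flip:
  "poset_iso (\<lambda>i. if i = 1 \<or> i = p + r then i else if i \<le> p then i + r - 1 else i + 1 - p)
    {1..p + r} (bar_le p r) {1..r + p} (bar_le r p)" if "2 \<le> p" "2 \<le> r"
proof -
  let ?f = "\<lambda>i. if i = 1 \<or> i = p + r then i else if i \<le> p then i + r - 1 else i + 1 - p"
  have "bij_betw ?f {1..p + r} {1..r + p}"
    by (rule bij_betw_byWitness[where f' = "\<lambda>i. if i = 1 \<or> i = p + r then i else if i \<le> r then i + p - 1 else i + 1 - r"])
      (use that in auto)
  moreover have "bar_le p r i j \<longleftrightarrow> bar_le r p (?f i) (?f j)"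
    if "i \<in> {1..p + r}" "j \<in> {1..p + r}" for i j
    using that \<open>2 \<le> p\<close> \<open>2 \<le> r\<close> unfolding bar_le_def by auto
  ultimately show ?thesis by (simp add: poset_iso_def)
qed

lemma bar_type_E7_principal: "principal_type {1..8} (bar_le 4 4) DE7"
proof -
  have "positive_type {1..7} (bar_le 3 4) DE7"
    using positive_type_iso[OF bar_iso_flip[of 4 3] ] bar_type_E(2) by simp
  moreover have sets: "{4<..<8} = {5, 6, 7::nat}" "{2..4} = {2, 3, 4::nat}" by auto
  \<comment> \<open>The test vector of the indefinite case, rescaled: with \<open>c = - 4\<close>
    the interior values are \<open>- c / 4 = 1\<close>. Since \<open>1/4 + 1/4 = 1/2\<close>, the
    \<open>c^2\<close> term vanishes too.\<close>
  have "qf {1..8} (bar_le 4 4) (\<lambda>s. real_of_int (if s = 1 \<or> s = 8 then - 2 else 1)) = 0"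
    using qf_bar[of 4 4 "\<lambda>s. real_of_int (if s = 1 \<or> s = 8 then - 2 else 1)"]
    by (simp add: sets)
  ultimately show ?thesis
    using bar_principalI[of 4 4 "\<lambda>s. if s = 1 \<or> s = 8 then - 2 else 1" DE7] by simp
qed

lemma bar_type_E8_principal: "principal_type {1..9} (bar_le 6 3) DE8"
proof -
  have sets: "{2..6} = {2, 3, 4, 5, 6::nat}" "{6<..<9} = {7, 8::nat}" by auto
  \<comment> \<open>Again interior values \<open>- c / p\<close> and \<open>- c / r\<close>, now
    with \<open>c = - 6\<close>: they are 1 on the chain of 6 arrows and 2 on the chain of 3
    arrows.\<close>
  let ?h = "\<lambda>s::nat. if s = 1 \<or> s = 9 then - 3 else if s \<le> 6 then 1 else 2 :: int"
  have "qf {1..9} (bar_le 6 3) (\<lambda>s. real_of_int (?h s)) = 0"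
    using qf_bar[of 6 3 "\<lambda>s. real_of_int (?h s)"] by (simp add: sets)
  then show ?thesis
    using bar_principalI[of 6 3 ?h DE8] bar_type_E(3) by simp
qed

section \<open>Connected graphs of maximal degree two\<close>

definition adjacent :: "(nat \<times> nat) set \<Rightarrow> nat \<Rightarrow> nat \<Rightarrow> bool" where
  "adjacent A u v \<longleftrightarrow> (u, v) \<in> A \<or> (v, u) \<in> A"

lemma adjacent_sym: "adjacent A u v \<Longrightarrow> adjacent A v u"
  by (auto simp: adjacent_def)

lemma nbrs_eq: "nbrs A v = {u. adjacent A u v}"
  by (simp add: nbrs_def adjacent_def)

definition graph_path :: "(nat \<times> nat) set \<Rightarrow> nat list \<Rightarrow> bool" where
  "graph_path A xs \<longleftrightarrow> distinct xs \<and> (\<forall>k. Suc k < length xs \<longrightarrow> adjacent A (xs ! k) (xs ! Suc k))"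

locale degree_two_graph =
  fixes n :: nat and A :: "(nat \<times> nat) set"
  assumes n: "1 \<le> n"
    and dig: "digraph_on n A"
    and acyc: "acyclic A"
    and con: "uconnected {1..n} A"
    and deg: "\<forall>v\<in>{1..n}. degree A v \<le> 2"
begin

lemma adjacent_mem: "adjacent A u v \<Longrightarrow> u \<in> {1..n} \<and> v \<in> {1..n}"
  using dig by (auto simp: adjacent_def digraph_on_def)

lemma adjacent_irrefl: "\<not> adjacent A u u"
  using acyc by (auto simp: adjacent_def acyclic_def)

lemma adjacent_antisym: "(u, v) \<in> A \<Longrightarrow> (v, u) \<notin> A"
  using acyc by (meson acyclic_def trancl.simps)

lemma finite_nbrs: "finite (nbrs A v)"
  by (rule finite_subset[of _ "{1..n}"]) (use adjacent_mem in \<open>auto simp: nbrs_eq\<close>)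

lemma nbrs_two:
  assumes "adjacent A u v" "adjacent A w v" "u \<noteq> w" "adjacent A x v"
  shows "x = u \<or> x = w"
proof (rule ccontr)
  assume "\<not> (x = u \<or> x = w)"
  then have "card {u, w, x} = 3" using assms(3) by auto
  moreover have "card {u, w, x} \<le> card (nbrs A v)"
    using assms by (intro card_mono finite_nbrs) (auto simp: nbrs_eq)
  moreover have "card (nbrs A v) \<le> 2" using deg adjacent_mem[OF assms(1)] by (auto simp: degree_def)
  ultimately show False by simp
qed

lemma closed_imp_all:
  assumes "x \<in> S" "x \<in> {1..n}" "\<And>u v. u \<in> S \<Longrightarrow> adjacent A u v \<Longrightarrow> v \<in> S"
  shows "{1..n} \<subseteq> S"
proof
  fix y assume "y \<in> {1..n}"
  then have "(x, y) \<in> ((A \<union> A\<inverse>) \<inter> {1..n} \<times> {1..n})\<^sup>*"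
    using con assms(2) unfolding uconnected_def by blast
  then show "y \<in> S"
    by induction (use assms in \<open>auto simp: adjacent_def\<close>)
qed

text \<open>A longest path works. By maximality its ends have no neighbours off the path, and by the
  degree bound its inner vertices have none beyond their two path neighbours. So its vertex set is
  closed under adjacency and, by connectedness, is everything; the only possible extra edge joins
  the two ends.\<close>

lemma hamiltonian_path:
  "\<exists>xs. distinct xs \<and> set xs = {1..n} \<and> length xs = n \<and>
    (\<forall>i j. i < j \<longrightarrow> j < n \<longrightarrow> adjacent A (xs ! i) (xs ! j) \<longrightarrow> j = Suc i \<or> i = 0 \<and> j = n - 1) \<and>
    (\<forall>i. Suc i < n \<longrightarrow> adjacent A (xs ! i) (xs ! Suc i))"
proof -
  define P where "P xs \<longleftrightarrow> graph_path A xs \<and> set xs \<subseteq> {1..n} \<and> xs \<noteq> []" for xs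
  have start: "P [1]" using n by (auto simp: P_def graph_path_def)
  have bound: "length xs \<le> n" if "P xs" for xs
    using that card_mono[of "{1..n}" "set xs"] distinct_card[of xs]
    by (auto simp: P_def graph_path_def)
  have "\<exists>xs. P xs \<and> (\<forall>ys. P ys \<longrightarrow> length ys \<le> length xs)"
    by (rule ex_has_greatest_nat[of P "[1]" length "Suc n"], rule start)
      (use bound in \<open>simp add: less_Suc_eq_le\<close>)
  then obtain xs where P: "P xs" and max: "\<And>ys. P ys \<Longrightarrow> length ys \<le> length xs"
    by blast
  let ?m = "length xs"
  have dist: "distinct xs" and sub: "set xs \<subseteq> {1..n}" and m: "0 < ?m"
    and edge: "\<And>k. Suc k < ?m \<Longrightarrow> adjacent A (xs ! k) (xs ! Suc k)"
    using P by (auto simp: P_def graph_path_def)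
  have first: "u \<in> set xs" if "adjacent A u (xs ! 0)" for u
  proof (rule ccontr)
    assume "u \<notin> set xs"
    moreover have "adjacent A ((u # xs) ! k) ((u # xs) ! Suc k)" if "Suc k < length (u # xs)" for k
      using that edge[of "k - 1"] \<open>adjacent A u (xs ! 0)\<close> by (cases k) auto
    ultimately have "P (u # xs)"
      using P adjacent_mem[OF that] by (auto simp: P_def graph_path_def)
    with max show False by fastforce
  qed
  have last: "u \<in> set xs" if "adjacent A u (xs ! (?m - 1))" for u
  proof (rule ccontr)
    assume "u \<notin> set xs"
    moreover have "adjacent A ((xs @ [u]) ! k) ((xs @ [u]) ! Suc k)" if "Suc k < length (xs @ [u])" for k
    proof (cases "Suc k < ?m")
      case False
      with that have "k = ?m - 1" "Suc k = ?m" by auto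
      then show ?thesis using m adjacent_sym[OF \<open>adjacent A u (xs ! (?m - 1))\<close>] by (simp add: nth_append)
    qed (use edge in \<open>simp add: nth_append\<close>)
    ultimately have "P (xs @ [u])"
      using P adjacent_mem[OF that] by (auto simp: P_def graph_path_def)
    with max show False by fastforce
  qed
  have inner: "u = xs ! (k - 1) \<or> u = xs ! Suc k"
    if "0 < k" "Suc k < ?m" "adjacent A u (xs ! k)" for u k
  proof (rule nbrs_two[OF _ _ _ that(3)])
    show "adjacent A (xs ! (k - 1)) (xs ! k)" using edge[of "k - 1"] that by simp
    show "adjacent A (xs ! Suc k) (xs ! k)" using edge[of k] that by (auto intro: adjacent_sym)
    show "xs ! (k - 1) \<noteq> xs ! Suc k" using dist that by (simp add: nth_eq_iff_index_eq)
  qed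
  have closed: "v \<in> set xs" if u: "u \<in> set xs" and uv: "adjacent A u v" for u v
  proof -
    obtain k where k: "k < ?m" "u = xs ! k" using u by (auto simp: in_set_conv_nth)
    consider "k = 0" | "k = ?m - 1" | "0 < k" "Suc k < ?m" using k by linarith
    then show ?thesis
      using first last inner[of k v] adjacent_sym[OF uv] k by cases auto
  qed
  have "xs ! 0 \<in> set xs" using m by simp
  then have set: "set xs = {1..n}"
    using closed_imp_all[of "xs ! 0" "set xs"] sub closed by blast
  then have len: "?m = n" using distinct_card[OF dist] by simp
  show ?thesis
  proof (intro exI[of _ xs] conjI allI impI dist set len)
    fix i j assume ij: "i < j" "j < n" "adjacent A (xs ! i) (xs ! j)"
    have i: "j = i - 1 \<or> j = Suc i" if "0 < i"
      using inner[of i "xs ! j"] that ij adjacent_sym[OF ij(3)] dist len by (auto simp: nth_eq_iff_index_eq)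
    have j: "i = j - 1 \<or> i = Suc j" if "j < n - 1"
      using inner[of j "xs ! i"] that ij dist len by (auto simp: nth_eq_iff_index_eq)
    show "j = Suc i \<or> i = 0 \<and> j = n - 1" using i j ij by linarith
  qed (use edge len in auto)
qed

text \<open>The case is decided by whether the ends of the path are adjacent; for
  \<open>n = 2\<close> they are adjacent merely as consecutive vertices, hence the bound
  \<open>3 \<le> n\<close>. A cycle is rotated until a sink stands last.\<close>

lemma path_or_cycle_labelling:
  obtains (path) \<sigma> where "bij_betw \<sigma> {1..n} {1..n}"
    "\<And>i j. i \<in> {1..n} \<Longrightarrow> j \<in> {1..n} \<Longrightarrow> adjacent A (\<sigma> i) (\<sigma> j) \<longleftrightarrow> j = Suc i \<or> i = Suc j"
  | (cycle) \<sigma> where "3 \<le> n" "bij_betw \<sigma> {1..n} {1..n}" "is_sink A (\<sigma> n)"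
    "\<And>i j. i \<in> {1..n} \<Longrightarrow> j \<in> {1..n} \<Longrightarrow>
      adjacent A (\<sigma> i) (\<sigma> j) \<longleftrightarrow> j = Suc i \<or> i = Suc j \<or> i = 1 \<and> j = n \<or> i = n \<and> j = 1"
proof -
  obtain xs where xs: "distinct xs" "set xs = {1..n}" "length xs = n"
    and xs45: "\<forall>i j. i < j \<longrightarrow> j < n \<longrightarrow> adjacent A (xs ! i) (xs ! j) \<longrightarrow> j = Suc i \<or> i = 0 \<and> j = n - 1"
      "\<forall>i. Suc i < n \<longrightarrow> adjacent A (xs ! i) (xs ! Suc i)"
    using hamiltonian_path by blast
  note xs = xs xs45[rule_format]
  have bij: "bij_betw (\<lambda>i. ys ! (i - 1)) {1..n} {1..n}"
    if "distinct ys" "set ys = {1..n}" "length ys = n" for ys :: "nat list"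
  proof -
    have "bij_betw (\<lambda>i. i - 1) {1..n} {..<n}"
      by (rule bij_betw_byWitness[where f' = Suc]) auto
    moreover have "bij_betw ((!) ys) {..<n} {1..n}"
      using that by (intro bij_betw_nth) auto
    ultimately show ?thesis using bij_betw_trans by (fastforce simp: comp_def)
  qed
  show ?thesis
  proof (cases "3 \<le> n \<and> adjacent A (xs ! 0) (xs ! (n - 1))")
    case False
    have lt: "adjacent A (xs ! i) (xs ! j) \<longleftrightarrow> j = Suc i" if "i < j" "j < n" for i j
    proof
      assume adj: "adjacent A (xs ! i) (xs ! j)"
      from xs(4)[OF that adj] show "j = Suc i"
      proof
        assume ij: "i = 0 \<and> j = n - 1"
        with adj False have "n < 3" by auto
        with ij that show ?thesis by simp
      qed
    qed (use xs(5) that in auto)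
    show ?thesis
    proof (rule path[OF bij[OF xs(1-3)]])
      fix i j assume ij: "i \<in> {1..n}" "j \<in> {1..n}"
      consider "i < j" | "i = j" | "j < i" by linarith
      then show "adjacent A (xs ! (i - 1)) (xs ! (j - 1)) \<longleftrightarrow> j = Suc i \<or> i = Suc j"
      proof cases
        case 1
        with lt[of "i - 1" "j - 1"] ij show ?thesis by auto
      next
        case 2
        then show ?thesis by (simp add: adjacent_irrefl)
      next
        case 3
        have "adjacent A (xs ! (i - 1)) (xs ! (j - 1)) \<longleftrightarrow> adjacent A (xs ! (j - 1)) (xs ! (i - 1))"
          by (auto simp: adjacent_def)
        with 3 lt[of "j - 1" "i - 1"] ij show ?thesis by auto
      qed
    qed
  next
    case True
    then have n3: "3 \<le> n" and closing: "adjacent A (xs ! 0) (xs ! (n - 1))" by auto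
    have lt: "adjacent A (xs ! i) (xs ! j) \<longleftrightarrow> j = Suc i mod n \<or> i = Suc j mod n" if "i < j" "j < n" for i j
    proof -
      have "Suc i mod n = Suc i" "Suc j mod n = (if j = n - 1 then 0 else Suc j)"
        using that by (auto simp: mod_Suc)
      then show ?thesis using xs(4)[OF that] xs(5)[of i] closing that by auto
    qed
    have cyc: "adjacent A (xs ! i) (xs ! j) \<longleftrightarrow> j = Suc i mod n \<or> i = Suc j mod n" if "i < n" "j < n" for i j
    proof -
      consider "i < j" | "i = j" | "j < i" by linarith
      then show ?thesis
      proof cases
        case 2
        then show ?thesis using that n3 by (auto simp: adjacent_irrefl mod_Suc)
      qed (use lt that adjacent_sym in blast)+
    qed
    \<comment> \<open>A finite acyclic digraph has a sink, found as a minimal vertex for the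
      converse arrows.\<close>
    have "finite A" using dig finite_subset unfolding digraph_on_def by blast
    then have "wf (A\<inverse>)" using acyc by (rule finite_acyclic_wf_converse)
    then obtain z where z: "z \<in> {1..n}" "\<And>y. (y, z) \<in> A\<inverse> \<Longrightarrow> y \<notin> {1..n}"
      using wfE_min[of "A\<inverse>" 1 "{1..n}"] n by auto
    have sink: "is_sink A z"
      using z dig unfolding is_sink_def digraph_on_def by blast
    obtain s where s: "s < n" "z = xs ! s" using z(1) xs(2,3) by (metis in_set_conv_nth)
    define ys where "ys = rotate (Suc s) xs"
    have ys: "distinct ys" "set ys = {1..n}" "length ys = n" using xs by (auto simp: ys_def)
    have nth: "ys ! k = xs ! ((Suc s + k) mod n)" if "k < n" for k
      unfolding ys_def using nth_rotate[of k xs "Suc s"] that xs(3) by simp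
    \<comment> \<open>Adjacency on the cycle means that indices differ by one modulo
      \<open>n\<close>, which a rotation preserves.\<close>
    have shift: "(Suc s + b) mod n = Suc ((Suc s + a) mod n) mod n \<longleftrightarrow> b = Suc a mod n" if "b < n" for a b
    proof -
      have "Suc ((Suc s + a) mod n) mod n = (Suc s + Suc a) mod n" by (simp add: mod_Suc_eq)
      then show ?thesis
        using cong_add_lcancel_nat[of "Suc s" b "Suc a" n] that by (simp add: cong_def)
    qed
    have last: "ys ! (n - 1) = z"
      using nth[of "n - 1"] s n by simp
    show ?thesis
    proof (rule cycle[OF n3 bij[OF ys]])
      show "is_sink A (ys ! (n - 1))" using sink last by simp
      fix i j assume ij: "i \<in> {1..n}" "j \<in> {1..n}"
      then have ij': "i - 1 < n" "j - 1 < n" by auto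
      have "adjacent A (ys ! (i - 1)) (ys ! (j - 1)) \<longleftrightarrow> j - 1 = Suc (i - 1) mod n \<or> i - 1 = Suc (j - 1) mod n"
      proof -
        have lt: "(Suc s + (i - 1)) mod n < n" "(Suc s + (j - 1)) mod n < n" using n by simp_all
        show ?thesis
          unfolding nth[OF ij'(1)] nth[OF ij'(2)] cyc[OF lt] shift[OF ij'(1)] shift[OF ij'(2)] ..
      qed
      also have "\<dots> \<longleftrightarrow> j = Suc i \<or> i = Suc j \<or> i = 1 \<and> j = n \<or> i = n \<and> j = 1"
      proof -
        have "Suc (i - 1) mod n = (if i = n then 0 else i)" "Suc (j - 1) mod n = (if j = n then 0 else j)"
          using ij by auto
        then show ?thesis using ij n3 by (auto split: if_splits)
      qed
      finally show "adjacent A (ys ! (i - 1)) (ys ! (j - 1)) \<longleftrightarrow>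
        j = Suc i \<or> i = Suc j \<or> i = 1 \<and> j = n \<or> i = n \<and> j = 1" .
    qed
  qed
qed

lemma uedges_eq: "uedges A = {{u, v} | u v. adjacent A u v}"
  by (auto simp: uedges_def adjacent_def insert_commute)

text \<open>The first vertex has at most one neighbour; for \<open>n = 1\<close> it has
  none.\<close>

lemma not_two_regular_path:
  assumes "bij_betw \<sigma> {1..n} {1..n}"
    and adj: "\<And>i j. i \<in> {1..n} \<Longrightarrow> j \<in> {1..n} \<Longrightarrow> adjacent A (\<sigma> i) (\<sigma> j) \<longleftrightarrow> j = Suc i \<or> i = Suc j"
  shows "\<not> two_regular n A" "underlying_is_path n A"
proof -
  have surj: "\<exists>i\<in>{1..n}. u = \<sigma> i" if "u \<in> {1..n}" for u
    using assms(1) that by (auto simp: bij_betw_def)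
  have mem: "\<sigma> i \<in> {1..n}" if "i \<in> {1..n}" for i using assms(1) that by (auto simp: bij_betw_def)
  have "nbrs A (\<sigma> 1) \<subseteq> {\<sigma> 2}"
  proof
    fix u assume "u \<in> nbrs A (\<sigma> 1)"
    then have u: "adjacent A u (\<sigma> 1)" by (simp add: nbrs_eq)
    then obtain i where i: "i \<in> {1..n}" "u = \<sigma> i" using surj adjacent_mem by blast
    with u adj[of i 1] n show "u \<in> {\<sigma> 2}" by (auto simp: numeral_2_eq_2 One_nat_def)
  qed
  then have "card (nbrs A (\<sigma> 1)) \<le> card {\<sigma> 2}" by (intro card_mono) simp_all
  then have "degree A (\<sigma> 1) \<noteq> 2" by (simp add: degree_def)
  moreover have "\<sigma> 1 \<in> {1..n}" using mem n by simp
  ultimately show "\<not> two_regular n A" by (auto simp: two_regular_def)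
  have "uedges A = {{\<sigma> i, \<sigma> (i + 1)} | i. 1 \<le> i \<and> i < n}"
  proof (intro equalityI subsetI)
    fix e assume "e \<in> uedges A"
    then obtain u v where e: "e = {u, v}" "adjacent A u v" by (auto simp: uedges_eq)
    then obtain i j where ij: "i \<in> {1..n}" "j \<in> {1..n}" "u = \<sigma> i" "v = \<sigma> j"
      using surj adjacent_mem by meson
    with e adj have "j = i + 1 \<or> i = j + 1" by auto
    then show "e \<in> {{\<sigma> i, \<sigma> (i + 1)} | i. 1 \<le> i \<and> i < n}"
      using ij e(1) by (auto simp: insert_commute)
  next
    fix e assume "e \<in> {{\<sigma> i, \<sigma> (i + 1)} | i. 1 \<le> i \<and> i < n}"
    then obtain i where i: "1 \<le> i" "i < n" "e = {\<sigma> i, \<sigma> (i + 1)}" by blast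
    then have "adjacent A (\<sigma> i) (\<sigma> (i + 1))" using adj[of i "i + 1"] by simp
    then show "e \<in> uedges A" using i(3) unfolding uedges_eq by blast
  qed
  then show "underlying_is_path n A" unfolding underlying_is_path_def using assms(1) by blast
qed

text \<open>The two neighbours along the cycle are distinct because \<open>3 \<le> n\<close>, and
  the degree bound allows no more.\<close>

lemma two_regular_cycle:
  assumes n3: "3 \<le> n" and bij: "bij_betw \<sigma> {1..n} {1..n}"
    and adj: "\<And>i j. i \<in> {1..n} \<Longrightarrow> j \<in> {1..n} \<Longrightarrow>
      adjacent A (\<sigma> i) (\<sigma> j) \<longleftrightarrow> j = Suc i \<or> i = Suc j \<or> i = 1 \<and> j = n \<or> i = n \<and> j = 1"
  shows "two_regular n A" "underlying_is_cycle n A"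
proof -
  have surj: "\<exists>i\<in>{1..n}. u = \<sigma> i" if "u \<in> {1..n}" for u
    using bij that by (auto simp: bij_betw_def)
  have inj: "\<sigma> i = \<sigma> j \<longleftrightarrow> i = j" if "i \<in> {1..n}" "j \<in> {1..n}" for i j
    using bij that unfolding bij_betw_def by (meson inj_on_eq_iff)
  show "two_regular n A"
    unfolding two_regular_def
  proof
    fix v assume v: "v \<in> {1..n}"
    then obtain i where i: "i \<in> {1..n}" "v = \<sigma> i" using surj by blast
    define j k where "j = (if i = n then 1 else Suc i)" and "k = (if i = 1 then n else i - 1)"
    have jk: "j \<in> {1..n}" "k \<in> {1..n}" "j \<noteq> k" using i n3 by (auto simp: j_def k_def)
    have "adjacent A (\<sigma> j) v" "adjacent A (\<sigma> k) v"
      using i jk adj[of j i] adj[of k i] by (auto simp: j_def k_def)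
    then have "{\<sigma> j, \<sigma> k} \<subseteq> nbrs A v" by (auto simp: nbrs_eq)
    then have "card {\<sigma> j, \<sigma> k} \<le> degree A v" unfolding degree_def by (intro card_mono finite_nbrs)
    moreover have "card {\<sigma> j, \<sigma> k} = 2" using inj jk by simp
    ultimately show "degree A v = 2" using deg v by (simp add: le_antisym)
  qed
  have "uedges A = {{\<sigma> i, \<sigma> (i + 1)} | i. 1 \<le> i \<and> i < n} \<union> {{\<sigma> n, \<sigma> 1}}"
  proof (intro equalityI subsetI)
    fix e assume "e \<in> uedges A"
    then obtain u v where e: "e = {u, v}" "adjacent A u v" by (auto simp: uedges_eq)
    then obtain i j where ij: "i \<in> {1..n}" "j \<in> {1..n}" "u = \<sigma> i" "v = \<sigma> j"
      using surj adjacent_mem by meson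
    with e adj have "j = i + 1 \<or> i = j + 1 \<or> i = 1 \<and> j = n \<or> i = n \<and> j = 1" by auto
    then show "e \<in> {{\<sigma> i, \<sigma> (i + 1)} | i. 1 \<le> i \<and> i < n} \<union> {{\<sigma> n, \<sigma> 1}}"
      using ij e(1) by (auto simp: insert_commute)
  next
    fix e assume "e \<in> {{\<sigma> i, \<sigma> (i + 1)} | i. 1 \<le> i \<and> i < n} \<union> {{\<sigma> n, \<sigma> 1}}"
    then consider i where "1 \<le> i" "i < n" "e = {\<sigma> i, \<sigma> (i + 1)}" | "e = {\<sigma> n, \<sigma> 1}" by blast
    then show "e \<in> uedges A"
    proof cases
      case 1
      then have "adjacent A (\<sigma> i) (\<sigma> (i + 1))" using adj[of i "i + 1"] by simp
      then show ?thesis using 1(3) unfolding uedges_eq by blast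
    next
      case 2
      have "adjacent A (\<sigma> n) (\<sigma> 1)" using adj[of n 1] n3 by simp
      then show ?thesis using 2 unfolding uedges_eq by blast
    qed
  qed
  then show "underlying_is_cycle n A" unfolding underlying_is_cycle_def using bij n3 by blast
qed

end

section \<open>The classification\<close>

lemma rtrancl_interval_down:
  assumes "\<And>k. i \<le> k \<Longrightarrow> k < j \<Longrightarrow> (Suc k, k) \<in> E" "i \<le> j"
  shows "(j, i) \<in> E\<^sup>*"
proof -
  have "(i, j) \<in> (E\<inverse>)\<^sup>*" by (rule rtrancl_interval) (use assms in auto)
  then show ?thesis by (simp add: rtrancl_converse)
qed

text \<open>A nontrivial descent to \<open>j\<close> would use edge \<open>j\<close> downwards, so
  the path must have been rising or empty.\<close>

lemma seg_le_step_up: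
  assumes "seg_le d i j" "d j"
  shows "seg_le d i (Suc j)"
proof -
  have "i \<le> j \<and> (\<forall>k\<in>{i..<j}. d k)"
    using assms unfolding seg_le_def by (cases "i = j") auto
  moreover have "k = j \<or> k \<in> {i..<j}" if "k \<in> {i..<Suc j}" for k using that by auto
  ultimately show ?thesis using assms(2) unfolding seg_le_def by (metis le_SucI)
qed

lemma seg_le_step_down:
  assumes "seg_le d i (Suc j)" "\<not> d j"
  shows "seg_le d i j"
proof -
  have "\<not> (i \<le> Suc j \<and> (\<forall>k\<in>{i..<Suc j}. d k)) \<or> i = Suc j"
    using assms(2) by (cases "i = Suc j") auto
  then have "Suc j \<le> i" "\<forall>k\<in>{Suc j..<i}. \<not> d k" using assms(1) by (auto simp: seg_le_def)
  moreover have "\<forall>k\<in>{j..<i}. \<not> d k"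
  proof
    fix k assume "k \<in> {j..<i}"
    then have "k = j \<or> k \<in> {Suc j..<i}" by auto
    then show "\<not> d k" using assms(2) calculation(2) by blast
  qed
  ultimately show ?thesis by (simp add: seg_le_def)
qed

lemma seg_le_imp_rtrancl:
  assumes "\<And>k. 1 \<le> k \<Longrightarrow> k < n \<Longrightarrow> d k \<Longrightarrow> (k, Suc k) \<in> E"
    "\<And>k. 1 \<le> k \<Longrightarrow> k < n \<Longrightarrow> \<not> d k \<Longrightarrow> (Suc k, k) \<in> E"
    "i \<in> {1..n}" "j \<in> {1..n}" "seg_le d i j"
  shows "(i, j) \<in> E\<^sup>*"
  using assms(5) unfolding seg_le_def
proof (elim disjE conjE)
  assume "i \<le> j" "\<forall>k\<in>{i..<j}. d k"
  then show ?thesis using assms(3,4) by (intro rtrancl_interval assms(1)) auto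
next
  assume "j \<le> i" "\<forall>k\<in>{j..<i}. \<not> d k"
  then show ?thesis using assms(3,4) by (intro rtrancl_interval_down assms(2)) auto
qed

lemma poset_of_seg:
  assumes E: "\<And>i j. (i, j) \<in> E \<longleftrightarrow> i \<in> {1..n} \<and> j \<in> {1..n} \<and> (j = Suc i \<and> d i \<or> i = Suc j \<and> \<not> d j)"
    and ij: "i \<in> {1..n}" "j \<in> {1..n}"
  shows "poset_of E i j \<longleftrightarrow> seg_le d i j"
proof
  assume "poset_of E i j"
  then have "(i, j) \<in> E\<^sup>*" by (simp add: poset_of_def)
  then show "seg_le d i j"
  proof induction
    case (step j k)
    from step.hyps(2) have "k = Suc j \<and> d j \<or> j = Suc k \<and> \<not> d k" unfolding E by blast
    then show ?case
      using seg_le_step_up[of d i j] seg_le_step_down[of d i k] step.IH by auto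
  qed (simp add: seg_le_def)
next
  assume "seg_le d i j"
  then show "poset_of E i j"
    unfolding poset_of_def by (rule seg_le_imp_rtrancl[where n = n, rotated 4]) (use E ij in auto)
qed

text \<open>The closing arrow ends at the sink \<open>n\<close>, so a directed path can use it only
  as its last step, after having descended to 1.\<close>

lemma poset_of_cyc:
  assumes E: "\<And>i j. (i, j) \<in> E \<longleftrightarrow> i \<in> {1..n} \<and> j \<in> {1..n} \<and>
      (j = Suc i \<and> d i \<or> i = Suc j \<and> \<not> d j \<or> i = 1 \<and> j = n)"
    and n: "2 \<le> n" and d: "\<not> d 0" "d (n - 1)"
    and ij: "i \<in> {1..n}" "j \<in> {1..n}"
  shows "poset_of E i j \<longleftrightarrow> cyc_le d n i j"
proof
  assume "poset_of E i j"
  then have "(i, j) \<in> E\<^sup>*" by (simp add: poset_of_def)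
  then show "cyc_le d n i j"
  proof induction
    case (step j k)
    have out: "(n, k) \<notin> E" using E[of n k] n d(2) by auto
    then have "j \<noteq> n" using step.hyps by auto
    with step.IH have j: "seg_le d i j" by (simp add: cyc_le_def)
    from step.hyps(2) consider "k = Suc j" "d j" | "j = Suc k" "\<not> d k" | "j = 1" "k = n"
      unfolding E by blast
    then show ?case
    proof cases
      case 1
      then show ?thesis using seg_le_step_up j by (simp add: cyc_le_def)
    next
      case 2
      then show ?thesis using seg_le_step_down j by (simp add: cyc_le_def)
    next
      case 3
      have "\<forall>l\<in>{1..<i}. \<not> d l"
        using j ij(1) unfolding 3 seg_le_def by auto
      moreover have "l = 0 \<or> l \<in> {1..<i}" if "l < i" for l using that by auto
      ultimately have "\<forall>l<i. \<not> d l" using d(1) by blast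
      then show ?thesis using 3 by (simp add: cyc_le_def)
    qed
  qed (simp add: cyc_le_def seg_le_def)
next
  have seg: "(i, j) \<in> E\<^sup>*" if "seg_le d i j" "j \<in> {1..n}" for j
    using that(1) by (rule seg_le_imp_rtrancl[where n = n, rotated 4]) (use E ij that in auto)
  assume "cyc_le d n i j"
  then show "poset_of E i j"
    unfolding cyc_le_def poset_of_def
  proof
    assume "j = n \<and> (\<forall>k<i. \<not> d k)"
    then have "seg_le d i 1" "j = n" using ij by (auto simp: seg_le_def)
    then have "(i, 1) \<in> E\<^sup>*" "(1, n) \<in> E" using seg E n by auto
    with \<open>j = n\<close> show "(i, j) \<in> E\<^sup>*" by simp
  qed (use seg ij in blast)
qed

lemma hasse_iso_eqI:
  assumes A: "acyclic A" "A \<subseteq> V \<times> V" and iso: "poset_iso f S (poset_of E) V (poset_of A)"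
    and arrows: "\<And>i j. i \<in> S \<Longrightarrow> j \<in> S \<Longrightarrow> (i, j) \<in> E \<longleftrightarrow> (f i, f j) \<in> A"
    and no: "\<And>i j k. i \<in> S \<Longrightarrow> j \<in> S \<Longrightarrow> k \<in> S \<Longrightarrow> (i, j) \<in> E \<Longrightarrow> k \<noteq> i \<Longrightarrow> k \<noteq> j \<Longrightarrow>
      poset_of E i k \<Longrightarrow> \<not> poset_of E k j"
  shows "hasse V (poset_of A) = A"
proof (rule hasse_eqI[OF A])
  fix u v w assume uvw: "(u, v) \<in> A" "w \<in> V" "w \<noteq> u" "w \<noteq> v" "poset_of A u w"
  then have "u \<in> V" "v \<in> V" using A by auto
  with uvw(2) obtain i j k where ijk: "i \<in> S" "j \<in> S" "k \<in> S" "u = f i" "v = f j" "w = f k"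
    using iso unfolding poset_iso_def bij_betw_def by (metis imageE)
  moreover have "k \<noteq> i" "k \<noteq> j" using uvw ijk by auto
  ultimately show "\<not> poset_of A w v"
    using no[of i j k] uvw arrows[of i j] iso unfolding poset_iso_def by blast
qed

section \<open>Transport of the model posets to the given digraph\<close>

context degree_two_graph
begin

lemma A_subset: "A \<subseteq> {1..n} \<times> {1..n}"
  using dig by (simp add: digraph_on_def)

text \<open>The arrows pulled back along the labelling, so that each case is argued on a path or
  cycle in standard position.\<close>

definition relabel :: "(nat \<Rightarrow> nat) \<Rightarrow> (nat \<times> nat) set" where
  "relabel \<sigma> = {(i, j). i \<in> {1..n} \<and> j \<in> {1..n} \<and> (\<sigma> i, \<sigma> j) \<in> A}"

lemma relabel_iso:
  assumes "bij_betw \<sigma> {1..n} {1..n}"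
  shows "poset_iso \<sigma> {1..n} (poset_of (relabel \<sigma>)) {1..n} (poset_of A)"
  by (rule poset_iso_rtrancl[OF assms _ A_subset]) (auto simp: relabel_def)

lemma path_case:
  assumes bij: "bij_betw \<sigma> {1..n} {1..n}"
    and adj: "\<And>i j. i \<in> {1..n} \<Longrightarrow> j \<in> {1..n} \<Longrightarrow> adjacent A (\<sigma> i) (\<sigma> j) \<longleftrightarrow> j = Suc i \<or> i = Suc j"
  shows "hasse {1..n} (poset_of A) = A" "positive_type {1..n} (poset_of A) (DA n)"
proof -
  define d where "d k \<longleftrightarrow> (k, Suc k) \<in> relabel \<sigma>" for k
  have E: "(i, j) \<in> relabel \<sigma> \<longleftrightarrow> i \<in> {1..n} \<and> j \<in> {1..n} \<and> (j = Suc i \<and> d i \<or> i = Suc j \<and> \<not> d j)" for i j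
    using adj[of i j] adjacent_antisym[of "\<sigma> i" "\<sigma> j"]
    by (auto simp: d_def relabel_def adjacent_def)
  note le = poset_of_seg[OF E]
  note iso = relabel_iso[OF bij]
  have "poset_iso id {1..n} (seg_le d) {1..n} (poset_of (relabel \<sigma>))"
    using le by (auto simp: poset_iso_def)
  then show "positive_type {1..n} (poset_of A) (DA n)"
    using positive_type_iso[OF iso] positive_type_iso path_positive_type by blast
  show "hasse {1..n} (poset_of A) = A"
  proof (rule hasse_iso_eqI[OF acyc A_subset iso])
    fix i j k assume mem: "i \<in> {1..n}" "j \<in> {1..n}" "k \<in> {1..n}"
      and ij: "(i, j) \<in> relabel \<sigma>" and k: "k \<noteq> i" "k \<noteq> j" and ik: "poset_of (relabel \<sigma>) i k"
    show "\<not> poset_of (relabel \<sigma>) k j"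
    proof
      assume "poset_of (relabel \<sigma>) k j"
      with ik have "seg_le d i k" "seg_le d k j" using le mem by auto
      moreover have "j = Suc i \<and> d i \<or> i = Suc j \<and> \<not> d j" using ij E by blast
      ultimately show False using k unfolding seg_le_def by fastforce
    qed
  qed (auto simp: relabel_def)
qed

text \<open>Both edges at the sink \<open>n\<close> point into it, which fixes
  \<open>d (n - 1)\<close> and the closing arrow from 1 to \<open>n\<close>. That \<open>d 0\<close>
  is false, as 0 is no vertex, is also the correct direction once 0 is identified with
  \<open>n\<close>: the closing edge descends from 1 to 0.\<close>

lemma cycle_labelling_arrows:
  assumes n3: "3 \<le> n" and bij: "bij_betw \<sigma> {1..n} {1..n}" and sink: "is_sink A (\<sigma> n)"
    and adj: "\<And>i j. i \<in> {1..n} \<Longrightarrow> j \<in> {1..n} \<Longrightarrow>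
      adjacent A (\<sigma> i) (\<sigma> j) \<longleftrightarrow> j = Suc i \<or> i = Suc j \<or> i = 1 \<and> j = n \<or> i = n \<and> j = 1"
  defines "d \<equiv> \<lambda>k. (k, Suc k) \<in> relabel \<sigma>"
  shows "\<not> d 0" "d (n - 1)"
    "(i, j) \<in> relabel \<sigma> \<longleftrightarrow> i \<in> {1..n} \<and> j \<in> {1..n} \<and>
      (j = Suc i \<and> d i \<or> i = Suc j \<and> \<not> d j \<or> i = 1 \<and> j = n)"
proof -
  have out: "(\<sigma> n, v) \<notin> A" for v using sink by (simp add: is_sink_def)
  show "\<not> d 0" by (simp add: d_def relabel_def)
  show "d (n - 1)"
    using adj[of "n - 1" n] out n3 by (auto simp: d_def relabel_def adjacent_def)
  show "(i, j) \<in> relabel \<sigma> \<longleftrightarrow> i \<in> {1..n} \<and> j \<in> {1..n} \<and>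
      (j = Suc i \<and> d i \<or> i = Suc j \<and> \<not> d j \<or> i = 1 \<and> j = n)"
    using adj[of i j] adjacent_antisym[of "\<sigma> i" "\<sigma> j"] out n3
    by (auto simp: d_def relabel_def adjacent_def)
qed

lemma sinks_relabel:
  assumes "bij_betw \<sigma> {1..n} {1..n}"
  shows "card (sinks n A) = card (sinks n (relabel \<sigma>))"
proof -
  have "sinks n A = \<sigma> ` sinks n (relabel \<sigma>)"
  proof (intro equalityI subsetI)
    fix v assume v: "v \<in> sinks n A"
    then obtain i where "i \<in> {1..n}" "v = \<sigma> i"
      using assms unfolding bij_betw_def sinks_def by blast
    with v show "v \<in> \<sigma> ` sinks n (relabel \<sigma>)" by (auto simp: sinks_def is_sink_def relabel_def)
  next
    fix v assume "v \<in> \<sigma> ` sinks n (relabel \<sigma>)"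
    then obtain i where i: "i \<in> {1..n}" "v = \<sigma> i" "is_sink (relabel \<sigma>) i"
      by (auto simp: sinks_def)
    have "is_sink A v"
      unfolding is_sink_def
    proof (intro allI notI)
      fix u assume "(v, u) \<in> A"
      moreover obtain j where "j \<in> {1..n}" "u = \<sigma> j"
        using assms A_subset \<open>(v, u) \<in> A\<close> unfolding bij_betw_def by blast
      ultimately have "(i, j) \<in> relabel \<sigma>" using i by (simp add: relabel_def)
      with i(3) show False by (simp add: is_sink_def)
    qed
    moreover have "v \<in> {1..n}" using assms i unfolding bij_betw_def by blast
    ultimately show "v \<in> sinks n A" by (simp add: sinks_def)
  qed
  moreover have "inj_on \<sigma> (sinks n (relabel \<sigma>))"
    using assms by (auto simp: bij_betw_def sinks_def intro: inj_on_subset)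
  ultimately show ?thesis by (simp add: card_image)
qed

text \<open>Wherever the direction changes from up to down there is a sink other than
  \<open>n\<close>. If there is none, the directions change just once, at the unique source
  \<open>t\<close>.\<close>

lemma single_source_single_sink:
  assumes E: "\<And>i j. (i, j) \<in> relabel \<sigma> \<longleftrightarrow> i \<in> {1..n} \<and> j \<in> {1..n} \<and>
      (j = Suc i \<and> d i \<or> i = Suc j \<and> \<not> d j \<or> i = 1 \<and> j = n)"
    and n2: "2 \<le> n" and d: "\<not> d 0" "d (n - 1)"
  shows "card (sinks n (relabel \<sigma>)) = 1 \<longleftrightarrow>
    (\<exists>t. 0 < t \<and> t < n \<and> (\<forall>k<t. \<not> d k) \<and> (\<forall>k\<in>{t..<n}. d k))"
proof
  have "is_sink (relabel \<sigma>) n"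
    unfolding is_sink_def using E n2 d(2) by auto
  then have n_sink: "n \<in> sinks n (relabel \<sigma>)" using n2 by (simp add: sinks_def)
  {
    assume "card (sinks n (relabel \<sigma>)) = 1"
    then have single: "sinks n (relabel \<sigma>) = {n}" using n_sink by (metis card_1_singletonE singletonD)
    \<comment> \<open>If edge \<open>i - 1\<close> points up and edge \<open>i\<close> points down,
      both arrows at \<open>i\<close> end there and \<open>i\<close> is a second sink.\<close>
    have mono: "d i" if "d (i - 1)" "1 \<le> i" "i < n" for i
    proof (rule ccontr)
      assume "\<not> d i"
      have "i - 1 \<noteq> 0" using that d(1) by metis
      then have "(i, j) \<notin> relabel \<sigma>" for j
        using E[of i j] that \<open>\<not> d i\<close> by auto
      then have "i \<in> sinks n (relabel \<sigma>)" using that by (simp add: sinks_def is_sink_def)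
      with single that show False by simp
    qed
    define t where "t = (LEAST t. d t)"
    have dt: "d t" "t \<le> n - 1" unfolding t_def using d(2) by (auto intro: LeastI Least_le)
    have below: "\<forall>k<t. \<not> d k" unfolding t_def using not_less_Least by blast
    have "d k" if "t \<le> k" "k < n" for k
      using that
    proof (induction k rule: dec_induct)
      case (step m)
      then show ?case using mono[of "Suc m"] by simp
    qed (rule dt(1))
    moreover have "0 < t" using dt(1) d(1) by (metis gr0I)
    moreover have "t < n" using dt(2) n2 by simp
    ultimately show "\<exists>t. 0 < t \<and> t < n \<and> (\<forall>k<t. \<not> d k) \<and> (\<forall>k\<in>{t..<n}. d k)"
      using below by (intro exI[of _ t]) auto
  }
  assume "\<exists>t. 0 < t \<and> t < n \<and> (\<forall>k<t. \<not> d k) \<and> (\<forall>k\<in>{t..<n}. d k)"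
  then obtain t where t: "0 < t" "t < n" "\<forall>k<t. \<not> d k" "\<forall>k\<in>{t..<n}. d k" by blast
  have "i = n" if "i \<in> sinks n (relabel \<sigma>)" for i
  proof (rule ccontr)
    assume "i \<noteq> n"
    then have i: "1 \<le> i" "i < n" and no: "(i, j) \<notin> relabel \<sigma>" for j
      using that by (auto simp: sinks_def is_sink_def)
    consider "t \<le> i" | "i < t" "i = 1" | "i < t" "2 \<le> i" using i by linarith
    then show False
    proof cases
      case 1
      then show ?thesis using no[of "Suc i"] E[of i "Suc i"] i t by auto
    next
      case 2
      then show ?thesis using no[of n] E[of i n] i n2 by auto
    next
      case 3
      then have "\<not> d (i - 1)" "Suc (i - 1) = i" using t by auto
      then show ?thesis using no[of "i - 1"] E[of i "i - 1"] i 3 by auto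
    qed
  qed
  with n_sink have "sinks n (relabel \<sigma>) = {n}" by blast
  then show "card (sinks n (relabel \<sigma>)) = 1" by simp
qed

text \<open>An arrow bypassed by another directed path would close up with it to the whole cycle,
  leaving only one sink.\<close>

lemma many_sinks_case:
  assumes n3: "3 \<le> n" and bij: "bij_betw \<sigma> {1..n} {1..n}" and sink: "is_sink A (\<sigma> n)"
    and adj: "\<And>i j. i \<in> {1..n} \<Longrightarrow> j \<in> {1..n} \<Longrightarrow>
      adjacent A (\<sigma> i) (\<sigma> j) \<longleftrightarrow> j = Suc i \<or> i = Suc j \<or> i = 1 \<and> j = n \<or> i = n \<and> j = 1"
    and many: "card (sinks n A) > 1"
  shows "hasse {1..n} (poset_of A) = A" "principal_type {1..n} (poset_of A) (DA (n - 1))"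
proof -
  define d where "d k \<longleftrightarrow> (k, Suc k) \<in> relabel \<sigma>" for k
  note arrows = cycle_labelling_arrows[OF n3 bij sink adj, folded d_def]
  note d = arrows(1,2) and E = arrows(3)
  have n2: "2 \<le> n" using n3 by simp
  note le = poset_of_cyc[OF E n2 d]
  note iso = relabel_iso[OF bij]
  have turn: "\<exists>k\<in>{t..<n}. \<not> d k" if "0 < t" "t < n" "\<forall>k<t. \<not> d k" for t
    using single_source_single_sink[OF E n2 d] sinks_relabel[OF bij] many that by auto
  have "poset_iso id {1..n} (cyc_le d n) {1..n} (poset_of (relabel \<sigma>))"
    using le by (auto simp: poset_iso_def)
  then show "principal_type {1..n} (poset_of A) (DA (n - 1))"
    using principal_type_iso[OF iso] principal_type_iso cycle_principal_type[OF n2 d turn] by blast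
  show "hasse {1..n} (poset_of A) = A"
  proof (rule hasse_iso_eqI[OF acyc A_subset iso])
    fix i j k assume mem: "i \<in> {1..n}" "j \<in> {1..n}" "k \<in> {1..n}"
      and ij: "(i, j) \<in> relabel \<sigma>" and k: "k \<noteq> i" "k \<noteq> j" and ik: "poset_of (relabel \<sigma>) i k"
    show "\<not> poset_of (relabel \<sigma>) k j"
    proof
      assume "poset_of (relabel \<sigma>) k j"
      with ik have ik: "cyc_le d n i k" and kj: "cyc_le d n k j" using le mem by auto
      have "k \<noteq> n"
      proof
        assume "k = n"
        then have "j < n" using mem k by auto
        then have "seg_le d n j" using kj \<open>k = n\<close> by (simp add: cyc_le_def)
        moreover have "n - 1 \<in> {j..<n}" using \<open>j < n\<close> by auto
        ultimately show False using d(2) \<open>j < n\<close> by (auto simp: seg_le_def)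
      qed
      then have sik: "seg_le d i k" using ik by (simp add: cyc_le_def)
      have seg: "k \<in> {i, j}" if "seg_le d k j" "j = Suc i \<and> d i \<or> i = Suc j \<and> \<not> d j"
        using sik that unfolding seg_le_def by fastforce
      from ij have "j = Suc i \<and> d i \<or> i = Suc j \<and> \<not> d j \<or> i = 1 \<and> j = n" using E by blast
      moreover from kj have "seg_le d k j \<or> j = n \<and> (\<forall>l<k. \<not> d l)" by (simp add: cyc_le_def)
      \<comment> \<open>Three ways to bypass an arrow into \<open>n\<close>: descend from
        \<open>n - 1\<close> through 1, climb from 1 all the way to \<open>n\<close>, or leave 1 and
        come back to it. The first two contradict \<open>turn\<close>, and the third would need edge
        1 in both directions.\<close>
      ultimately consider "j = Suc i \<and> d i \<or> i = Suc j \<and> \<not> d j" "j = n" "\<forall>l<k. \<not> d l"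
        | "i = 1" "j = n" "seg_le d k n" | "i = 1" "j = n" "\<forall>l<k. \<not> d l"
        using seg k by blast
      then show False
      proof cases
        case 1
        then have i: "i = n - 1" using mem by auto
        then have "k < i" using mem k \<open>j = n\<close> by auto
        then have "\<not> d l" if "l \<in> {k..<i}" for l using sik that by (auto simp: seg_le_def)
        moreover have "l < k \<or> l \<in> {k..<i}" if "l < i" for l using that by auto
        ultimately have below: "\<forall>l<i. \<not> d l" using 1(3) by blast
        moreover have "0 < i" "i < n" using i n3 by auto
        ultimately have "\<exists>l\<in>{i..<n}. \<not> d l" using turn by blast
        then obtain l where "l \<in> {i..<n}" "\<not> d l" by blast
        moreover from this have "l = n - 1" using i by auto
        ultimately show False using d(2) by simp
      next
        case 2
        have "1 < k" "k < n" using k mem \<open>k \<noteq> n\<close> 2 by auto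
        then have up: "\<forall>l\<in>{1..<k}. d l" and up': "\<forall>l\<in>{k..<n}. d l"
          using sik 2 by (auto simp: seg_le_def)
        have "\<forall>l\<in>{1..<n}. d l" using up up' by (metis atLeastLessThan_iff not_le)
        moreover have "\<forall>l<1. \<not> d l" using d(1) by simp
        ultimately show False using turn[of 1] n3 by auto
      next
        case 3
        then have "1 < k" using k mem by auto
        then have "d 1" "\<not> d 1" using sik 3 by (auto simp: seg_le_def)
        then show False by simp
      qed
    qed
  qed (auto simp: relabel_def)
qed

text \<open>The unique source \<open>t\<close> cuts the cycle into an ascending arc with
  \<open>n - t\<close> arrows and a descending arc, finished by the closing arrow, with
  \<open>t\<close> arrows. The cases differ in which arc is the longer and so becomes the first
  chain.\<close>

lemma single_sink_iso_Abar:
  assumes n3: "3 \<le> n" and bij: "bij_betw \<sigma> {1..n} {1..n}" and sink: "is_sink A (\<sigma> n)"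
    and adj: "\<And>i j. i \<in> {1..n} \<Longrightarrow> j \<in> {1..n} \<Longrightarrow>
      adjacent A (\<sigma> i) (\<sigma> j) \<longleftrightarrow> j = Suc i \<or> i = Suc j \<or> i = 1 \<and> j = n \<or> i = n \<and> j = 1"
    and single: "card (sinks n A) = 1"
  shows "\<exists>p r. iso_Abar n A p r"
proof -
  define d where "d k \<longleftrightarrow> (k, Suc k) \<in> relabel \<sigma>" for k
  note arrows = cycle_labelling_arrows[OF n3 bij sink adj, folded d_def]
  note d = arrows(1,2) and E = arrows(3)
  have n2: "2 \<le> n" using n3 by simp
  obtain t where t: "0 < t" "t < n" "\<forall>k<t. \<not> d k" "\<forall>k\<in>{t..<n}. d k"
    using single_source_single_sink[OF E n2 d] sinks_relabel[OF bij] single by auto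
  have Et: "(i, j) \<in> relabel \<sigma> \<longleftrightarrow> i \<in> {1..n} \<and> j \<in> {1..n} \<and>
      (j = Suc i \<and> t \<le> i \<or> i = Suc j \<and> j < t \<or> i = 1 \<and> j = n)" for i j
    using E[of i j] t(3,4) by (auto simp: not_less)
  have main: "iso_Abar n A p r"
    if f: "bij_betw f {1..n} {1..n}" and pr: "1 \<le> r" "r \<le> p" "p + r = n"
      and ar: "\<And>i j. i \<in> {1..n} \<Longrightarrow> j \<in> {1..n} \<Longrightarrow> (i, j) \<in> relabel \<sigma> \<longleftrightarrow> (f i, f j) \<in> Abar p r"
    for f p r
  proof -
    define g where "g = inv_into {1..n} \<sigma>"
    have g: "bij_betw g {1..n} {1..n}" unfolding g_def by (rule bij_betw_inv_into[OF bij])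
    have gm: "g i \<in> {1..n}" "\<sigma> (g i) = i" if "i \<in> {1..n}" for i
      using g bij that by (auto simp: bij_betw_def g_def f_inv_into_f)
    have "(i, j) \<in> A \<longleftrightarrow> ((f \<circ> g) i, (f \<circ> g) j) \<in> Abar p r" if "i \<in> {1..n}" "j \<in> {1..n}" for i j
      using ar[OF gm(1) gm(1), OF that] gm that by (simp add: relabel_def)
    then show ?thesis
      unfolding iso_Abar_def using pr n3 bij_betw_trans[OF g f] by blast
  qed
  show ?thesis
  proof (cases "t \<le> n - t")
    case True
    \<comment> \<open>The ascending arc from \<open>t\<close> is shifted onto the first chain; the
      descending arc from \<open>t - 1\<close> to 1 becomes \<open>n - t + 1\<close> to
      \<open>n - 1\<close>.\<close>
    define f where "f i = (if i = n then n else if t \<le> i then i - t + 1 else n - i)" for i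
    define g where "g l = (if l = n then n else if l \<le> n - t then l + t - 1 else n - l)" for l
    have f: "f n = n" "\<And>i. t \<le> i \<Longrightarrow> i < n \<Longrightarrow> f i = i - t + 1" "\<And>i. i < t \<Longrightarrow> f i = n - i"
      using t(1,2) by (auto simp: f_def)
    have g: "g n = n" "\<And>l. l \<le> n - t \<Longrightarrow> g l = l + t - 1" "\<And>l. n - t < l \<Longrightarrow> l < n \<Longrightarrow> g l = n - l"
      using t(1,2) by (auto simp: g_def)
    have p: "1 \<le> n - t" "1 \<le> t" "n - t + (t) = n" using t by auto
    note Abar = Abar_iff[OF p(1,2), unfolded p(3)]
    have inv: "g (f i) = i" "f i \<in> {1..n}" if "i \<in> {1..n}" for i
    proof -
      consider "i = n" | "t \<le> i" "i < n" | "i < t" using \<open>i \<in> {1..n}\<close> by fastforce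
      then have "g (f i) = i \<and> f i \<in> {1..n}" using f g t(1,2) that by cases auto
      then show "g (f i) = i" "f i \<in> {1..n}" by auto
    qed
    have inv': "f (g l) = l" "g l \<in> {1..n}" if "l \<in> {1..n}" for l
    proof -
      consider "l = n" | "l \<le> n - t" | "n - t < l" "l < n" using \<open>l \<in> {1..n}\<close> by fastforce
      then have "f (g l) = l \<and> g l \<in> {1..n}" using f g t(1,2) that by cases auto
      then show "f (g l) = l" "g l \<in> {1..n}" by auto
    qed
    have bij_f: "bij_betw f {1..n} {1..n}"
      by (rule bij_betw_byWitness[where f' = g]) (use inv inv' in blast)+
    have fwd: "(f i, f j) \<in> Abar (n - t) (t)" if "(i, j) \<in> relabel \<sigma>" for i j
    proof -
      from that have mem: "1 \<le> i" "i \<le> n" "1 \<le> j" "j \<le> n"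
        and "j = Suc i \<and> t \<le> i \<or> i = Suc j \<and> j < t \<or> i = 1 \<and> j = n"
        unfolding Et by auto
      then consider (up) "j = Suc i" "t \<le> i" | (down) "i = Suc j" "j < t" | (closing) "i = 1" "j = n"
        by blast
      then show ?thesis
      proof cases
        case up
        show ?thesis
        proof (cases "j = n")
          case True
          then have "f i = n - t" "f j = n" using up f t(1,2) by auto
          then show ?thesis unfolding Abar by blast
        next
          case False
          then have "1 \<le> f i" "f i < n - t" "f j = Suc (f i)" using up mem f t(1,2) by auto
          then show ?thesis unfolding Abar by blast
        qed
      next
        case down
        show ?thesis
        proof (cases "i = t")
          case True
          then have "f i = 1" "f j = n - t + 1" using down f t(1,2) by auto
          then show ?thesis unfolding Abar by blast
        next
          case False
          then have "n - t < f i" "f i < n" "f j = Suc (f i)" using down mem f t(1,2) by auto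
          then show ?thesis unfolding Abar by blast
        qed
      next
        case closing
        show ?thesis
        \<comment> \<open>For \<open>t = 1\<close> the source is vertex 1 itself and the closing
          arrow is the entire second chain.\<close>
        proof (cases "t = 1")
          case True
          then have "f i = 1" "f j = n - t + 1" using closing f t(1,2) by auto
          then show ?thesis unfolding Abar by blast
        next
          case False
          then have "n - t < f i" "f i < n" "f j = Suc (f i)" using closing f t(1,2) by auto
          then show ?thesis unfolding Abar by blast
        qed
      qed
    qed
    have bwd: "(g u, g v) \<in> relabel \<sigma>" if "(u, v) \<in> Abar (n - t) (t)" "u \<in> {1..n}" "v \<in> {1..n}" for u v
    proof -
      from that(1) consider (first) "1 \<le> u" "u < n - t" "v = Suc u" | (top) "u = n - t" "v = n"
        | (bot) "u = 1" "v = n - t + 1" | (second) "n - t < u" "u < n" "v = Suc u"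
        unfolding Abar by blast
      then have "g v = Suc (g u) \<and> t \<le> g u \<or> g u = Suc (g v) \<and> g v < t \<or> g u = 1 \<and> g v = n"
      proof cases
        case first
        then have "g v = Suc (g u)" "t \<le> g u" using g t(1,2) by auto
        then show ?thesis by blast
      next
        case top
        then have "g v = Suc (g u)" "t \<le> g u" using g t(1,2) by auto
        then show ?thesis by blast
      next
        case bot
        show ?thesis
        proof (cases "t = 1")
          case True
          then have "g u = 1" "g v = n" using bot g t(1,2) by auto
          then show ?thesis by blast
        next
          case False
          then have "g u = Suc (g v)" "g v < t" using bot g t(1,2) by auto
          then show ?thesis by blast
        qed
      next
        case second
        show ?thesis
        proof (cases "v = n")
          case True
          then have "g u = 1" "g v = n" using second g t(1,2) by auto
          then show ?thesis by blast
        next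
          case False
          then have "g u = Suc (g v)" "g v < t" using second g t(1,2) by auto
          then show ?thesis by blast
        qed
      qed
      then show ?thesis unfolding Et using inv'(2)[OF that(2)] inv'(2)[OF that(3)] by blast
    qed
    have arrows: "(i, j) \<in> relabel \<sigma> \<longleftrightarrow> (f i, f j) \<in> Abar (n - t) (t)"
      if ij: "i \<in> {1..n}" "j \<in> {1..n}" for i j
      using fwd[of i j] bwd[of "f i" "f j"] inv[OF ij(1)] inv[OF ij(2)] by auto
    have "iso_Abar n A (n - t) (t)" by (rule main[OF bij_f p(2) _ p(3) arrows]) (use True in simp_all)
    then show ?thesis by blast
  next
    case False
    \<comment> \<open>Here the descending arc is the first chain, so the labels up to
      \<open>t\<close> are reversed; the ascending arc already carries the labels of the second
      chain.\<close>
    define f where "f i = (if i \<le> t then t - i + 1 else i)" for i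
    define g where "g l = (if l \<le> t then t - l + 1 else l)" for l
    have f: "\<And>i. i \<le> t \<Longrightarrow> f i = t - i + 1" "\<And>i. t < i \<Longrightarrow> f i = i"
      by (auto simp: f_def)
    have g: "\<And>l. l \<le> t \<Longrightarrow> g l = t - l + 1" "\<And>l. t < l \<Longrightarrow> g l = l"
      by (auto simp: g_def)
    have p: "1 \<le> t" "1 \<le> n - t" "t + (n - t) = n" using t by auto
    note Abar = Abar_iff[OF p(1,2), unfolded p(3)]
    have inv: "g (f i) = i" "f i \<in> {1..n}" if "i \<in> {1..n}" for i
      using that f[of i] g[of "f i"] t(1,2) by (cases "i \<le> t"; auto)+
    have inv': "f (g l) = l" "g l \<in> {1..n}" if "l \<in> {1..n}" for l
      using that g[of l] f[of "g l"] t(1,2) by (cases "l \<le> t"; auto)+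
    have bij_f: "bij_betw f {1..n} {1..n}"
      by (rule bij_betw_byWitness[where f' = g]) (use inv inv' in blast)+
    have fwd: "(f i, f j) \<in> Abar (t) (n - t)" if "(i, j) \<in> relabel \<sigma>" for i j
    proof -
      from that have mem: "1 \<le> i" "i \<le> n" "1 \<le> j" "j \<le> n"
        and "j = Suc i \<and> t \<le> i \<or> i = Suc j \<and> j < t \<or> i = 1 \<and> j = n"
        unfolding Et by auto
      then consider (up) "j = Suc i" "t \<le> i" | (down) "i = Suc j" "j < t" | (closing) "i = 1" "j = n"
        by blast
      then show ?thesis
      proof cases
        case up
        show ?thesis
        proof (cases "t = i")
          case True
          then have "f i = 1" "f j = t + 1" using up f by auto
          then show ?thesis unfolding Abar by blast
        next
          case False
          then have "t < f i" "f i < n" "f j = Suc (f i)" using up mem f by auto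
          then show ?thesis unfolding Abar by blast
        qed
      next
        case down
        then have "1 \<le> f i" "f i < t" "f j = Suc (f i)" using mem f by auto
        then show ?thesis unfolding Abar by blast
      next
        case closing
        then have "f i = t" "f j = n" using f t(1,2) by auto
        then show ?thesis unfolding Abar by blast
      qed
    qed
    have bwd: "(g u, g v) \<in> relabel \<sigma>" if "(u, v) \<in> Abar (t) (n - t)" "u \<in> {1..n}" "v \<in> {1..n}" for u v
    proof -
      from that(1) consider "1 \<le> u" "u < t" "v = Suc u" | "u = t" "v = n"
        | "u = 1" "v = t + 1" | "t < u" "u < n" "v = Suc u"
        unfolding Abar by blast
      then have "g v = Suc (g u) \<and> t \<le> g u \<or> g u = Suc (g v) \<and> g v < t \<or> g u = 1 \<and> g v = n"
      proof cases
        case 1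
        then have "g u = Suc (g v)" "g v < t" using g by auto
        then show ?thesis by blast
      next
        case 2
        then have "g u = 1" "g v = n" using g t(1,2) by auto
        then show ?thesis by blast
      next
        case 3
        then have "g v = Suc (g u)" "t \<le> g u" using g t(1,2) by auto
        then show ?thesis by blast
      next
        case 4
        then have "g v = Suc (g u)" "t \<le> g u" using g by auto
        then show ?thesis by blast
      qed
      then show ?thesis unfolding Et using inv'(2)[OF that(2)] inv'(2)[OF that(3)] by blast
    qed
    have arrows: "(i, j) \<in> relabel \<sigma> \<longleftrightarrow> (f i, f j) \<in> Abar (t) (n - t)"
      if ij: "i \<in> {1..n}" "j \<in> {1..n}" for i j
      using fwd[of i j] bwd[of "f i" "f j"] inv[OF ij(1)] inv[OF ij(2)] by auto
    have "iso_Abar n A (t) (n - t)" by (rule main[OF bij_f p(2) _ p(3) arrows]) (use False in simp_all)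
    then show ?thesis by blast
  qed
qed

section \<open>Digraphs isomorphic to a pair of chains\<close>

lemma iso_Abar_poset_iso:
  assumes "iso_Abar n A p r"
  obtains f where "bij_betw f {1..n} {1..n}"
    "poset_iso f {1..n} (poset_of (Abar p r)) {1..n} (poset_of A)"
    "poset_iso f {1..n} (bar_le p r) {1..n} (poset_of A)"
    "\<forall>i\<in>{1..n}. \<forall>j\<in>{1..n}. (i, j) \<in> Abar p r \<longleftrightarrow> (f i, f j) \<in> A"
proof -
  from assms obtain \<sigma> where pr: "1 \<le> r" "r \<le> p" "p + r = n" and \<sigma>: "bij_betw \<sigma> {1..n} {1..n}"
    and ar: "\<forall>i\<in>{1..n}. \<forall>j\<in>{1..n}. (i, j) \<in> A \<longleftrightarrow> (\<sigma> i, \<sigma> j) \<in> Abar p r"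
    by (auto simp: iso_Abar_def)
  define f where "f = inv_into {1..n} \<sigma>"
  have f: "bij_betw f {1..n} {1..n}" unfolding f_def by (rule bij_betw_inv_into[OF \<sigma>])
  have fm: "f i \<in> {1..n}" "\<sigma> (f i) = i" if "i \<in> {1..n}" for i
    using f \<sigma> that by (auto simp: bij_betw_def f_def f_inv_into_f)
  have arf: "(i, j) \<in> Abar p r \<longleftrightarrow> (f i, f j) \<in> A" if "i \<in> {1..n}" "j \<in> {1..n}" for i j
    using ar fm that by simp
  have p: "1 \<le> p" using pr by simp
  have sub: "Abar p r \<subseteq> {1..n} \<times> {1..n}" using Abar_subset[OF p pr(1)] pr(3) by simp
  have iso: "poset_iso f {1..n} (poset_of (Abar p r)) {1..n} (poset_of A)"
    by (rule poset_iso_rtrancl[OF f sub A_subset arf])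
  moreover have "poset_iso f {1..n} (bar_le p r) {1..n} (poset_of A)"
    using iso poset_of_Abar[OF p pr(1)] pr(3) by (auto simp: poset_iso_def)
  ultimately show ?thesis using that f arf by blast
qed

text \<open>For \<open>r = 1\<close> the arrow from minimum to maximum is bypassed by vertex 2, as
  \<open>p\<close> is at least 2. For larger \<open>r\<close> both chains have interior vertices,
  and no arrow of either is bypassed by the other.\<close>

lemma hasse_Abar:
  assumes "iso_Abar n A p r"
  shows "hasse {1..n} (poset_of A) = A \<longleftrightarrow> r \<noteq> 1"
proof -
  have pr: "1 \<le> r" "r \<le> p" "p + r = n" "3 \<le> n" using assms by (auto simp: iso_Abar_def)
  then have p: "2 \<le> p" by simp
  obtain f where f: "bij_betw f {1..n} {1..n}"
    and iso: "poset_iso f {1..n} (poset_of (Abar p r)) {1..n} (poset_of A)"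
    and iso': "poset_iso f {1..n} (bar_le p r) {1..n} (poset_of A)"
    and ar: "\<forall>i\<in>{1..n}. \<forall>j\<in>{1..n}. (i, j) \<in> Abar p r \<longleftrightarrow> (f i, f j) \<in> A"
    using iso_Abar_poset_iso[OF assms] .
  note ar = ar[rule_format]
  show ?thesis
  proof (cases "r = 1")
    case True
    have n: "n = p + 1" using pr True by simp
    have "(1, n) \<in> Abar p r" using p True n by (simp add: Abar_iff)
    then have "(f 1, f n) \<in> A" using ar[of 1 n] n by simp
    moreover have "bar_le p r 1 2" "bar_le p r 2 n" using n p by (auto simp: bar_le_def True)
    then have "poset_of A (f 1) (f 2)" "poset_of A (f 2) (f n)"
      using iso' p n by (auto simp: poset_iso_def)
    moreover have "f 2 \<noteq> f 1" "f 2 \<noteq> f n" "f 2 \<in> {1..n}"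
      using p n inj_on_eq_iff[OF bij_betw_imp_inj_on[OF f]] bij_betwE[OF f] by auto
    ultimately have "hasse {1..n} (poset_of A) \<noteq> A" unfolding hasse_def by blast
    with True show ?thesis by simp
  next
    case False
    have "hasse {1..n} (poset_of A) = A"
    proof (rule hasse_iso_eqI[OF acyc A_subset iso ar])
      fix i j k assume mem: "i \<in> {1..n}" "j \<in> {1..n}" "k \<in> {1..n}"
        and ij: "(i, j) \<in> Abar p r" and k: "k \<noteq> i" "k \<noteq> j" and ik: "poset_of (Abar p r) i k"
      have p1: "1 \<le> p" using p by simp
      have "bar_le p r i k" using ik poset_of_Abar[OF p1 pr(1)] mem pr by simp
      moreover have "\<not> bar_le p r k j" if "bar_le p r i k"
        using ij that k mem pr p False unfolding Abar_iff[OF p1 pr(1)] bar_le_def by auto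
      ultimately show "\<not> poset_of (Abar p r) k j"
        using poset_of_Abar[OF p1 pr(1)] mem pr by simp
    qed
    with False show ?thesis by simp
  qed
qed

lemma iso_Abar_positive:
  assumes "iso_Abar n A p r" "positive_type {1..p + r} (bar_le p r) D"
  shows "poset_positive {1..n} (poset_of A)" "has_dynkin_type {1..n} (poset_of A) D"
proof -
  have n: "p + r = n" using assms(1) by (simp add: iso_Abar_def)
  obtain f where "poset_iso f {1..n} (bar_le p r) {1..n} (poset_of A)"
    using iso_Abar_poset_iso[OF assms(1)] by blast
  then have "positive_type {1..n} (poset_of A) D"
    using positive_type_iso assms(2) n by blast
  then show "poset_positive {1..n} (poset_of A)" "has_dynkin_type {1..n} (poset_of A) D"
    using positive_typeD[OF acyc] by auto
qed

lemma iso_Abar_principal: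
  assumes "iso_Abar n A p r" "principal_type {1..p + r} (bar_le p r) D"
  shows "poset_principal {1..n} (poset_of A)" "has_dynkin_type {1..n} (poset_of A) D"
proof -
  have n: "p + r = n" using assms(1) by (simp add: iso_Abar_def)
  obtain f where "poset_iso f {1..n} (bar_le p r) {1..n} (poset_of A)"
    using iso_Abar_poset_iso[OF assms(1)] by blast
  then have "principal_type {1..n} (poset_of A) D"
    using principal_type_iso assms(2) n by blast
  then show "poset_principal {1..n} (poset_of A)" "has_dynkin_type {1..n} (poset_of A) D"
    using principal_typeD[OF acyc] by auto
qed

lemma iso_Abar_indefinite:
  assumes "iso_Abar n A p r" "2 * p + 2 * r < p * r"
  shows "poset_indefinite {1..n} (poset_of A)"
proof -
  have pr: "2 \<le> p" "1 \<le> r" "p + r = n" using assms(1) by (auto simp: iso_Abar_def)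
  obtain f where f: "bij_betw f {1..n} {1..n}"
    and iso: "poset_iso f {1..n} (bar_le p r) {1..n} (poset_of A)"
    by (rule iso_Abar_poset_iso[OF assms(1)])
  obtain x y where "qf {1..p + r} (bar_le p r) x < 0" "qf {1..p + r} (bar_le p r) y > 0"
    by (rule bar_indefinite[OF pr(1,2) assms(2)])
  then have xy: "qf {1..n} (bar_le p r) x < 0" "qf {1..n} (bar_le p r) y > 0"
    by (simp_all add: pr(3))
  define g where "g = inv_into {1..n} f"
  have g: "g (f s) = s" if "s \<in> {1..n}" for s
    using f that by (simp add: g_def bij_betw_inv_into_left)
  have "qf {1..n} (poset_of A) (\<lambda>s. z (g s)) = qf {1..n} (bar_le p r) z" for z
    unfolding qf_iso[OF iso] by (rule qf_cong) (simp add: g)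
  then show ?thesis
    using xy by (intro poset_indefiniteI[of _ _ "\<lambda>s. x (g s)" "\<lambda>s. y (g s)"]) auto
qed

text \<open>The conclusion is equivalent to \<open>(p - 2) * (r - 2) > 4\<close> once both exceed 2.
  With \<open>r \<le> p\<close> the excluded pairs leave only \<open>r = 3\<close> with
  \<open>p\<close> at least 7, or \<open>r\<close> at least 4 with \<open>p\<close> at least
  5.\<close>

lemma iso_Abar_remaining:
  assumes "iso_Abar n A p r" "\<not> iso_Abar n A (n - 1) 1" "\<not> iso_Abar n A (n - 2) 2"
    "\<not> iso_Abar n A 3 3" "\<not> iso_Abar n A 4 3" "\<not> iso_Abar n A 5 3" "\<not> iso_Abar n A 4 4"
    "\<not> iso_Abar n A 6 3"
  shows "2 * p + 2 * r < p * r"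
proof -
  have pr: "1 \<le> r" "r \<le> p" "p + r = n" using assms(1) by (auto simp: iso_Abar_def)
  have "r \<noteq> 1" "r \<noteq> 2" using assms(1-3) pr(3) by auto
  then consider "r = 3" "7 \<le> p" | "4 \<le> r" "5 \<le> p"
  proof -
    have "r = 3 \<or> 4 \<le> r" using \<open>r \<noteq> 1\<close> \<open>r \<noteq> 2\<close> pr by linarith
    moreover have "p \<notin> {3, 4, 5, 6}" if "r = 3" using assms that by auto
    moreover have "p \<noteq> 4" if "4 \<le> r" using assms that pr by auto
    ultimately show thesis using that pr by fastforce
  qed
  then show ?thesis
  proof cases
    case 2
    \<comment> \<open>Writing the excesses over the bounds as natural numbers turns the inequality
      into one between polynomials with nonnegative coefficients.\<close>
    then obtain a b where "p = 5 + a" "r = 4 + b" using le_Suc_ex by metis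
    then show ?thesis by (simp add: algebra_simps)
  qed simp
qed

end

theorem theorem4p2:
  fixes n :: nat and A :: "(nat \<times> nat) set"
  assumes "1 \<le> n"
    and "digraph_on n A"
    and "acyclic A"
    and "uconnected {1..n} A"
    and "\<forall>v\<in>{1..n}. degree A v \<le> 2"
  shows "let I = poset_of A; V = {1..n};
           case_a = (\<not> two_regular n A \<and> underlying_is_path n A \<and> hasse V I = A \<and>
                     poset_positive V I \<and> has_dynkin_type V I (DA n));
           case_b = (two_regular n A \<and> underlying_is_cycle n A \<and>
             (card (sinks n A) = 1 \<longrightarrow>
                (iso_Abar n A (n - 1) 1 \<longrightarrow>
                   has_dynkin_type V I (DA n) \<and> poset_positive V I \<and> hasse V I \<noteq> A) \<and>
                (iso_Abar n A (n - 2) 2 \<longrightarrow>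
                   has_dynkin_type V I (DD n) \<and> poset_positive V I \<and> hasse V I = A) \<and>
                (iso_Abar n A 3 3 \<longrightarrow>
                   hasse V I = A \<and> poset_positive V I \<and> has_dynkin_type V I DE6) \<and>
                (iso_Abar n A 4 3 \<longrightarrow>
                   hasse V I = A \<and> poset_positive V I \<and> has_dynkin_type V I DE7) \<and>
                (iso_Abar n A 5 3 \<longrightarrow>
                   hasse V I = A \<and> poset_positive V I \<and> has_dynkin_type V I DE8) \<and>
                (iso_Abar n A 4 4 \<longrightarrow>
                   hasse V I = A \<and> poset_principal V I \<and> has_dynkin_type V I DE7) \<and>
                (iso_Abar n A 6 3 \<longrightarrow>
                   hasse V I = A \<and> poset_principal V I \<and> has_dynkin_type V I DE8) \<and>
                (\<not> iso_Abar n A (n - 1) 1 \<and> \<not> iso_Abar n A (n - 2) 2 \<and>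
                 \<not> iso_Abar n A 3 3 \<and> \<not> iso_Abar n A 4 3 \<and> \<not> iso_Abar n A 5 3 \<and>
                 \<not> iso_Abar n A 4 4 \<and> \<not> iso_Abar n A 6 3 \<longrightarrow>
                   poset_indefinite V I)) \<and>
             (card (sinks n A) > 1 \<longrightarrow>
                poset_principal V I \<and> has_dynkin_type V I (DA (n - 1)) \<and> hasse V I = A))
         in (case_a \<and> \<not> case_b) \<or> (\<not> case_a \<and> case_b)"
proof -
  interpret degree_two_graph n A
    using assms by unfold_locales
  let ?I = "poset_of A" and ?V = "{1..n}"
  have A1: "has_dynkin_type ?V ?I (DA n) \<and> poset_positive ?V ?I \<and> hasse ?V ?I \<noteq> A"
    if iso: "iso_Abar n A (n - 1) 1"
  proof -
    have "1 \<le> n - 1" "n - 1 + 1 = n" using iso by (auto simp: iso_Abar_def)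
    then show ?thesis
      using iso_Abar_positive[OF iso, of "DA n"] bar_type_A[of "n - 1"] hasse_Abar[OF iso] by simp
  qed
  have A2: "has_dynkin_type ?V ?I (DD n) \<and> poset_positive ?V ?I \<and> hasse ?V ?I = A"
    if iso: "iso_Abar n A (n - 2) 2"
  proof -
    have "2 \<le> n - 2" "n - 2 + 2 = n" using iso by (auto simp: iso_Abar_def)
    then show ?thesis
      using iso_Abar_positive[OF iso, of "DD n"] bar_type_D[of "n - 2"] hasse_Abar[OF iso] by simp
  qed
  have A3: "hasse ?V ?I = A \<and> poset_positive ?V ?I \<and> has_dynkin_type ?V ?I D"
    if iso: "iso_Abar n A p 3" and D: "positive_type {1..p + 3} (bar_le p 3) D" for p D
    using iso_Abar_positive[OF iso D] hasse_Abar[OF iso] by simp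
  have A4: "hasse ?V ?I = A \<and> poset_principal ?V ?I \<and> has_dynkin_type ?V ?I D"
    if iso: "iso_Abar n A p r" and "r \<noteq> 1" and D: "principal_type {1..p + r} (bar_le p r) D" for p r D
    using iso_Abar_principal[OF iso D] hasse_Abar[OF iso] that(2) by simp
  have E6: "hasse ?V ?I = A \<and> poset_positive ?V ?I \<and> has_dynkin_type ?V ?I DE6" if "iso_Abar n A 3 3"
    using A3[OF that] bar_type_E(1) by simp
  have E7: "hasse ?V ?I = A \<and> poset_positive ?V ?I \<and> has_dynkin_type ?V ?I DE7" if "iso_Abar n A 4 3"
    using A3[OF that] bar_type_E(2) by simp
  have E8: "hasse ?V ?I = A \<and> poset_positive ?V ?I \<and> has_dynkin_type ?V ?I DE8" if "iso_Abar n A 5 3"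
    using A3[OF that] bar_type_E(3) by simp
  have E7p: "hasse ?V ?I = A \<and> poset_principal ?V ?I \<and> has_dynkin_type ?V ?I DE7" if "iso_Abar n A 4 4"
    using A4[OF that] bar_type_E7_principal by simp
  have E8p: "hasse ?V ?I = A \<and> poset_principal ?V ?I \<and> has_dynkin_type ?V ?I DE8" if "iso_Abar n A 6 3"
    using A4[OF that] bar_type_E8_principal by simp
  show ?thesis
  \<comment> \<open>Two-regularity alone separates the alternatives, so in each branch it is enough
    to prove one of them.\<close>
  proof (cases rule: path_or_cycle_labelling)
    case (path \<sigma>)
    have "\<not> two_regular n A" "underlying_is_path n A" "hasse ?V ?I = A"
      "poset_positive ?V ?I" "has_dynkin_type ?V ?I (DA n)"
      using not_two_regular_path[OF path] path_case[OF path] positive_typeD[OF acyc] by auto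
    then show ?thesis unfolding Let_def by blast
  next
    case (cycle \<sigma>)
    have reg: "two_regular n A" "underlying_is_cycle n A"
      using two_regular_cycle[OF cycle(1,2,4)] by auto
    have many: "poset_principal ?V ?I \<and> has_dynkin_type ?V ?I (DA (n - 1)) \<and> hasse ?V ?I = A"
      if "card (sinks n A) > 1"
      using many_sinks_case[OF cycle that] principal_typeD[OF acyc] by auto
    have indef: "poset_indefinite ?V ?I"
      if "card (sinks n A) = 1" "\<not> iso_Abar n A (n - 1) 1 \<and> \<not> iso_Abar n A (n - 2) 2 \<and>
        \<not> iso_Abar n A 3 3 \<and> \<not> iso_Abar n A 4 3 \<and> \<not> iso_Abar n A 5 3 \<and>
        \<not> iso_Abar n A 4 4 \<and> \<not> iso_Abar n A 6 3"
    proof -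
      obtain p r where iso: "iso_Abar n A p r"
        using single_sink_iso_Abar[OF cycle \<open>card (sinks n A) = 1\<close>] by blast
      show ?thesis
        by (rule iso_Abar_indefinite[OF iso iso_Abar_remaining[OF iso]]) (use that(2) in simp_all)
    qed
    show ?thesis
      unfolding Let_def
      by (rule disjI2, rule conjI, rule notI, erule conjE, erule notE, rule reg(1),
          intro conjI[OF reg(1)] conjI[OF reg(2)], rule conjI, rule impI,
          rule conjI, rule impI, erule A1, rule conjI, rule impI, erule A2,
          rule conjI, rule impI, erule E6, rule conjI, rule impI, erule E7,
          rule conjI, rule impI, erule E8, rule conjI, rule impI, erule E7p,
          rule conjI, rule impI, erule E8p, rule impI, rule indef, assumption, assumption,
          rule impI, erule many)
  qed
qed

end
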